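(* Let $d\ge1$ be an integer and let $m,n$ be real numbers with $0\le m\le n$ and $m+n>d/2$. For $p\in[2,+\infty]$ let $p^*\in[2,+\infty]$ be defined by $1/p+1/p^*=1/2$. Then: (i) the set $R_{mnd}:=\{p\in R_{md}:\ p^*\in R_{nd}\}$ is nonempty; (ii) for any $p\in R_{mnd}$ (such that $S_{pmd}$ and $S_{p^*nd}$ are defined) one has $$K_{0mnd}\le S_{pmd}\,S_{p^*nd};$$ so $K_{0mnd}\le\inf_{p} S_{pmd}\,S_{p^*nd}$, the infimum being over such $p\in R_{mnd}$.
   Context: The Fourier transform is normalized so that $\mathcal F f(k)=(2\pi)^{-d/2}\int_{\mathbb R^d}e^{-ik\cdot x}f(x)\,dx$. For real $\ell\ge0$, $H^\ell(\mathbb R^d,\mathbb C)=\{f\in S'(\mathbb R^d,\mathbb C): (1+|k|^2)^{\ell/2}\mathcal F f\in L^2\}$, $\|f\|_\ell=\|(1+|k|^2)^{\ell/2}\mathcal F f\|_{L^2}$; in particular $\|\cdot\|_0=\|\cdot\|_{L^2}$. $K_{0mnd}$ is the sharp constant $$K_{0mnd}:=\min\{K\in[0,+\infty):\ \|fg\|_0\le K\|f\|_m\|g\|_n\ \text{ for all } f\in H^m(\mathbb R^d,\mathbb C),\ g\in H^n(\mathbb R^d,\mathbb C)\}.$$ For $t\in[0,+\infty)$: $$R_{td}:=\begin{cases}[2,\frac{d}{d/2-t}]&\text{if }t\in[0,d/2),\\ [2,+\infty)&\text{if }t=d/2,\\ [2,+\infty]&\text{if }t\in(d/2,+\infty).\end{cases}$$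 The constants $S_{rtd}$ are defined by $$S_{rtd}:=\frac{1}{(4\pi)^{d/4-d/(2r)}}\left(\frac{\Gamma\big(\frac{t}{1-2/r}-\frac d2\big)}{\Gamma\big(\frac{t}{1-2/r}\big)}\right)^{1/2-1/r}\left(\frac{E(1/r)}{E(1-1/r)}\right)^{d/2}$$ if $t\in[0,d/2)$ and $r\in(2,\frac{d}{d/2-t})$, or $t\in[d/2,+\infty)$ and $r\in(2,+\infty)$; $S_{2td}:=1$ for $t\in[0,+\infty)$; and $S_{\infty td}:=\frac1{(4\pi)^{d/4}}\sqrt{\frac{\Gamma(t-d/2)}{\Gamma(t)}}$ for $t\in(d/2,+\infty)$. Here $E(u):=u^u$ for $u>0$ and $E(0):=1$. *)

theory Defs
  imports "HOL-Analysis.Analysis"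
begin

subsection \<open>Schwartz functions and tempered distributions\<close>

text \<open>
  Higher partial derivatives are indexed by lists of coordinate directions instead of
  multi-indices; for smooth functions the order of the list is irrelevant.
\<close>

primrec iter_partial ::
  "'d::finite list \<Rightarrow> (real ^ 'd \<Rightarrow> complex) \<Rightarrow> (real ^ 'd \<Rightarrow> complex)" where
  "iter_partial [] f = f"
| "iter_partial (i # is) f =
     (\<lambda>x. frechet_derivative (iter_partial is f) (at x) (axis i 1))"

definition schwartz :: "(real ^ 'd::finite \<Rightarrow> complex) set" where
  "schwartz = {\<phi>.
     (\<forall>is x. iter_partial is \<phi> differentiable (at x)) \<and>
     (\<forall>is N. bounded (range (\<lambda>x. (1 + norm x) ^ N *\<^sub>R iter_partial is \<phi> x)))}"

definition schwartz_seminorm :: "nat \<Rightarrow> (real ^ 'd::finite \<Rightarrow> complex) \<Rightarrow> real" where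
  "schwartz_seminorm N \<phi> =
     (SUP (is, x) \<in> {is. length is \<le> N} \<times> UNIV. (1 + norm x) ^ N * norm (iter_partial is \<phi> x))"

text \<open>
  A tempered distribution is a functional of which only the values on Schwartz functions matter.
  The seminorms above increase with \<open>N\<close> and generate the usual topology, so continuity
  amounts to being dominated by a multiple of one of them.
\<close>

type_synonym 'd distr = "(real ^ 'd \<Rightarrow> complex) \<Rightarrow> complex"

definition tempered :: "'d::finite distr \<Rightarrow> bool" where
  "tempered T \<longleftrightarrow>
     (\<forall>\<phi>\<in>schwartz. \<forall>\<psi>\<in>schwartz. \<forall>a b. T (\<lambda>x. a * \<phi> x + b * \<psi> x) = a * T \<phi> + b * T \<psi>) \<and>
     (\<exists>C N. \<forall>\<phi>\<in>schwartz. norm (T \<phi>) \<le> C * schwartz_seminorm N \<phi>)"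

text \<open>
  \<open>is_function T f\<close>: the distribution \<open>T\<close> is the function \<open>f\<close>. Restricting to Borel measurable
  \<open>f\<close> loses nothing, because every Lebesgue measurable function has a Borel representative.
\<close>

definition is_function :: "'d::finite distr \<Rightarrow> (real ^ 'd \<Rightarrow> complex) \<Rightarrow> bool" where
  "is_function T f \<longleftrightarrow> f \<in> borel_measurable lborel \<and>
     (\<forall>\<phi>\<in>schwartz. integrable lborel (\<lambda>x. f x * \<phi> x) \<and> T \<phi> = (LINT x|lborel. f x * \<phi> x))"

definition fourier :: "(real ^ 'd::finite \<Rightarrow> complex) \<Rightarrow> (real ^ 'd \<Rightarrow> complex)" where
  "fourier f k = complex_of_real ((2 * pi) powr (- real CARD('d) / 2)) *
     (LINT x|lborel. exp (- \<i> * complex_of_real (k \<bullet> x)) * f x)"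

definition distr_fourier :: "'d::finite distr \<Rightarrow> 'd distr" where
  "distr_fourier T = (\<lambda>\<phi>. T (fourier \<phi>))"

definition distr_mult :: "(real ^ 'd::finite \<Rightarrow> real) \<Rightarrow> 'd distr \<Rightarrow> 'd distr" where
  "distr_mult w T = (\<lambda>\<phi>. T (\<lambda>x. complex_of_real (w x) * \<phi> x))"

subsection \<open>Sobolev spaces\<close>

definition L2 :: "(real ^ 'd::finite \<Rightarrow> complex) set" where
  "L2 = {u \<in> borel_measurable lborel. integrable lborel (\<lambda>x. (norm (u x))\<^sup>2)}"

definition L2_norm :: "(real ^ 'd::finite \<Rightarrow> complex) \<Rightarrow> real" where
  "L2_norm u = sqrt (LINT x|lborel. (norm (u x))\<^sup>2)"

definition sobolev_weighted_fourier :: "real \<Rightarrow> 'd::finite distr \<Rightarrow> 'd distr" where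
  "sobolev_weighted_fourier l T =
     distr_mult (\<lambda>k. (1 + (norm k)\<^sup>2) powr (l / 2)) (distr_fourier T)"

definition sobolev :: "real \<Rightarrow> 'd::finite distr set" where
  "sobolev l = {T. tempered T \<and> (\<exists>u\<in>L2. is_function (sobolev_weighted_fourier l T) u)}"

text \<open>The function chosen here is unique up to null sets.\<close>

definition sobolev_norm :: "real \<Rightarrow> 'd::finite distr \<Rightarrow> real" where
  "sobolev_norm l T = L2_norm (SOME u. u \<in> L2 \<and> is_function (sobolev_weighted_fourier l T) u)"

text \<open>
  For \<open>l \<ge> 0\<close> the elements of \<open>sobolev l\<close> are square integrable functions, and the product of
  two of them is the (locally integrable) pointwise product of the functions. The inequality
  \<open>\<parallel>f g\<parallel>\<^sub>0 \<le> K \<parallel>f\<parallel>\<^sub>m \<parallel>g\<parallel>\<^sub>n\<close> is understood to include that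
  its left-hand side is finite, i.e. that the product lies in \<open>sobolev 0\<close>.
\<close>

definition product_bound :: "'d::finite itself \<Rightarrow> real \<Rightarrow> real \<Rightarrow> real \<Rightarrow> bool" where
  "product_bound TYPE('d) m n K \<longleftrightarrow>
     (\<forall>F \<in> sobolev m :: 'd distr set. \<forall>G \<in> sobolev n. \<forall>f g.
        is_function F f \<and> is_function G g \<longrightarrow>
        (\<exists>H \<in> sobolev 0. is_function H (\<lambda>x. f x * g x) \<and>
           sobolev_norm 0 H \<le> K * sobolev_norm m F * sobolev_norm n G))"

definition K0 :: "'d::finite itself \<Rightarrow> real \<Rightarrow> real \<Rightarrow> real" where
  "K0 d m n = (LEAST K. 0 \<le> K \<and> product_bound d m n K)"

subsection \<open>Exponents and embedding constants\<close>

definition dual_exponent :: "ereal \<Rightarrow> ereal" where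
  "dual_exponent p = (THE q. q \<in> {2..\<infinity>} \<and> 1 / p + 1 / q = 1 / 2)"

definition R_set :: "real \<Rightarrow> nat \<Rightarrow> ereal set" where
  "R_set t d = (if t < real d / 2 then {2 .. ereal (real d / (real d / 2 - t))}
            else if t = real d / 2 then {2 ..< \<infinity>}
            else {2 .. \<infinity>})"

definition R_pair :: "real \<Rightarrow> real \<Rightarrow> nat \<Rightarrow> ereal set" where
  "R_pair m n d = {p \<in> R_set m d. dual_exponent p \<in> R_set n d}"

definition E_fun :: "real \<Rightarrow> real" where
  "E_fun u = (if u = 0 then 1 else u powr u)"

text \<open>The parameters for which the constant \<open>S_const\<close> below is defined.\<close>

definition S_defined :: "ereal \<Rightarrow> real \<Rightarrow> nat \<Rightarrow> bool" where
  "S_defined r t d \<longleftrightarrow> 0 \<le> t \<and>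
     (r = 2 \<or>
      t < real d / 2 \<and> r \<in> {2 <..< ereal (real d / (real d / 2 - t))} \<or>
      t \<ge> real d / 2 \<and> r \<in> {2 <..< \<infinity>} \<or>
      t > real d / 2 \<and> r = \<infinity>)"

definition S_const :: "ereal \<Rightarrow> real \<Rightarrow> nat \<Rightarrow> real" where
  "S_const r t d =
     (if r = 2 then 1
      else if r = \<infinity> then
        1 / (4 * pi) powr (real d / 4) * sqrt (Gamma (t - real d / 2) / Gamma t)
      else let s = real_of_ereal r in
        1 / (4 * pi) powr (real d / 4 - real d / (2 * s))
        * (Gamma (t / (1 - 2 / s) - real d / 2) / Gamma (t / (1 - 2 / s))) powr (1 / 2 - 1 / s)
        * (E_fun (1 / s) / E_fun (1 - 1 / s)) powr (real d / 2))"

definition R_pair_defined :: "real \<Rightarrow> real \<Rightarrow> nat \<Rightarrow> ereal set" where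
  "R_pair_defined m n d =
     {p \<in> R_pair m n d. S_defined p m d \<and> S_defined (dual_exponent p) n d}"

end

theory Submission
  imports Defs "HOL-Probability.Characteristic_Functions"
begin

text \<open>
  Write \<open>f\<close> and \<open>g\<close> as Fourier transforms of \<open>U = (1 + |k|\<^sup>2) powr (-m/2) u\<close> and
  \<open>V = (1 + |k|\<^sup>2) powr (-n/2) v\<close>, where the square integrable functions \<open>u\<close> and \<open>v\<close> carry the Sobolev
  norms. The product \<open>f g\<close> is then a multiple of the Fourier transform of the convolution
  \<open>U * V\<close>, so its norm is at most \<open>(2 pi) powr (-d/2)\<close> times the norm of \<open>|U| * |V|\<close>.

  Let \<open>2 < p < \<infinity>\<close> and let \<open>q\<close> be the dual exponent of \<open>p\<close>. The conjugates \<open>p'\<close> and \<open>q'\<close> satisfy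
  \<open>1/p' + 1/q' = 1 + 1/2\<close>, so Young's convolution inequality maps the pair of Lebesgue spaces with
  exponents \<open>p'\<close> and \<open>q'\<close> to the square integrable functions. Its sharp constant (Beckner,
  Brascamp-Lieb) is exactly the product of the factors built from \<open>E_fun\<close>. The inequality of
  Hoelder bounds the norm of \<open>U\<close> by the norm of \<open>u\<close> times a power of
  \<open>\<integral> (1 + |k|\<^sup>2) powr (-m / (1 - 2/p)) dk\<close>, which is a power of \<open>pi\<close> times a quotient of two values of \<open>Gamma\<close>
  (\<open>nn_integral_bessel_weight\<close>), and the condition that the constants \<open>S_const\<close> are defined says
  precisely that this integral converges. Since \<open>1/p + 1/q = 1/2\<close>, the powers of \<open>pi\<close>
  combine to the product of the two constants (\<open>K0_le_S_const\<close>). For \<open>p = 2\<close> and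
  \<open>p = \<infinity>\<close> one of \<open>U\<close>, \<open>V\<close> is integrable and the Cauchy-Schwarz inequality is enough.

  The sharp Young inequality (\<open>sharp_young\<close>) is proved in the symmetric form of a bound for
  \<open>\<integral>\<integral> F\<^sub>1(x)\<^sup>a F\<^sub>2(y)\<^sup>b F\<^sub>3(x + y)\<^sup>c dx dy\<close> with \<open>a + b + c = 2\<close>, following the transport
  argument of Barthe. On the line, monotone maps \<open>S\<^sub>i\<close> carry the densities \<open>F\<^sub>i\<close> to Gaussians; the
  map \<open>(x, y) \<mapsto> (S\<^sub>1 x + S\<^sub>3 (x + y), S\<^sub>2 y + S\<^sub>3 (x + y))\<close> is injective, and the weighted
  inequality of arithmetic and geometric means bounds its Jacobian from below by the product of
  powers of the derivatives that occurs in the integral. A change of variables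
  leaves a Gaussian integral over the plane. The symmetric form passes from
  the line to products of lines by Fubini's theorem alone.

  Distributions are tested with Gaussians times powers of \<open>1 + |k|\<^sup>2\<close>, the powers cancelling the
  Sobolev weight. Testing with Gaussians determines a function (\<open>heat_kernel_uniqueness\<close>), and together
  with the inequality of Bessel for the Fourier transform
  (\<open>fourier_square_integrable\<close>, \<open>L2_fourier_transform_exists\<close>) this identifies the function of a
  Sobolev distribution as an almost everywhere limit of Fourier transforms of integrable functions
  (\<open>sobolev_function_as_fourier_limit\<close>), for which the convolution theorem is elementary.

  Finally, \<open>K0\<close> is a least element. The norm of the product distribution depends only on the
  product function (\<open>sobolev_norm_0_determined\<close>), so the infimum of the admissible constants
  is admissible and every admissible constant bounds \<open>K0\<close> from above (\<open>K0_le\<close>). The infimum over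
  \<open>p\<close> is taken over a nonempty set because the intervals allowed for \<open>1/p\<close> by the two
  conditions overlap when \<open>m + n > d/2\<close> (\<open>R_pair_defined_nonempty\<close>).
\<close>

section \<open>Lebesgue measure and Gaussian integrals in the plane\<close>

lemma measurable_vector2 [measurable]:
  "(\<lambda>p::real\<times>real. vector [fst p, snd p] :: real^2) \<in> borel_measurable (lborel \<Otimes>\<^sub>M lborel)"
proof -
  have "(\<lambda>p::real\<times>real. vector [fst p, snd p] :: real^2) = (\<lambda>p. fst p *\<^sub>R axis 1 1 + snd p *\<^sub>R axis 2 1)"
    by (rule ext) (auto simp: vec_eq_iff forall_2 axis_def)
  then show ?thesis by simp
qed

text \<open>
  The change of variables theorem lives on \<open>real^2\<close>, while iterated integrals live on products;
  this identity moves between the two.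
\<close>

lemma lborel_real2:
  "(lborel :: (real^2) measure) =
     distr (lborel \<Otimes>\<^sub>M lborel) borel (\<lambda>p. vector [fst p, snd p])"
proof (rule lborel_eqI)
  fix l u :: "real^2" assume le: "\<And>b. b \<in> Basis \<Longrightarrow> l \<bullet> b \<le> u \<bullet> b"
  have pre: "(\<lambda>p. vector [fst p, snd p]) -` box l u = {l$1<..<u$1} \<times> {l$2<..<u$2}"
    by (auto simp: mem_box_cart forall_2)
  have le': "l$1 \<le> u$1" "l$2 \<le> u$2"
    using le[of "axis 1 1"] le[of "axis 2 1"] by (auto simp: inner_axis)
  have B: "Basis = {axis 1 1, axis 2 (1::real) :: real^2}"
    by (auto simp: Basis_vec_def UNIV_2)
  have ne: "axis 1 1 \<noteq> (axis 2 (1::real) :: real^2)"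
    by (auto simp: axis_eq_axis)
  have "emeasure (distr (lborel \<Otimes>\<^sub>M lborel) borel (\<lambda>p. vector [fst p, snd p])) (box l u)
      = emeasure (lborel \<Otimes>\<^sub>M lborel) ({l$1<..<u$1} \<times> {l$2<..<u$2})"
    by (subst emeasure_distr) (auto simp: pre space_pair_measure)
  also have "\<dots> = emeasure lborel {l$1<..<u$1} * emeasure lborel {l$2<..<u$2}"
    by (rule lborel.emeasure_pair_measure_Times) auto
  also have "\<dots> = ennreal (\<Prod>b\<in>Basis. (u - l) \<bullet> b)"
    using le' ne by (simp add: B inner_axis ennreal_mult)
  finally show "emeasure (distr (lborel \<Otimes>\<^sub>M lborel) borel (\<lambda>p. vector [fst p, snd p])) (box l u)
      = ennreal (\<Prod>b\<in>Basis. (u - l) \<bullet> b)" .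
qed simp

lemma nn_integral_real2:
  fixes F :: "real \<Rightarrow> real \<Rightarrow> ennreal"
  assumes [measurable]: "case_prod F \<in> borel_measurable (lborel \<Otimes>\<^sub>M lborel)"
  shows "(\<integral>\<^sup>+v. F (v$1) (v$2) \<partial>(lborel :: (real^2) measure)) = (\<integral>\<^sup>+x. \<integral>\<^sup>+y. F x y \<partial>lborel \<partial>lborel)"
proof -
  have "(\<integral>\<^sup>+v. F (v$1) (v$2) \<partial>(lborel :: (real^2) measure)) = (\<integral>\<^sup>+p. F (fst p) (snd p) \<partial>(lborel \<Otimes>\<^sub>M lborel))"
    by (subst lborel_real2) (subst nn_integral_distr, auto)
  also have "\<dots> = (\<integral>\<^sup>+x. \<integral>\<^sup>+y. F x y \<partial>lborel \<partial>lborel)"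
    by (subst lborel.nn_integral_fst[symmetric]) auto
  finally show ?thesis .
qed

lemma nn_integral_gaussian_shift:
  fixes t m :: real
  assumes "t > 0"
  shows "(\<integral>\<^sup>+x. ennreal (exp (- t * (x - m)\<^sup>2)) \<partial>lborel) = ennreal (sqrt (pi / t))"
proof -
  define s where "s = sqrt (1 / (2 * t))"
  have s: "s > 0" "s\<^sup>2 = 1 / (2*t)" using assms by (auto simp: s_def)
  have nd: "normal_density m s x = sqrt (t / pi) * exp (- t * (x - m)\<^sup>2)" for x
  proof -
    have t: "t = 1 / (2 * s\<^sup>2)" using assms s by simp
    show ?thesis using s(1) unfolding t by (simp add: normal_density_def real_sqrt_divide real_sqrt_mult field_simps)
  qed
  have "(\<integral>\<^sup>+x. ennreal (normal_density m s x) \<partial>lborel) = 1"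
    using prob_space.emeasure_space_1[OF prob_space_normal_density[OF s(1)], of m]
    by (simp add: emeasure_density cong: nn_integral_cong)
  then have "ennreal (sqrt (t / pi)) * (\<integral>\<^sup>+x. ennreal (exp (- t * (x - m)\<^sup>2)) \<partial>lborel) = 1"
    unfolding nd using assms by (subst (asm) ennreal_mult) (auto simp: nn_integral_cmult)
  then have "ennreal (sqrt (pi / t)) * (ennreal (sqrt (t / pi)) * (\<integral>\<^sup>+x. ennreal (exp (- t * (x - m)\<^sup>2)) \<partial>lborel)) = ennreal (sqrt (pi / t))"
    by simp
  then show ?thesis using assms
    by (simp add: mult.assoc[symmetric] ennreal_mult[symmetric] real_sqrt_mult[symmetric] del: ennreal_mult)
qed

text \<open>
  This form is the one that remains after the change of variables below. The sum of the weights
  being \<open>1\<close>, its determinant is \<open>l1 * l2 * l3\<close>.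
\<close>

lemma nn_integral_gaussian_quadratic2:
  fixes l1 l2 l3 :: real
  assumes l: "l1 > 0" "l2 > 0" "l3 > 0" "l1 + l2 + l3 = 1"
  shows "(\<integral>\<^sup>+a. \<integral>\<^sup>+b. ennreal (exp (- (l1*l3*a\<^sup>2 + l2*l3*b\<^sup>2 + l1*l2*(a-b)\<^sup>2))) \<partial>lborel \<partial>lborel)
      = ennreal (pi / sqrt (l1*l2*l3))"
proof -
  define C where "C = l2 * (l1 + l3)"
  have C: "C > 0" using l by (simp add: C_def)
  have sq: "l1*l3*a\<^sup>2 + l2*l3*b\<^sup>2 + l1*l2*(a-b)\<^sup>2 = C * (b - l1*l2*a/C)\<^sup>2 + (l1*l2*l3/C) * (a - 0)\<^sup>2" for a b
  proof -
    have "C * (l1*l3*a\<^sup>2 + l2*l3*b\<^sup>2 + l1*l2*(a-b)\<^sup>2) = (C * b - l1*l2*a)\<^sup>2 + l1*l2*l3*(l1+l2+l3) * a\<^sup>2"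
      by (simp add: C_def power2_eq_square algebra_simps)
    then have "l1*l3*a\<^sup>2 + l2*l3*b\<^sup>2 + l1*l2*(a-b)\<^sup>2 = ((C * b - l1*l2*a)\<^sup>2 + l1*l2*l3 * a\<^sup>2) / C"
      using C l(4) by (simp add: eq_divide_eq mult.commute)
    also have "\<dots> = C * (b - l1*l2*a/C)\<^sup>2 + (l1*l2*l3/C) * (a - 0)\<^sup>2"
      using C by (simp add: power2_eq_square field_simps)
    finally show ?thesis .
  qed
  have "(\<integral>\<^sup>+b. ennreal (exp (- (l1*l3*a\<^sup>2 + l2*l3*b\<^sup>2 + l1*l2*(a-b)\<^sup>2))) \<partial>lborel)
     = ennreal (exp (- (l1*l2*l3/C) * (a-0)\<^sup>2)) * ennreal (sqrt (pi / C))" for a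
  proof -
    have "ennreal (exp (- (l1*l3*a\<^sup>2 + l2*l3*b\<^sup>2 + l1*l2*(a-b)\<^sup>2))) = ennreal (exp (- (l1*l2*l3/C) * (a-0)\<^sup>2)) * ennreal (exp (- C * (b - l1*l2*a/C)\<^sup>2))" for b
      unfolding sq by (subst ennreal_mult[symmetric]) (auto simp flip: exp_add)
    then show ?thesis by (simp only:) (subst nn_integral_cmult, auto simp only: nn_integral_gaussian_shift[OF C], measurable)
  qed
  then have "(\<integral>\<^sup>+a. \<integral>\<^sup>+b. ennreal (exp (- (l1*l3*a\<^sup>2 + l2*l3*b\<^sup>2 + l1*l2*(a-b)\<^sup>2))) \<partial>lborel \<partial>lborel)
    = (\<integral>\<^sup>+a. ennreal (exp (- (l1*l2*l3/C) * (a-0)\<^sup>2)) \<partial>lborel) * ennreal (sqrt (pi / C))"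
    by (simp only:) (subst nn_integral_multc, auto)
  also have "\<dots> = ennreal (sqrt (pi / (l1*l2*l3/C))) * ennreal (sqrt (pi / C))"
    by (subst nn_integral_gaussian_shift) (use C l in auto)
  also have "\<dots> = ennreal (pi / sqrt (l1*l2*l3))"
    using C l by (auto simp flip: ennreal_mult real_sqrt_mult) (simp add: real_sqrt_divide real_sqrt_mult)
  finally show ?thesis .
qed

section \<open>Change of variables for sums of monotone maps\<close>

text \<open>
  The map \<open>(x, y) \<mapsto> (S1 x + S3 (x + y), S2 y + S3 (x + y))\<close> has the second factor of the integrand
  on the left as its Jacobian. It is injective: if \<open>x\<close> grows while the first coordinate is fixed,
  then \<open>x + y\<close> decreases, hence \<open>y\<close> decreases, and both summands of the second coordinate
  decrease. The inequality accounts for points outside the range of the map.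
\<close>

lemma transport_change_of_variables:
  fixes S1 S2 S3 s1 s2 s3 :: "real \<Rightarrow> real" and w :: "real \<Rightarrow> real \<Rightarrow> real"
  assumes D1: "\<And>x. (S1 has_real_derivative s1 x) (at x)"
    and D2: "\<And>x. (S2 has_real_derivative s2 x) (at x)"
    and D3: "\<And>x. (S3 has_real_derivative s3 x) (at x)"
    and pos: "\<And>x. s1 x > 0" "\<And>x. s2 x > 0" "\<And>x. s3 x > 0"
    and cont: "continuous_on UNIV s1" "continuous_on UNIV s2" "continuous_on UNIV s3"
    and w: "continuous_on UNIV (\<lambda>p. w (fst p) (snd p))" "\<And>a b. w a b \<ge> 0"
    and fin: "(\<integral>\<^sup>+a. \<integral>\<^sup>+b. ennreal (w a b) \<partial>lborel \<partial>lborel) < \<infinity>"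
  shows "(\<integral>\<^sup>+x. \<integral>\<^sup>+y. ennreal (w (S1 x + S3 (x+y)) (S2 y + S3 (x+y)) *
             (s1 x * s2 y + s1 x * s3 (x+y) + s2 y * s3 (x+y))) \<partial>lborel \<partial>lborel)
       \<le> (\<integral>\<^sup>+a. \<integral>\<^sup>+b. ennreal (w a b) \<partial>lborel \<partial>lborel)"
proof -
  define g :: "real^2 \<Rightarrow> real^2" where
    "g v = (S1 (v$1) + S3 (v$1 + v$2)) *\<^sub>R axis 1 1 + (S2 (v$2) + S3 (v$1 + v$2)) *\<^sub>R axis 2 1" for v
  define g' :: "real^2 \<Rightarrow> real^2 \<Rightarrow> real^2" where
    "g' v h = (s1 (v$1) * h$1 + s3 (v$1 + v$2) * (h$1 + h$2)) *\<^sub>R axis 1 1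
            + (s2 (v$2) * h$2 + s3 (v$1 + v$2) * (h$1 + h$2)) *\<^sub>R axis 2 1" for v h
  have ax: "axis 1 (1::real) $ (2::2) = 0" "axis 2 (1::real) $ (1::2) = 0" "axis 1 (1::real) $ (1::2) = 1" "axis 2 (1::real) $ (2::2) = 1"
    by (auto simp: axis_def)
  have g1: "g v $ 1 = S1 (v$1) + S3 (v$1 + v$2)" and g2: "g v $ 2 = S2 (v$2) + S3 (v$1 + v$2)" for v
    by (auto simp: g_def ax)
  have dnth: "((\<lambda>v::real^2. v $ i) has_derivative (\<lambda>h. h $ i)) (at v)" for i v
    by (rule bounded_linear_imp_has_derivative[OF bounded_linear_vec_nth])
  have der: "(g has_derivative g' v) (at v)" for v
  proof -
    have e1: "((\<lambda>v::real^2. S1 (v$1)) has_derivative (\<lambda>h. s1 (v$1) * h$1)) (at v)"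
      using DERIV_compose_FDERIV[OF D1 dnth] by (simp add: mult.commute)
    have e2: "((\<lambda>v::real^2. S2 (v$2)) has_derivative (\<lambda>h. s2 (v$2) * h$2)) (at v)"
      using DERIV_compose_FDERIV[OF D2 dnth] by (simp add: mult.commute)
    have e3: "((\<lambda>v::real^2. S3 (v$1+v$2)) has_derivative (\<lambda>h. s3 (v$1+v$2) * (h$1+h$2))) (at v)"
      using DERIV_compose_FDERIV[OF D3 has_derivative_add[OF dnth dnth]] by (simp add: mult.commute)
    show ?thesis unfolding g_def g'_def
      by (intro has_derivative_add has_derivative_scaleR_left e1 e2 e3)
  qed
  have lin: "linear (g' v)" for v
    using der has_derivative_linear by blast
  have J: "det (matrix (g' v)) = s1 (v$1) * s2 (v$2) + s1 (v$1) * s3 (v$1+v$2) + s2 (v$2) * s3 (v$1+v$2)" for v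
    by (simp add: det_2 matrix_def g'_def ax algebra_simps)
  have Jpos: "det (matrix (g' v)) > 0" for v
    unfolding J by (intro add_pos_pos mult_pos_pos pos)
  have mono: "S x < S y" if "\<And>x. (S has_real_derivative s x) (at x)" "\<And>x. s x > 0" "x < y" for S s x and y :: real
    by (rule DERIV_pos_imp_increasing[OF that(3)]) (use that in blast)
  have iff: "S x < S y \<longleftrightarrow> x < y" if "\<And>x. (S has_real_derivative s x) (at x)" "\<And>x. s x > 0" for S s x and y :: real
    using mono[of S s, OF that] by (metis not_less_iff_gr_or_eq)
  note m1 = iff[of S1 s1, OF D1 pos(1)] and m2 = iff[of S2 s2, OF D2 pos(2)] and m3 = iff[of S3 s3, OF D3 pos(3)]
  have inj: "inj g"
  proof (rule injI)
    fix v u assume "g v = g u"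
    then have a: "S1 (v$1) + S3 (v$1 + v$2) = S1 (u$1) + S3 (u$1 + u$2)"
      and b: "S2 (v$2) + S3 (v$1 + v$2) = S2 (u$2) + S3 (u$1 + u$2)"
      by (metis g1, metis g2)
    have "v$1 = u$1 \<and> v$2 = u$2"
      using a b m1[of "v$1" "u$1"] m1[of "u$1" "v$1"] m2[of "v$2" "u$2"] m2[of "u$2" "v$2"]
        m3[of "v$1+v$2" "u$1+u$2"] m3[of "u$1+u$2" "v$1+v$2"] by smt
    then show "v = u" by (simp add: vec_eq_iff forall_2)
  qed
  have contg: "continuous_on UNIV g"
    using der by (meson continuous_at_imp_continuous_on has_derivative_continuous)
  have gm: "range g \<in> sets borel"
  proof -
    have "range g = (\<Union>n::nat. g ` cball 0 (real n))"
    proof -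
      have "(UNIV::(real^2) set) = (\<Union>n::nat. cball 0 (real n))"
        by (auto simp: real_arch_simple)
      then show ?thesis by (metis image_UN)
    qed
    moreover have "closed (g ` cball 0 (real n))" for n
      by (intro compact_imp_closed compact_continuous_image continuous_on_subset[OF contg]) auto
    ultimately show ?thesis by auto
  qed
  define W :: "real^2 \<Rightarrow> real" where "W v = w (v$1) (v$2)" for v
  have Wnonneg: "W v \<ge> 0" for v by (simp add: W_def w)
  have Wc: "continuous_on UNIV W"
    unfolding W_def by (rule continuous_on_compose2[OF w(1), of UNIV "\<lambda>v. (v$1, v$2)", simplified])
       (intro continuous_intros)
  have [measurable]: "W \<in> borel_measurable borel" using Wc by (rule borel_measurable_continuous_onI)
  have [measurable]: "case_prod w \<in> borel_measurable (lborel \<Otimes>\<^sub>M lborel)"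
  proof -
    have "(\<lambda>p. w (fst p) (snd p)) \<in> borel_measurable borel" using w(1) by (rule borel_measurable_continuous_onI)
    moreover have "case_prod w = (\<lambda>p. w (fst p) (snd p))" by (auto simp: split_beta)
    ultimately show ?thesis by (simp add: borel_prod[symmetric] lborel_prod cong: measurable_cong_sets)
  qed
  have Wnn: "(\<integral>\<^sup>+v. ennreal (W v) \<partial>lborel) = (\<integral>\<^sup>+a. \<integral>\<^sup>+b. ennreal (w a b) \<partial>lborel \<partial>lborel)"
    unfolding W_def by (rule nn_integral_real2) measurable
  have Wint: "integrable lborel W"
    by (rule integrableI_nonneg) (use fin in \<open>auto simp: Wnn, auto simp: W_def w\<close>)
  have Wabs: "W absolutely_integrable_on UNIV"
    using Wint by (simp add: set_integrable_def integrable_completion)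
  have Wabs': "W absolutely_integrable_on range g"
    by (rule set_integrable_subset[OF Wabs]) (use gm in auto)
  \<comment> \<open>The change of variables theorem is stated for vector-valued integrands.\<close>
  define f where "f v = (vec (W v) :: real^1)" for v
  have fabs: "f absolutely_integrable_on range g"
    using Wabs' by (simp add: f_def absolutely_integrable_on_1_iff)
  have cov: "(\<lambda>v. \<bar>det (matrix (g' v))\<bar> *\<^sub>R f (g v)) absolutely_integrable_on UNIV \<and>
           integral UNIV (\<lambda>v. \<bar>det (matrix (g' v))\<bar> *\<^sub>R f (g v)) = integral (range g) f"
    by (subst has_absolute_integral_change_of_variables) (use der inj fabs in auto)
  define h where "h v = det (matrix (g' v)) * W (g v)" for v
  have heq: "(\<lambda>v. \<bar>det (matrix (g' v))\<bar> *\<^sub>R f (g v)) = (\<lambda>v. vec (h v))"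
    using Jpos by (intro ext) (simp add: h_def f_def vec_eq_iff abs_of_pos)
  have habs: "h absolutely_integrable_on UNIV"
    using cov unfolding heq by (simp add: absolutely_integrable_on_1_iff)
  have hint: "integral UNIV h = integral (range g) W"
    using cov unfolding heq by (simp add: integral_on_1_eq f_def vec_eq_iff)
  have hnn: "h v \<ge> 0" for v using Jpos[of v] by (simp add: h_def W_def w)
  have [measurable]: "s1 \<in> borel_measurable borel" "s2 \<in> borel_measurable borel" "s3 \<in> borel_measurable borel"
    using cont by (auto intro: borel_measurable_continuous_onI)
  have [measurable]: "g \<in> borel_measurable borel" using contg by (rule borel_measurable_continuous_onI)
  have cS: "continuous_on UNIV S1" "continuous_on UNIV S2" "continuous_on UNIV S3"
    by (intro continuous_at_imp_continuous_on ballI DERIV_isCont[OF D1] DERIV_isCont[OF D2] DERIV_isCont[OF D3])+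
  have [measurable]: "S1 \<in> borel_measurable borel" "S2 \<in> borel_measurable borel" "S3 \<in> borel_measurable borel"
    using cS by (auto intro: borel_measurable_continuous_onI)
  have hm: "h \<in> borel_measurable borel"
    unfolding h_def J by measurable
  have "(\<integral>\<^sup>+v. ennreal (h v) \<partial>lborel) = ennreal (integral UNIV h)"
    by (rule nn_integral_has_integral_lborel[OF hm hnn])
      (use habs in \<open>auto simp: absolutely_integrable_on_def\<close>)
  also have "integral UNIV h \<le> integral UNIV W"
    unfolding hint by (rule integral_subset_le) (use Wabs Wabs' in \<open>auto simp: absolutely_integrable_on_def W_def w\<close>)
  also have "ennreal (integral UNIV W) = (\<integral>\<^sup>+v. ennreal (W v) \<partial>lborel)"
    by (rule nn_integral_has_integral_lborel[symmetric])
      (use Wabs Wnonneg in \<open>auto simp: absolutely_integrable_on_def\<close>)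
  finally have "(\<integral>\<^sup>+v. ennreal (h v) \<partial>lborel) \<le> (\<integral>\<^sup>+a. \<integral>\<^sup>+b. ennreal (w a b) \<partial>lborel \<partial>lborel)"
    using Wnn ennreal_leI by simp
  moreover have "(\<integral>\<^sup>+v. ennreal (h v) \<partial>lborel) = (\<integral>\<^sup>+x. \<integral>\<^sup>+y. ennreal (w (S1 x + S3 (x+y)) (S2 y + S3 (x+y)) *
             (s1 x * s2 y + s1 x * s3 (x+y) + s2 y * s3 (x+y))) \<partial>lborel \<partial>lborel)"
    unfolding h_def J W_def g1 g2
    by (subst mult.commute, rule nn_integral_real2) measurable
  ultimately show ?thesis by simp
qed

section \<open>Monotone transport between densities on the line\<close>

text \<open>
  The antiderivative of a positive integrable function is an increasing bijection onto an interval
  that depends only on the total integral. Two densities of equal mass are therefore related by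
  composing one antiderivative with the inverse of the other.
\<close>

lemma cumulative_integral_bijective:
  fixes f :: "real \<Rightarrow> real"
  assumes f: "continuous_on UNIV f" "\<And>x. f x > 0" "integrable lborel f"
  obtains F where "\<And>x. (F has_real_derivative f x) (at x)" "bij_betw F UNIV {0<..<LINT x|lborel. f x}"
proof -
  define F where "F x = (LINT t|lborel. indicator {..x} t *\<^sub>R f t)" for x
  define I where "I = (LINT x|lborel. f x)"
  have [measurable]: "f \<in> borel_measurable borel" using f(3) by auto
  have ii: "integrable lborel (\<lambda>t. indicator A t *\<^sub>R f t)" if "A \<in> sets borel" for A
    using f(3) that by (intro integrable_mult_indicator) auto
  have inc: "F b = F a + integral {a..b} f" if "a \<le> b" for a b
  proof -
    have "F b = (LINT t|lborel. indicator {..a} t *\<^sub>R f t + indicator {a<..b} t *\<^sub>R f t)"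
      unfolding F_def using that by (intro Bochner_Integration.integral_cong) (auto split: split_indicator)
    also have "\<dots> = F a + (LINT t|lborel. indicator {a<..b} t *\<^sub>R f t)"
      unfolding F_def by (rule Bochner_Integration.integral_add) (rule ii, simp)+
    also have "(LINT t|lborel. indicator {a<..b} t *\<^sub>R f t) = (LINT t|lborel. indicator {a..b} t *\<^sub>R f t)"
    proof (rule integral_cong_AE)
      show "AE t in lborel. indicator {a<..b} t *\<^sub>R f t = indicator {a..b} t *\<^sub>R f t"
        using AE_lborel_singleton[of a] by eventually_elim (auto split: split_indicator)
    qed auto
    also have "\<dots> = integral {a..b} f"
      using set_borel_integral_eq_integral(2)[of "{a..b}" f] ii[of "{a..b}"]
      by (simp add: set_integrable_def set_lebesgue_integral_def)
    finally show ?thesis .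
  qed
  have D: "(F has_real_derivative f x) (at x)" for x
  proof -
    have "((\<lambda>u. integral {x - 1..u} f) has_real_derivative f x) (at x within {x - 1..x + 1})"
      by (rule integral_has_real_derivative) (auto intro: continuous_on_subset[OF f(1)])
    moreover have "at x within {x - 1..x + 1} = at x"
      by (rule at_within_Icc_at) auto
    ultimately have "((\<lambda>u. F (x - 1) + integral {x - 1..u} f) has_real_derivative f x) (at x)"
      by (auto intro!: derivative_eq_intros)
    then show ?thesis
    proof (rule has_field_derivative_transform_within_open)
      show "open {x - 1<..}" "x \<in> {x - 1<..}" by auto
      show "F (x - 1) + integral {x - 1..u} f = F u" if "u \<in> {x - 1<..}" for u
        using inc[of "x - 1" u] that by auto
    qed
  qed
  have mono: "F a < F b" if "a < b" for a b
    by (rule DERIV_pos_imp_increasing[OF that]) (use D f(2) in blast)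
  have ge0: "F x \<ge> 0" for x
    unfolding F_def using f(2) by (intro integral_nonneg_AE) (auto simp: less_imp_le)
  have leI: "F x \<le> I" for x
    unfolding F_def I_def
    by (rule integral_mono[OF ii f(3)]) (use f(2) in \<open>auto split: split_indicator simp: less_imp_le\<close>)
  have top: "(F \<longlongrightarrow> I) at_top"
    unfolding F_def I_def by (rule tendsto_integral_at_top) (use f in auto)
  have bot: "(\<lambda>n. F (- real n)) \<longlonglongrightarrow> 0"
  proof -
    have "(\<lambda>n. F (- real n)) \<longlonglongrightarrow> (LINT t::real|lborel. 0)"
      unfolding F_def
    proof (rule integral_dominated_convergence[where w=f])
      show "AE x in lborel. (\<lambda>i. indicator {..- real i} x *\<^sub>R f x) \<longlonglongrightarrow> 0"
      proof (rule AE_I2)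
        fix x :: real
        obtain n :: nat where n: "- x < real n" using reals_Archimedean2 by blast
        have "eventually (\<lambda>i. indicator {..- real i} x *\<^sub>R f x = 0) sequentially"
          using eventually_ge_at_top[of n] by eventually_elim (use n in \<open>auto split: split_indicator\<close>)
        then show "(\<lambda>i. indicator {..- real i} x *\<^sub>R f x) \<longlonglongrightarrow> 0" by (rule tendsto_eventually)
      qed
      show "AE x in lborel. norm (indicator {..- real i} x *\<^sub>R f x) \<le> f x" for i
        using f(2) by (auto split: split_indicator simp: less_imp_le)
    qed (use f in auto)
    then show ?thesis by simp
  qed
  have cont: "isCont F x" for x using D by (rule DERIV_isCont)
  have "bij_betw F UNIV {0<..<I}"
  proof (rule bij_betw_imageI)
    show "inj F" by (rule injI) (metis mono linorder_neqE_linordered_idom less_irrefl)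
    show "range F = {0<..<I}"
    proof (intro set_eqI iffI)
      fix y assume "y \<in> range F"
      then obtain x where "y = F x" by auto
      then show "y \<in> {0<..<I}"
        using mono[of "x-1" x] ge0[of "x-1"] mono[of x "x+1"] leI[of "x+1"] by auto
    next
      fix y assume y: "y \<in> {0<..<I}"
      obtain n where n: "F (- real n) < y"
        using order_tendstoD(2)[OF bot, of y] y by (auto dest: eventually_happens)
      obtain b where b: "F b > y"
        using order_tendstoD(1)[OF top, of y] y by (auto dest: eventually_happens)
      have "- real n \<le> b" using mono[of b "- real n"] n b by force
      then obtain x where "F x = y"
        using IVT[of F "- real n" y b] n b cont by auto
      then show "y \<in> range F" by auto
    qed
  qed
  then show ?thesis using that D unfolding I_def by blast
qed

lemma transport_map_exists:
  fixes f g :: "real \<Rightarrow> real"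
  assumes f: "continuous_on UNIV f" "\<And>x. f x > 0" "integrable lborel f"
    and g: "continuous_on UNIV g" "\<And>x. g x > 0" "integrable lborel g"
    and eq: "(LINT x|lborel. f x) = (LINT x|lborel. g x)"
  obtains S where "\<And>x. (S has_real_derivative f x / g (S x)) (at x)"
proof -
  obtain F where F: "\<And>x. (F has_real_derivative f x) (at x)" "bij_betw F UNIV {0<..<LINT x|lborel. f x}"
    using cumulative_integral_bijective[OF f] by blast
  obtain G where G: "\<And>x. (G has_real_derivative g x) (at x)" "bij_betw G UNIV {0<..<LINT x|lborel. g x}"
    using cumulative_integral_bijective[OF g] by blast
  have inj: "inj G" using G(2) by (simp add: bij_betw_def)
  have "\<exists>s. G s = F x" for x
  proof -
    have "F x \<in> range G" using F(2) G(2) unfolding eq bij_betw_def by blast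
    then show ?thesis by auto
  qed
  have D: "(inv G has_real_derivative inverse (g s)) (at (G s))" for s
  proof (rule DERIV_inverse_function[where f = G])
    show "(G has_real_derivative g s) (at (inv G (G s)))" using inj G(1) by simp
    show "g s \<noteq> 0" using g(2)[of s] by simp
    show "isCont (inv G) (G s)"
      by (rule isCont_inverse_function[where d=1]) (use inj G(1) DERIV_isCont in auto)
    have r: "range G = {0<..<LINT x|lborel. g x}" using G(2) by (simp add: bij_betw_def)
    show "0 < G s" "G s < (LINT x|lborel. g x)" using r by auto
    show "G (inv G y) = y" if "0 < y" "y < (LINT x|lborel. g x)" for y
      using that r by (intro f_inv_into_f) auto
  qed
  have "((\<lambda>x. inv G (F x)) has_real_derivative f x / g (inv G (F x))) (at x)" for x
  proof -
    obtain s where s: "G s = F x" using \<open>\<exists>s. G s = F x\<close> by blast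
    have "((\<lambda>x. inv G (F x)) has_real_derivative inverse (g s) * f x) (at x)"
      by (rule DERIV_chain2[OF _ F(1)]) (use D[of s] s in simp)
    moreover have "inv G (F x) = s" using s inj by (metis inv_f_f)
    ultimately show ?thesis by (simp add: divide_inverse mult.commute)
  qed
  then show ?thesis by (rule that)
qed

section \<open>The sharp Young inequality on the line\<close>

text \<open>
  For exponent \<open>1 / (1 - l)\<close> this is the constant of Babenko and Beckner: the sharp constant in
  the inequality of Young is the product of three such factors.
\<close>

definition young_const :: "real \<Rightarrow> real" where
  "young_const l = sqrt (l powr l / (1 - l) powr (1 - l))"

text \<open>
  Two applications of the case of two numbers, grouping the first two.
\<close>

lemma weighted_arith_geo_mean3:
  fixes l1 l2 l3 x y z :: real
  assumes l: "l1 > 0" "l2 > 0" "l3 > 0" "l1 + l2 + l3 = 1" and p: "x > 0" "y > 0" "z > 0"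
  shows "x powr l1 * y powr l2 * z powr l3 \<le> l1 * x + l2 * y + l3 * z"
proof -
  define m where "m = l1 + l2"
  have m: "m > 0" using l by (simp add: m_def)
  have "x powr l1 * y powr l2 * z powr l3 = (x powr (l1/m) * y powr (l2/m)) powr m * z powr l3"
    using m p by (simp add: powr_mult powr_powr)
  also have "\<dots> \<le> m * (x powr (l1/m) * y powr (l2/m)) + l3 * z"
    by (rule Youngs_inequality_0) (use l m p in \<open>auto simp: m_def\<close>)
  also have "m * (x powr (l1/m) * y powr (l2/m)) \<le> m * (l1/m * x + l2/m * y)"
    by (intro mult_left_mono Youngs_inequality_0) (use l m p in \<open>auto simp: m_def simp flip: add_divide_distrib\<close>)
  also have "\<dots> = l1 * x + l2 * y" using m by (simp add: field_simps)
  finally show ?thesis by simp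
qed

text \<open>
  The weighted inequality of arithmetic and geometric means for the three products of two of the
  numbers. With weight \<open>l3\<close> on \<open>a * b\<close> and so on, the total exponent of \<open>a\<close> is \<open>l2 + l3 = 1 - l1\<close>.
\<close>

lemma jacobian_lower_bound:
  fixes l1 l2 l3 a b c :: real
  assumes l: "l1 > 0" "l2 > 0" "l3 > 0" "l1 + l2 + l3 = 1" and p: "a > 0" "b > 0" "c > 0"
  shows "a powr (1-l1) * b powr (1-l2) * c powr (1-l3)
      \<le> l1 powr l1 * l2 powr l2 * l3 powr l3 * (a*b + a*c + b*c)"
proof -
  have e: "1 - l1 = l2 + l3" "1 - l2 = l1 + l3" "1 - l3 = l1 + l2" using l by auto
  have "(b*c/l1) powr l1 * (a*c/l2) powr l2 * (a*b/l3) powr l3 \<le> l1 * (b*c/l1) + l2 * (a*c/l2) + l3 * (a*b/l3)"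
    by (rule weighted_arith_geo_mean3) (use l p in auto)
  also have "\<dots> = a*b + a*c + b*c" using l by simp
  finally have "l1 powr l1 * l2 powr l2 * l3 powr l3 * ((b*c/l1) powr l1 * (a*c/l2) powr l2 * (a*b/l3) powr l3)
     \<le> l1 powr l1 * l2 powr l2 * l3 powr l3 * (a*b + a*c + b*c)"
    using l by (intro mult_left_mono) auto
  moreover have "l1 powr l1 * l2 powr l2 * l3 powr l3 * ((b*c/l1) powr l1 * (a*c/l2) powr l2 * (a*b/l3) powr l3)
     = a powr (1-l1) * b powr (1-l2) * c powr (1-l3)"
    using l p unfolding e by (simp add: powr_mult powr_divide powr_add)
  ultimately show ?thesis by simp
qed

text \<open>
  The transport to the density proportional to \<open>exp (- (l / (1 - l)) s\<^sup>2)\<close>. The width is chosen so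
  that the power \<open>1 - l\<close> turns the exponential into \<open>exp (- l s\<^sup>2)\<close>; with this
  choice the estimates in \<open>sharp_young_continuous\<close> are equalities for Gaussians and no constant
  is lost.
\<close>

lemma gaussian_transport:
  fixes f :: "real \<Rightarrow> real"
  assumes f: "continuous_on UNIV f" "\<And>x. f x > 0" "integrable lborel f" and l: "0 < l" "l < 1"
  obtains S s where "\<And>x. (S has_real_derivative s x) (at x)" "\<And>x. s x > 0" "continuous_on UNIV s"
    "\<And>x. f x powr (1 - l) = ((LINT x|lborel. f x) * sqrt (l / ((1 - l) * pi))) powr (1 - l)
        * exp (- l * (S x)\<^sup>2) * s x powr (1 - l)"
proof -
  define I where "I = (LINT x|lborel. f x)"
  define c where "c = 1 - l"
  have c: "c > 0" using l by (simp add: c_def)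
  have lc: "l / c > 0" using l c by auto
  have Ipos: "I > 0"
    using cumulative_integral_bijective[OF f] unfolding I_def bij_betw_def
    by (metis UNIV_I greaterThanLessThan_empty_iff image_is_empty UNIV_not_empty not_le)
  define g where "g t = I * sqrt (l / (c * pi)) * exp (- (l/c) * (t - 0)\<^sup>2)" for t
  have gnn: "(\<integral>\<^sup>+t. ennreal (exp (- (l/c) * (t - 0)\<^sup>2)) \<partial>lborel) = ennreal (sqrt (pi / (l/c)))"
    by (rule nn_integral_gaussian_shift[OF lc])
  have gi: "integrable lborel (\<lambda>t. exp (- (l/c) * (t - 0)\<^sup>2))"
    by (rule integrableI_nonneg) (use gnn in auto)
  have gI: "(LINT t|lborel. exp (- (l/c) * (t - 0)\<^sup>2)) = sqrt (pi / (l/c))"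
    using l c by (subst integral_eq_nn_integral) (use gnn in auto)
  have "(LINT t|lborel. g t) = I * (sqrt (l / (c * pi)) * sqrt (pi / (l/c)))"
    unfolding g_def using gI by simp
  also have "\<dots> = I" using l c by (simp flip: real_sqrt_mult)
  finally have geq: "(LINT x|lborel. f x) = (LINT t|lborel. g t)" by (simp add: I_def)
  have gpos: "g t > 0" for t using Ipos l c by (simp add: g_def)
  have gc: "continuous_on UNIV g" unfolding g_def by (intro continuous_intros)
  have gint: "integrable lborel g" unfolding g_def using gi by simp
  obtain S where S: "\<And>x. (S has_real_derivative f x / g (S x)) (at x)"
    using transport_map_exists[OF f gc gpos gint geq] by blast
  have Sc: "continuous_on UNIV S"
    by (intro continuous_at_imp_continuous_on ballI DERIV_isCont[OF S])
  show ?thesis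
  proof (rule that[OF S])
    show "f x / g (S x) > 0" for x using f(2) gpos by simp
    show "continuous_on UNIV (\<lambda>x. f x / g (S x))"
      using gpos by (intro continuous_intros f(1) continuous_on_compose2[OF gc Sc]) (auto simp: less_imp_neq[THEN not_sym])
    fix x
    have gS: "g (S x) = I * sqrt (l / (c * pi)) * exp (- (l/c) * (S x)\<^sup>2)"
      by (simp add: g_def)
    have "f x powr c = (g (S x) * (f x / g (S x))) powr c"
      using gpos[of "S x"] by simp
    also have "\<dots> = g (S x) powr c * (f x / g (S x)) powr c"
      using gpos[of "S x"] f(2)[of x] by (intro powr_mult)
    also have "g (S x) powr c = (I * sqrt (l / (c * pi))) powr c * exp (- (l/c) * (S x)\<^sup>2) powr c"
      unfolding gS using Ipos l c by (intro powr_mult)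
    also have "exp (- (l/c) * (S x)\<^sup>2) powr c = exp (- l * (S x)\<^sup>2)"
      using c by (simp add: powr_def)
    finally show "f x powr (1 - l) = ((LINT x|lborel. f x) * sqrt (l / ((1 - l) * pi))) powr (1 - l)
        * exp (- l * (S x)\<^sup>2) * (f x / g (S x)) powr (1 - l)"
      by (simp add: c_def I_def)
  qed
qed

text \<open>
  Collects the constants that belong to one of the three functions: the normalization of its Gaussian,
  its share of \<open>jacobian_lower_bound\<close> and its share of the determinant of the quadratic form.
\<close>

lemma young_const_factor:
  assumes l: "0 < l" "l < 1" and I: "I \<ge> 0"
  shows "(I * sqrt (l / ((1 - l) * pi))) powr (1 - l) * (l powr l / sqrt l)
       = young_const l * I powr (1 - l) * pi powr (- (1 - l) / 2)"
proof -
  define c where "c = 1 - l"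
  have c: "c > 0" using l by (simp add: c_def)
  have "ln (sqrt (l / (c * pi)) powr c * (l powr l / sqrt l)) = ln (sqrt (l powr l / c powr c) * pi powr (- c / 2))"
  proof -
    have "ln (sqrt (l / (c * pi)) powr c * (l powr l / sqrt l)) = c * ((ln l - (ln c + ln pi)) / 2) + (l * ln l - ln l / 2)"
      using l c by (simp add: ln_mult ln_div ln_sqrt)
    also have "\<dots> = (l * ln l - c * ln c) / 2 - c / 2 * ln pi"
      unfolding c_def by (simp add: field_simps)
    also have "\<dots> = ln (sqrt (l powr l / c powr c) * pi powr (- c / 2))"
      using l c by (simp add: ln_mult ln_div ln_sqrt)
    finally show ?thesis .
  qed
  then have "sqrt (l / (c * pi)) powr c * (l powr l / sqrt l) = sqrt (l powr l / c powr c) * pi powr (- c / 2)"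
    using l c by (subst (asm) ln_inj_iff) auto
  then have "I powr c * (sqrt (l / (c * pi)) powr c * (l powr l / sqrt l)) = I powr c * (sqrt (l powr l / c powr c) * pi powr (- c / 2))"
    by simp
  moreover have "(I * sqrt (l / (c * pi))) powr c = I powr c * sqrt (l / (c * pi)) powr c"
    using l c I by (intro powr_mult)
  ultimately show ?thesis
    unfolding young_const_def c_def by (simp only: mult_ac)
qed

text \<open>
  Replacing each function by its transport turns the integrand into a Gaussian in the three
  transported variables times powers of the derivatives of the transport maps. The Gaussian depends
  on three variables, but it is dominated by a function of the two coordinates of the
  change of variables, and the derivatives are dominated by the Jacobian.
\<close>

lemma sharp_young_continuous:
  fixes f1 f2 f3 :: "real \<Rightarrow> real"
  assumes l: "l1 > 0" "l2 > 0" "l3 > 0" "l1 + l2 + l3 = 1"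
    and f1: "continuous_on UNIV f1" "\<And>x. f1 x > 0" "integrable lborel f1"
    and f2: "continuous_on UNIV f2" "\<And>x. f2 x > 0" "integrable lborel f2"
    and f3: "continuous_on UNIV f3" "\<And>x. f3 x > 0" "integrable lborel f3"
  shows "(\<integral>\<^sup>+x. \<integral>\<^sup>+y. ennreal (f1 x powr (1-l1) * f2 y powr (1-l2) * f3 (x+y) powr (1-l3)) \<partial>lborel \<partial>lborel)
     \<le> ennreal ((young_const l1 * (LINT x|lborel. f1 x) powr (1-l1)) *
                (young_const l2 * (LINT x|lborel. f2 x) powr (1-l2)) *
                (young_const l3 * (LINT x|lborel. f3 x) powr (1-l3)))"
proof -
  have l': "l1 < 1" "l2 < 1" "l3 < 1" using l by auto
  obtain S1 s1 where S1: "\<And>x. (S1 has_real_derivative s1 x) (at x)" "\<And>x. s1 x > 0" "continuous_on UNIV s1"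
    "\<And>x. f1 x powr (1 - l1) = ((LINT x|lborel. f1 x) * sqrt (l1 / ((1 - l1) * pi))) powr (1 - l1)
        * exp (- l1 * (S1 x)\<^sup>2) * s1 x powr (1 - l1)"
    using gaussian_transport[OF f1 l(1) l'(1)] by blast
  obtain S2 s2 where S2: "\<And>x. (S2 has_real_derivative s2 x) (at x)" "\<And>x. s2 x > 0" "continuous_on UNIV s2"
    "\<And>x. f2 x powr (1 - l2) = ((LINT x|lborel. f2 x) * sqrt (l2 / ((1 - l2) * pi))) powr (1 - l2)
        * exp (- l2 * (S2 x)\<^sup>2) * s2 x powr (1 - l2)"
    using gaussian_transport[OF f2 l(2) l'(2)] by blast
  obtain S3 s3 where S3: "\<And>x. (S3 has_real_derivative s3 x) (at x)" "\<And>x. s3 x > 0" "continuous_on UNIV s3"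
    "\<And>x. f3 x powr (1 - l3) = ((LINT x|lborel. f3 x) * sqrt (l3 / ((1 - l3) * pi))) powr (1 - l3)
        * exp (- l3 * (S3 x)\<^sup>2) * s3 x powr (1 - l3)"
    using gaussian_transport[OF f3 l(3) l'(3)] by blast
  define K1 where "K1 = ((LINT x|lborel. f1 x) * sqrt (l1 / ((1 - l1) * pi))) powr (1 - l1)"
  define K2 where "K2 = ((LINT x|lborel. f2 x) * sqrt (l2 / ((1 - l2) * pi))) powr (1 - l2)"
  define K3 where "K3 = ((LINT x|lborel. f3 x) * sqrt (l3 / ((1 - l3) * pi))) powr (1 - l3)"
  define L where "L = l1 powr l1 * l2 powr l2 * l3 powr l3"
  define w where "w a b = exp (- (l1*l3*a\<^sup>2 + l2*l3*b\<^sup>2 + l1*l2*(a-b)\<^sup>2))" for a b :: real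
  define J where "J x y = s1 x * s2 y + s1 x * s3 (x+y) + s2 y * s3 (x+y)" for x y
  have K: "K1 \<ge> 0" "K2 \<ge> 0" "K3 \<ge> 0" "L \<ge> 0" by (auto simp: K1_def K2_def K3_def L_def)
  have pt: "f1 x powr (1-l1) * f2 y powr (1-l2) * f3 (x+y) powr (1-l3)
     \<le> (K1 * K2 * K3 * L) * (w (S1 x + S3 (x+y)) (S2 y + S3 (x+y)) * J x y)" for x y
  proof -
    define a b c where "a = S1 x" and "b = S2 y" and "c = S3 (x+y)"
    \<comment> \<open>The variance of the numbers \<open>a, b, -c\<close> under the weights, which add up to \<open>1\<close>.\<close>
    have id: "l1*a\<^sup>2 + l2*b\<^sup>2 + l3*c\<^sup>2 - (l1*l3*(a+c)\<^sup>2 + l2*l3*(b+c)\<^sup>2 + l1*l2*((a+c)-(b+c))\<^sup>2) = (l1*a + l2*b - l3*c)\<^sup>2"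
    proof -
      have l3: "l3 = 1 - l1 - l2" using l by simp
      show ?thesis unfolding l3 by (simp add: power2_eq_square algebra_simps)
    qed
    have "exp (- l1 * a\<^sup>2) * exp (- l2 * b\<^sup>2) * exp (- l3 * c\<^sup>2) = exp (- (l1*a\<^sup>2 + l2*b\<^sup>2 + l3*c\<^sup>2))"
      by (simp flip: exp_add)
    also have "\<dots> \<le> w (a + c) (b + c)"
    proof -
      have "l1*l3*(a+c)\<^sup>2 + l2*l3*(b+c)\<^sup>2 + l1*l2*((a+c)-(b+c))\<^sup>2 \<le> l1*a\<^sup>2 + l2*b\<^sup>2 + l3*c\<^sup>2"
        using id zero_le_power2[of "l1*a + l2*b - l3*c"] by linarith
      then show ?thesis unfolding w_def by simp
    qed
    finally have e: "exp (- l1 * a\<^sup>2) * exp (- l2 * b\<^sup>2) * exp (- l3 * c\<^sup>2) \<le> w (a + c) (b + c)" .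
    have j: "s1 x powr (1-l1) * s2 y powr (1-l2) * s3 (x+y) powr (1-l3) \<le> L * J x y"
      unfolding L_def J_def by (rule jacobian_lower_bound[OF l]) (use S1 S2 S3 in auto)
    have "f1 x powr (1-l1) * f2 y powr (1-l2) * f3 (x+y) powr (1-l3) =
       (K1 * K2 * K3) * ((exp (- l1 * a\<^sup>2) * exp (- l2 * b\<^sup>2) * exp (- l3 * c\<^sup>2)) * (s1 x powr (1-l1) * s2 y powr (1-l2) * s3 (x+y) powr (1-l3)))"
      unfolding S1(4) S2(4) S3(4) K1_def K2_def K3_def a_def b_def c_def by (simp only: mult_ac)
    also have "\<dots> \<le> (K1 * K2 * K3) * (w (a + c) (b + c) * (L * J x y))"
      by (intro mult_left_mono mult_mono e j) (use K in \<open>auto simp: w_def\<close>)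
    finally show ?thesis by (simp add: a_def b_def c_def mult_ac)
  qed
  have Q: "(\<integral>\<^sup>+a. \<integral>\<^sup>+b. ennreal (w a b) \<partial>lborel \<partial>lborel) = ennreal (pi / sqrt (l1*l2*l3))"
    unfolding w_def by (rule nn_integral_gaussian_quadratic2[OF l])
  have [measurable]: "s1 \<in> borel_measurable borel" "s2 \<in> borel_measurable borel" "s3 \<in> borel_measurable borel"
    using S1 S2 S3 by (auto intro: borel_measurable_continuous_onI)
  have cS: "continuous_on UNIV S1" "continuous_on UNIV S2" "continuous_on UNIV S3"
    by (intro continuous_at_imp_continuous_on ballI DERIV_isCont[OF S1(1)] DERIV_isCont[OF S2(1)] DERIV_isCont[OF S3(1)])+
  have [measurable]: "S1 \<in> borel_measurable borel" "S2 \<in> borel_measurable borel" "S3 \<in> borel_measurable borel"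
    using cS by (auto intro: borel_measurable_continuous_onI)
  have Jn: "J x y \<ge> 0" for x y
    unfolding J_def using S1(2) S2(2) S3(2) by (simp add: less_imp_le)
  have "(\<integral>\<^sup>+x. \<integral>\<^sup>+y. ennreal (f1 x powr (1-l1) * f2 y powr (1-l2) * f3 (x+y) powr (1-l3)) \<partial>lborel \<partial>lborel)
    \<le> (\<integral>\<^sup>+x. \<integral>\<^sup>+y. ennreal (K1 * K2 * K3 * L) * ennreal (w (S1 x + S3 (x+y)) (S2 y + S3 (x+y)) * J x y) \<partial>lborel \<partial>lborel)"
    using K Jn by (intro nn_integral_mono) (auto simp flip: ennreal_mult simp: w_def intro!: ennreal_leI order_trans[OF pt])
  also have "\<dots> = ennreal (K1 * K2 * K3 * L) * (\<integral>\<^sup>+x. \<integral>\<^sup>+y. ennreal (w (S1 x + S3 (x+y)) (S2 y + S3 (x+y)) * J x y) \<partial>lborel \<partial>lborel)"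
    unfolding w_def J_def by (subst nn_integral_cmult, measurable, rule nn_integral_cmult, measurable)
  also have "\<dots> \<le> ennreal (K1 * K2 * K3 * L) * (\<integral>\<^sup>+a. \<integral>\<^sup>+b. ennreal (w a b) \<partial>lborel \<partial>lborel)"
    unfolding J_def
    by (intro mult_left_mono transport_change_of_variables S1 S2 S3)
      (auto simp: Q, auto simp: w_def intro!: continuous_intros)
  also have "\<dots> = ennreal (K1 * K2 * K3 * L * (pi / sqrt (l1*l2*l3)))"
    unfolding Q using K l by (subst ennreal_mult) auto
  also have "K1 * K2 * K3 * L * (pi / sqrt (l1*l2*l3))
     = (K1 * (l1 powr l1 / sqrt l1)) * (K2 * (l2 powr l2 / sqrt l2)) * (K3 * (l3 powr l3 / sqrt l3)) * pi"
    by (simp add: L_def real_sqrt_mult)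
  also have "\<dots> = (young_const l1 * (LINT x|lborel. f1 x) powr (1-l1)) *
                (young_const l2 * (LINT x|lborel. f2 x) powr (1-l2)) *
                (young_const l3 * (LINT x|lborel. f3 x) powr (1-l3)) * (pi powr (- (1 - l1) / 2) * pi powr (- (1 - l2) / 2) * pi powr (- (1 - l3) / 2) * pi)"
  proof -
    have nn: "(LINT x|lborel. f1 x) \<ge> 0" "(LINT x|lborel. f2 x) \<ge> 0" "(LINT x|lborel. f3 x) \<ge> 0"
      using f1 f2 f3 by (auto intro!: integral_nonneg_AE simp: less_imp_le)
    show ?thesis
      unfolding K1_def K2_def K3_def young_const_factor[OF l(1) l'(1) nn(1)] young_const_factor[OF l(2) l'(2) nn(2)] young_const_factor[OF l(3) l'(3) nn(3)]
      by (simp only: mult_ac)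
  qed
  also have "pi powr (- (1 - l1) / 2) * pi powr (- (1 - l2) / 2) * pi powr (- (1 - l3) / 2) * pi = 1"
  proof -
    have "pi powr (- (1 - l1) / 2) * pi powr (- (1 - l2) / 2) * pi powr (- (1 - l3) / 2) = pi powr (-1)"
    proof -
      have "- (1 - l1) / 2 + - (1 - l2) / 2 + - (1 - l3) / 2 = -1" using l(4) by argo
      then show ?thesis by (simp only: powr_add[symmetric])
    qed
    then show ?thesis by (simp add: powr_minus)
  qed
  finally show ?thesis by simp
qed

text \<open>
  Extends a bound for a functional of one function from continuous positive functions to all
  integrable nonnegative ones, so that the inequality can be extended one function at a time. A
  bounded function of bounded support is an almost everywhere limit of continuous functions, which
  can be truncated and made positive while staying below a fixed integrable function; Fatou's lemma
  gives the bound in the limit, and again for the truncations of a general function.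
\<close>

lemma continuous_power_bound_imp_measurable:
  fixes K :: "real \<Rightarrow> ennreal" and F :: "real \<Rightarrow> real"
  assumes K[measurable]: "K \<in> borel_measurable borel" and C: "C \<ge> 0" and c: "c > 0"
    and bound: "\<And>f. continuous_on UNIV f \<Longrightarrow> (\<And>x. f x > 0) \<Longrightarrow> integrable lborel f \<Longrightarrow>
       (\<integral>\<^sup>+x. ennreal (f x powr c) * K x \<partial>lborel) \<le> ennreal (C * (LINT x|lborel. f x) powr c)"
    and F: "integrable lborel F" "\<And>x. F x \<ge> 0"
  shows "(\<integral>\<^sup>+x. ennreal (F x powr c) * K x \<partial>lborel) \<le> ennreal (C * (LINT x|lborel. F x) powr c)"
proof -
  define e where "e x = exp (- 1 * (x - 0)\<^sup>2)" for x :: real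
  have ec: "continuous_on UNIV e" unfolding e_def by (intro continuous_intros)
  have [measurable]: "e \<in> borel_measurable borel" using ec by (rule borel_measurable_continuous_onI)
  have ei: "integrable lborel e"
    using nn_integral_gaussian_shift[of 1 0]
    by (intro integrableI_nonneg) (simp, simp add: e_def, simp add: e_def)
  have epos: "e x > 0" for x by (simp add: e_def)
  have [measurable]: "F \<in> borel_measurable borel" using F by auto
  have "(\<integral>\<^sup>+x. ennreal (e x powr c) * K x \<partial>lborel) \<noteq> \<infinity>"
    using bound[OF ec epos ei] by (metis ennreal_less_top infinity_ennreal_def linorder_not_less)
  then have "AE x in lborel. ennreal (e x powr c) * K x \<noteq> \<infinity>"
    by (intro nn_integral_PInf_AE) auto
  \<comment> \<open>Finiteness of the kernel makes multiplication by it continuous, which the limits below rely on.\<close>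
  then have Kfin: "AE x in lborel. K x < \<infinity>"
  proof eventually_elim
    case (elim x)
    then show ?case using epos[of x] by (auto simp: ennreal_mult_eq_top_iff less_top)
  qed
  have fatou: "(\<integral>\<^sup>+x. ennreal (G x powr c) * K x \<partial>lborel) \<le> ennreal (C * b powr c)"
    if meas: "\<And>n. g n \<in> borel_measurable borel" and lim: "AE x in lborel. (\<lambda>n. g n x) \<longlonglongrightarrow> G x"
      and nn: "\<And>n x. g n x \<ge> 0"
      and bd: "\<And>n. (\<integral>\<^sup>+x. ennreal (g n x powr c) * K x \<partial>lborel) \<le> ennreal (C * b' n powr c)"
      and b': "b' \<longlonglongrightarrow> b" "\<And>n. b' n \<ge> 0"
    for g :: "nat \<Rightarrow> real \<Rightarrow> real" and G b b'
  proof -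
    have "(\<integral>\<^sup>+x. ennreal (G x powr c) * K x \<partial>lborel) = (\<integral>\<^sup>+x. liminf (\<lambda>n. ennreal (g n x powr c) * K x) \<partial>lborel)"
    proof (rule nn_integral_cong_AE)
      show "AE x in lborel. ennreal (G x powr c) * K x = liminf (\<lambda>n. ennreal (g n x powr c) * K x)"
        using lim Kfin
      proof eventually_elim
        case (elim x)
        have "(\<lambda>n. g n x powr c) \<longlonglongrightarrow> G x powr c"
          by (rule tendsto_powr2) (use elim c nn in auto)
        then have "(\<lambda>n. ennreal (g n x powr c) * K x) \<longlonglongrightarrow> ennreal (G x powr c) * K x"
          using elim unfolding mult.commute[of _ "K x"]
          by (intro ennreal_tendsto_cmult tendsto_ennrealI) auto
        then show ?case by (simp add: lim_imp_Liminf)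
      qed
    qed
    also have "\<dots> \<le> liminf (\<lambda>n. \<integral>\<^sup>+x. ennreal (g n x powr c) * K x \<partial>lborel)"
      by (rule nn_integral_liminf) (use meas in auto)
    also have "\<dots> \<le> liminf (\<lambda>n. ennreal (C * b' n powr c))"
      by (rule Liminf_mono) (use bd in auto)
    also have "\<dots> = ennreal (C * b powr c)"
    proof (rule lim_imp_Liminf)
      have "(\<lambda>n. b' n powr c) \<longlonglongrightarrow> b powr c"
        by (rule tendsto_powr2) (use b' c in auto)
      then show "(\<lambda>n. ennreal (C * b' n powr c)) \<longlonglongrightarrow> ennreal (C * b powr c)"
        by (intro tendsto_ennrealI tendsto_mult tendsto_const)
    qed simp
    finally show ?thesis .
  qed
  have bdd: "(\<integral>\<^sup>+x. ennreal (G x powr c) * K x \<partial>lborel) \<le> ennreal (C * (LINT x|lborel. G x) powr c)"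
    if Gm: "G \<in> borel_measurable borel" and G: "\<And>x. 0 \<le> G x" "\<And>x. G x \<le> M" "\<And>x. \<bar>x\<bar> > M \<Longrightarrow> G x = 0"
    for G :: "real \<Rightarrow> real" and M
  proof -
    have "G \<in> borel_measurable lebesgue" using Gm by (simp add: measurable_completion)
    then have "G measurable_on UNIV" by (simp add: lebesgue_measurable_imp_measurable_on)
    then obtain N g where N: "negligible N" and gc: "\<And>n. continuous_on UNIV (g n)"
      and gl: "\<And>x. x \<notin> N \<Longrightarrow> (\<lambda>n. g n x) \<longlonglongrightarrow> G x"
      unfolding measurable_on_def by auto
    define ch where "ch x = max 0 (min 1 (M + 1 - \<bar>x\<bar>))" for x :: real
    define f where "f n x = min M (max 0 (g n x)) * ch x + e x / (real n + 1)" for n x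
    have M0: "M \<ge> 0" using G(1,2)[of 0] by linarith
    have fc: "continuous_on UNIV (f n)" for n
      unfolding f_def ch_def by (intro continuous_intros gc ec) auto
    have [measurable]: "f n \<in> borel_measurable borel" for n
      using fc by (rule borel_measurable_continuous_onI)
    have fpos: "f n x > 0" for n x
      unfolding f_def by (intro add_nonneg_pos mult_nonneg_nonneg) (use M0 epos in \<open>auto simp: ch_def\<close>)
    define D where "D x = M * indicator {- (M+1)..M+1} x + e x" for x
    have Di: "integrable lborel D"
      unfolding D_def by (intro Bochner_Integration.integrable_add ei integrable_mult_right integrable_real_indicator)
      (auto simp: emeasure_lborel_Icc_eq)
    have dom: "norm (f n x) \<le> D x" for n x
    proof -
      have "min M (max 0 (g n x)) * ch x \<le> M * indicator {- (M+1)..M+1} x"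
      proof (cases "x \<in> {- (M+1)..M+1}")
        case True
        have "min M (max 0 (g n x)) * ch x \<le> M * 1"
          by (rule mult_mono) (use M0 in \<open>auto simp: ch_def\<close>)
        then show ?thesis using True by simp
      next
        case False
        then have "ch x = 0" by (auto simp: ch_def)
        then show ?thesis using False by simp
      qed
      moreover have "e x / (real n + 1) \<le> e x" using epos[of x] by (simp add: field_simps)
      ultimately have "f n x \<le> D x" by (simp add: f_def D_def)
      then show ?thesis using fpos[of n x] by simp
    qed
    have fi: "integrable lborel (f n)" for n
      by (rule Bochner_Integration.integrable_bound[OF Di]) (use dom in \<open>auto intro: order_trans[OF _ abs_ge_self]\<close>)
    have "AE x in lebesgue. x \<notin> N"
      using N negligible_iff_null_sets AE_not_in by blast
    then have "AE x in lborel. x \<notin> N" by (simp add: AE_completion_iff)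
    then have flim: "AE x in lborel. (\<lambda>n. f n x) \<longlonglongrightarrow> G x"
    proof eventually_elim
      case (elim x)
      have "(\<lambda>n. e x / (real n + 1)) \<longlonglongrightarrow> 0"
        using tendsto_mult[OF tendsto_const[of "e x"] LIMSEQ_inverse_real_of_nat]
        by (simp add: divide_inverse add.commute)
      then have "(\<lambda>n. f n x) \<longlonglongrightarrow> min M (max 0 (G x)) * ch x + 0"
        unfolding f_def using elim by (intro tendsto_intros gl)
      moreover have "min M (max 0 (G x)) * ch x + 0 = G x"
        using G[of x] by (cases "\<bar>x\<bar> > M") (auto simp: ch_def)
      ultimately show ?case by simp
    qed
    have lim: "(\<lambda>n. LINT x|lborel. f n x) \<longlonglongrightarrow> (LINT x|lborel. G x)"
      by (rule integral_dominated_convergence[OF _ _ Di flim]) (use Gm dom in auto)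
    show ?thesis
      by (rule fatou[OF _ flim _ _ lim])
        (use fpos bound[OF fc fpos fi] in \<open>auto simp: less_imp_le intro!: integral_nonneg_AE\<close>)
  qed
  define G where "G n x = (if \<bar>x\<bar> \<le> real n then min (F x) (real n) else 0)" for n :: nat and x
  have [measurable]: "G n \<in> borel_measurable borel" for n unfolding G_def by measurable
  have Gn: "0 \<le> G n x" "G n x \<le> F x" for n x using F(2)[of x] by (auto simp: G_def)
  show ?thesis
  proof (rule fatou[where g = G and b' = "\<lambda>n. LINT x|lborel. G n x"])
    show "AE x in lborel. (\<lambda>n. G n x) \<longlonglongrightarrow> F x"
    proof (rule AE_I2)
      fix x
      obtain n :: nat where n: "max \<bar>x\<bar> (F x) \<le> real n" using real_arch_simple by blast
      have "eventually (\<lambda>k. G k x = F x) sequentially"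
        using eventually_ge_at_top[of n] by eventually_elim (use n in \<open>auto simp: G_def\<close>)
      then show "(\<lambda>n. G n x) \<longlonglongrightarrow> F x" by (rule tendsto_eventually)
    qed
    then show "(\<lambda>n. LINT x|lborel. G n x) \<longlonglongrightarrow> (LINT x|lborel. F x)"
      by (intro integral_dominated_convergence[where w=F]) (use F Gn in auto)
    show "(\<integral>\<^sup>+x. ennreal (G n x powr c) * K x \<partial>lborel) \<le> ennreal (C * (LINT x|lborel. G n x) powr c)" for n
      by (rule bdd[of _ "real n"]) (use Gn in \<open>auto simp: G_def\<close>)
  qed (use Gn in \<open>auto intro!: integral_nonneg_AE\<close>)
qed

lemma sharp_young_real:
  fixes f1 f2 f3 :: "real \<Rightarrow> real"
  assumes l: "l1 > 0" "l2 > 0" "l3 > 0" "l1 + l2 + l3 = 1"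
    and f1: "integrable lborel f1" "\<And>x. f1 x \<ge> 0"
    and f2: "integrable lborel f2" "\<And>x. f2 x \<ge> 0"
    and f3: "integrable lborel f3" "\<And>x. f3 x \<ge> 0"
  shows "(\<integral>\<^sup>+x. \<integral>\<^sup>+y. ennreal (f1 x powr (1-l1)) * ennreal (f2 y powr (1-l2)) * ennreal (f3 (x+y) powr (1-l3)) \<partial>lborel \<partial>lborel)
     \<le> ennreal ((young_const l1 * (LINT x|lborel. f1 x) powr (1-l1)) *
                (young_const l2 * (LINT x|lborel. f2 x) powr (1-l2)) *
                (young_const l3 * (LINT x|lborel. f3 x) powr (1-l3)))" (is "?T f1 f2 f3 \<le> ?R f1 f2 f3")
proof -
  have l': "1 - l1 > 0" "1 - l2 > 0" "1 - l3 > 0" using l by auto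
  have yc: "young_const l \<ge> 0" for l by (simp add: young_const_def)
  have step1: "?T f1 g2 g3 \<le> ?R f1 g2 g3"
    if g2: "continuous_on UNIV g2" "\<And>x. g2 x > 0" "integrable lborel g2"
      and g3: "continuous_on UNIV g3" "\<And>x. g3 x > 0" "integrable lborel g3" for g2 g3
  proof -
    have [measurable]: "g2 \<in> borel_measurable borel" "g3 \<in> borel_measurable borel" using g2 g3 by auto
    define K where "K x = (\<integral>\<^sup>+y. ennreal (g2 y powr (1-l2)) * ennreal (g3 (x+y) powr (1-l3)) \<partial>lborel)" for x
    have [measurable]: "K \<in> borel_measurable borel" unfolding K_def by measurable
    have T: "?T h g2 g3 = (\<integral>\<^sup>+x. ennreal (h x powr (1-l1)) * K x \<partial>lborel)" for h
      unfolding K_def mult.assoc by (intro nn_integral_cong nn_integral_cmult) measurable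
    have R: "?R h g2 g3 = ennreal ((young_const l1 * (young_const l2 * (LINT x|lborel. g2 x) powr (1-l2)) *
                (young_const l3 * (LINT x|lborel. g3 x) powr (1-l3))) * (LINT x|lborel. h x) powr (1-l1))" for h
      by (simp add: mult_ac)
    show ?thesis unfolding T R
    proof (rule continuous_power_bound_imp_measurable)
      fix h :: "real \<Rightarrow> real" assume h: "continuous_on UNIV h" "\<And>x. h x > 0" "integrable lborel h"
      show "(\<integral>\<^sup>+x. ennreal (h x powr (1-l1)) * K x \<partial>lborel) \<le> ennreal ((young_const l1 * (young_const l2 * (LINT x|lborel. g2 x) powr (1-l2)) *
                (young_const l3 * (LINT x|lborel. g3 x) powr (1-l3))) * (LINT x|lborel. h x) powr (1-l1))"
        using sharp_young_continuous[OF l h g2 g3] unfolding T[symmetric] R[symmetric] by (simp add: ennreal_mult)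
    qed (use f1 l' yc in auto)
  qed
  have step2: "?T f1 f2 g3 \<le> ?R f1 f2 g3"
    if g3: "continuous_on UNIV g3" "\<And>x. g3 x > 0" "integrable lborel g3" for g3
  proof -
    have [measurable]: "f1 \<in> borel_measurable borel" "f2 \<in> borel_measurable borel" "g3 \<in> borel_measurable borel" using f1 f2 g3 by auto
    define K where "K y = (\<integral>\<^sup>+x. ennreal (f1 x powr (1-l1)) * ennreal (g3 (x+y) powr (1-l3)) \<partial>lborel)" for y
    have [measurable]: "K \<in> borel_measurable borel" unfolding K_def by measurable
    have T: "?T f1 h g3 = (\<integral>\<^sup>+y. ennreal (h y powr (1-l2)) * K y \<partial>lborel)" if [measurable]: "h \<in> borel_measurable borel" for h
    proof -
      have "?T f1 h g3 = (\<integral>\<^sup>+y. \<integral>\<^sup>+x. ennreal (f1 x powr (1-l1)) * ennreal (h y powr (1-l2)) * ennreal (g3 (x+y) powr (1-l3)) \<partial>lborel \<partial>lborel)"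
        by (rule lborel_pair.Fubini') measurable
      also have "\<dots> = (\<integral>\<^sup>+y. \<integral>\<^sup>+x. ennreal (h y powr (1-l2)) * (ennreal (f1 x powr (1-l1)) * ennreal (g3 (x+y) powr (1-l3))) \<partial>lborel \<partial>lborel)"
        by (simp only: mult_ac)
      also have "\<dots> = (\<integral>\<^sup>+y. ennreal (h y powr (1-l2)) * K y \<partial>lborel)"
        unfolding K_def by (intro nn_integral_cong nn_integral_cmult) measurable
      finally show ?thesis .
    qed
    have R: "?R f1 h g3 = ennreal (((young_const l1 * (LINT x|lborel. f1 x) powr (1-l1)) * young_const l2 *
                (young_const l3 * (LINT x|lborel. g3 x) powr (1-l3))) * (LINT x|lborel. h x) powr (1-l2))" for h
      by (simp add: mult_ac)
    show ?thesis unfolding T[OF \<open>f2 \<in> borel_measurable borel\<close>] R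
    proof (rule continuous_power_bound_imp_measurable)
      fix h :: "real \<Rightarrow> real" assume h: "continuous_on UNIV h" "\<And>x. h x > 0" "integrable lborel h"
      have "h \<in> borel_measurable borel" using h by auto
      from step1[OF h g3] show "(\<integral>\<^sup>+y. ennreal (h y powr (1-l2)) * K y \<partial>lborel) \<le> ennreal (((young_const l1 * (LINT x|lborel. f1 x) powr (1-l1)) * young_const l2 *
                (young_const l3 * (LINT x|lborel. g3 x) powr (1-l3))) * (LINT x|lborel. h x) powr (1-l2))"
        unfolding T[OF \<open>h \<in> borel_measurable borel\<close>] R .
    qed (use f2 l' yc in auto)
  qed
  show ?thesis
  proof -
    have [measurable]: "f1 \<in> borel_measurable borel" "f2 \<in> borel_measurable borel" "f3 \<in> borel_measurable borel" using f1 f2 f3 by auto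
    define K where "K z = (\<integral>\<^sup>+x. ennreal (f1 x powr (1-l1)) * ennreal (f2 (z - x) powr (1-l2)) \<partial>lborel)" for z
    have [measurable]: "K \<in> borel_measurable borel" unfolding K_def by measurable
    have T: "?T f1 f2 h = (\<integral>\<^sup>+z. ennreal (h z powr (1-l3)) * K z \<partial>lborel)" if [measurable]: "h \<in> borel_measurable borel" for h
    proof -
      have "(\<integral>\<^sup>+y. ennreal (f1 x powr (1-l1)) * ennreal (f2 y powr (1-l2)) * ennreal (h (x+y) powr (1-l3)) \<partial>lborel)
         = (\<integral>\<^sup>+z. ennreal (f1 x powr (1-l1)) * ennreal (f2 (z - x) powr (1-l2)) * ennreal (h z powr (1-l3)) \<partial>lborel)" for x
        by (subst nn_integral_real_affine[where c=1 and t="-x"]) auto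
      then have "?T f1 f2 h = (\<integral>\<^sup>+x. \<integral>\<^sup>+z. ennreal (f1 x powr (1-l1)) * ennreal (f2 (z - x) powr (1-l2)) * ennreal (h z powr (1-l3)) \<partial>lborel \<partial>lborel)"
        by simp
      also have "\<dots> = (\<integral>\<^sup>+z. \<integral>\<^sup>+x. ennreal (f1 x powr (1-l1)) * ennreal (f2 (z - x) powr (1-l2)) * ennreal (h z powr (1-l3)) \<partial>lborel \<partial>lborel)"
        by (rule lborel_pair.Fubini') measurable
      also have "\<dots> = (\<integral>\<^sup>+z. \<integral>\<^sup>+x. ennreal (h z powr (1-l3)) * (ennreal (f1 x powr (1-l1)) * ennreal (f2 (z - x) powr (1-l2))) \<partial>lborel \<partial>lborel)"
        by (simp only: mult_ac)
      also have "\<dots> = (\<integral>\<^sup>+z. ennreal (h z powr (1-l3)) * K z \<partial>lborel)"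
        unfolding K_def by (intro nn_integral_cong nn_integral_cmult) measurable
      finally show ?thesis .
    qed
    have R: "?R f1 f2 h = ennreal (((young_const l1 * (LINT x|lborel. f1 x) powr (1-l1)) *
                (young_const l2 * (LINT x|lborel. f2 x) powr (1-l2)) * young_const l3) * (LINT x|lborel. h x) powr (1-l3))" for h
      by (simp add: mult_ac)
    show ?thesis unfolding T[OF \<open>f3 \<in> borel_measurable borel\<close>] R
    proof (rule continuous_power_bound_imp_measurable)
      fix h :: "real \<Rightarrow> real" assume h: "continuous_on UNIV h" "\<And>x. h x > 0" "integrable lborel h"
      have "h \<in> borel_measurable borel" using h by auto
      from step2[OF h] show "(\<integral>\<^sup>+z. ennreal (h z powr (1-l3)) * K z \<partial>lborel) \<le> ennreal (((young_const l1 * (LINT x|lborel. f1 x) powr (1-l1)) *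
                (young_const l2 * (LINT x|lborel. f2 x) powr (1-l2)) * young_const l3) * (LINT x|lborel. h x) powr (1-l3))"
        unfolding T[OF \<open>h \<in> borel_measurable borel\<close>] R .
    qed (use f3 l' yc in auto)
  qed
qed

text \<open>
  Real powers with values in the extended nonnegative reals. Partial integrals of a function of
  several variables can be infinite on a null set, and the induction on the number of
  variables has to take powers of them.
\<close>

definition ennreal_powr :: "ennreal \<Rightarrow> real \<Rightarrow> ennreal" where
  "ennreal_powr x c = (if x = \<infinity> then \<infinity> else ennreal (enn2real x powr c))"

lemma ennreal_powr_0 [simp]: "ennreal_powr 0 c = 0"
  by (simp add: ennreal_powr_def)

lemma ennreal_powr_ennreal: "x \<ge> 0 \<Longrightarrow> ennreal_powr (ennreal x) c = ennreal (x powr c)"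
  by (simp add: ennreal_powr_def)

lemma ennreal_powr_eq_0: "ennreal_powr x c = 0 \<longleftrightarrow> x = 0"
  by (cases x) (auto simp: ennreal_powr_def)

lemma measurable_ennreal_powr [measurable (raw)]:
  assumes [measurable]: "f \<in> borel_measurable M"
  shows "(\<lambda>x. ennreal_powr (f x) c) \<in> borel_measurable M"
  unfolding ennreal_powr_def by measurable

lemma AE_lborel_translate:
  fixes x :: "'a::euclidean_space"
  assumes "AE z in lborel. P z"
  shows "AE y in lborel. P (x + y)"
proof -
  have "AE z in distr lborel borel ((+) x). P z"
    using assms by (simp only: lborel_distr_plus)
  then show ?thesis by (rule AE_distrD[rotated]) simp
qed

lemma young_const_pos: "0 < l \<Longrightarrow> l < 1 \<Longrightarrow> young_const l > 0"
  by (simp add: young_const_def)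

text \<open>
  If one of the integrals vanishes, both sides are zero; otherwise an infinite integral makes the
  right hand side infinite. The remaining case is the one of real-valued functions.
\<close>

lemma sharp_young_ennreal:
  fixes F1 F2 F3 :: "real \<Rightarrow> ennreal"
  assumes l: "l1 > 0" "l2 > 0" "l3 > 0" "l1 + l2 + l3 = 1"
    and [measurable]: "F1 \<in> borel_measurable borel" "F2 \<in> borel_measurable borel" "F3 \<in> borel_measurable borel"
  shows "(\<integral>\<^sup>+x. \<integral>\<^sup>+y. ennreal_powr (F1 x) (1-l1) * ennreal_powr (F2 y) (1-l2) * ennreal_powr (F3 (x+y)) (1-l3) \<partial>lborel \<partial>lborel)
     \<le> ennreal (young_const l1 * young_const l2 * young_const l3) *
        (ennreal_powr (\<integral>\<^sup>+x. F1 x \<partial>lborel) (1-l1) * ennreal_powr (\<integral>\<^sup>+x. F2 x \<partial>lborel) (1-l2) * ennreal_powr (\<integral>\<^sup>+x. F3 x \<partial>lborel) (1-l3))"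
    (is "?L \<le> ?R")
proof -
  have l': "l1 < 1" "l2 < 1" "l3 < 1" using l by auto
  note yp = young_const_pos[OF l(1) l'(1)] young_const_pos[OF l(2) l'(2)] young_const_pos[OF l(3) l'(3)]
  have zero: "?L = 0" if "(\<integral>\<^sup>+x. F1 x \<partial>lborel) = 0 \<or> (\<integral>\<^sup>+x. F2 x \<partial>lborel) = 0 \<or> (\<integral>\<^sup>+x. F3 x \<partial>lborel) = 0"
    using that
  proof (elim disjE)
    assume "(\<integral>\<^sup>+x. F1 x \<partial>lborel) = 0"
    then have "AE x in lborel. F1 x = 0" by (simp add: nn_integral_0_iff_AE)
    then have "?L = (\<integral>\<^sup>+x. 0 \<partial>(lborel :: real measure))"
      by (intro nn_integral_cong_AE, use \<open>AE x in lborel. F1 x = 0\<close> in eventually_elim) simp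
    then show ?thesis by simp
  next
    assume "(\<integral>\<^sup>+x. F2 x \<partial>lborel) = 0"
    then have a: "AE x in lborel. F2 x = 0" by (simp add: nn_integral_0_iff_AE)
    have "(\<integral>\<^sup>+y. ennreal_powr (F1 x) (1-l1) * ennreal_powr (F2 y) (1-l2) * ennreal_powr (F3 (x+y)) (1-l3) \<partial>lborel) = (\<integral>\<^sup>+y. 0 \<partial>(lborel :: real measure))" for x
      by (intro nn_integral_cong_AE, use a in eventually_elim) simp
    then show ?thesis by simp
  next
    assume "(\<integral>\<^sup>+x. F3 x \<partial>lborel) = 0"
    then have a: "AE x in lborel. F3 x = 0" by (simp add: nn_integral_0_iff_AE)
    have "(\<integral>\<^sup>+y. ennreal_powr (F1 x) (1-l1) * ennreal_powr (F2 y) (1-l2) * ennreal_powr (F3 (x+y)) (1-l3) \<partial>lborel) = (\<integral>\<^sup>+y. 0 \<partial>(lborel :: real measure))" for x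
      by (intro nn_integral_cong_AE, use AE_lborel_translate[OF a, of x] in eventually_elim) simp
    then show ?thesis by simp
  qed
  consider (z) "(\<integral>\<^sup>+x. F1 x \<partial>lborel) = 0 \<or> (\<integral>\<^sup>+x. F2 x \<partial>lborel) = 0 \<or> (\<integral>\<^sup>+x. F3 x \<partial>lborel) = 0"
    | (i) "(\<integral>\<^sup>+x. F1 x \<partial>lborel) \<noteq> 0" "(\<integral>\<^sup>+x. F2 x \<partial>lborel) \<noteq> 0" "(\<integral>\<^sup>+x. F3 x \<partial>lborel) \<noteq> 0"
       "(\<integral>\<^sup>+x. F1 x \<partial>lborel) = \<infinity> \<or> (\<integral>\<^sup>+x. F2 x \<partial>lborel) = \<infinity> \<or> (\<integral>\<^sup>+x. F3 x \<partial>lborel) = \<infinity>"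
    | (f) "(\<integral>\<^sup>+x. F1 x \<partial>lborel) \<noteq> \<infinity>" "(\<integral>\<^sup>+x. F2 x \<partial>lborel) \<noteq> \<infinity>" "(\<integral>\<^sup>+x. F3 x \<partial>lborel) \<noteq> \<infinity>"
    by blast
  then show ?thesis
  proof cases
    case z
    then show ?thesis using zero by simp
  next
    case i
    have inf: "ennreal_powr top c = top" for c by (simp add: ennreal_powr_def)
    have "?R = \<infinity>"
      using i yp by (elim disjE) (simp_all add: inf ennreal_powr_eq_0 ennreal_mult_eq_top_iff)
    then show ?thesis by simp
  next
    case f
    have red: "AE x in lborel. F x = ennreal (enn2real (F x))" "integrable lborel (\<lambda>x. enn2real (F x))"
       "(\<integral>\<^sup>+x. F x \<partial>lborel) = ennreal (LINT x|lborel. enn2real (F x))"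
      if [measurable]: "F \<in> borel_measurable borel" and fin: "(\<integral>\<^sup>+x. F x \<partial>lborel) \<noteq> \<infinity>" for F :: "real \<Rightarrow> ennreal"
    proof -
      have "AE x in lborel. F x \<noteq> \<infinity>" using fin by (intro nn_integral_PInf_AE) auto
      then show a: "AE x in lborel. F x = ennreal (enn2real (F x))"
        by eventually_elim (simp add: less_top)
      have eq: "(\<integral>\<^sup>+x. F x \<partial>lborel) = (\<integral>\<^sup>+x. ennreal (enn2real (F x)) \<partial>lborel)"
        by (rule nn_integral_cong_AE) (use a in auto)
      show i: "integrable lborel (\<lambda>x. enn2real (F x))"
        by (rule integrableI_nonneg) (use fin eq in \<open>auto simp: less_top\<close>)
      show "(\<integral>\<^sup>+x. F x \<partial>lborel) = ennreal (LINT x|lborel. enn2real (F x))"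
        unfolding eq by (rule nn_integral_eq_integral[OF i]) simp
    qed
    note r1 = red[OF assms(5) f(1)] and r2 = red[OF assms(6) f(2)] and r3 = red[OF assms(7) f(3)]
    define I1 where "I1 = (LINT x|lborel. enn2real (F1 x))"
    define I2 where "I2 = (LINT x|lborel. enn2real (F2 x))"
    define I3 where "I3 = (LINT x|lborel. enn2real (F3 x))"
    have I: "I1 \<ge> 0" "I2 \<ge> 0" "I3 \<ge> 0" by (auto simp: I1_def I2_def I3_def)
    have pow: "ennreal_powr X c = ennreal (enn2real X powr c)" if "X = ennreal (enn2real X)" for X c
      by (subst that, rule ennreal_powr_ennreal) simp
    have "?L = (\<integral>\<^sup>+x. \<integral>\<^sup>+y. ennreal (enn2real (F1 x) powr (1-l1)) * ennreal (enn2real (F2 y) powr (1-l2)) * ennreal (enn2real (F3 (x+y)) powr (1-l3)) \<partial>lborel \<partial>lborel)"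
    proof (rule nn_integral_cong_AE, use r1(1) in eventually_elim)
      case (elim x)
      show ?case
      proof (rule nn_integral_cong_AE, use r2(1) AE_lborel_translate[OF r3(1), of x] in eventually_elim)
        case (elim y)
        show ?case by (simp only: pow[OF \<open>F1 x = _\<close>] pow[OF elim(1)] pow[OF elim(2)])
      qed
    qed
    also have "\<dots> \<le> ennreal ((young_const l1 * I1 powr (1-l1)) * (young_const l2 * I2 powr (1-l2)) * (young_const l3 * I3 powr (1-l3)))"
      unfolding I1_def I2_def I3_def
      by (rule sharp_young_real[OF l]) (use r1 r2 r3 in auto)
    also have "\<dots> = ?R"
      unfolding r1(3) r2(3) r3(3) I1_def[symmetric] I2_def[symmetric] I3_def[symmetric] ennreal_powr_ennreal[OF I(1)] ennreal_powr_ennreal[OF I(2)] ennreal_powr_ennreal[OF I(3)]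
      using yp by (simp add: ennreal_mult[symmetric] mult_ac)
    finally show ?thesis .
  qed
qed

section \<open>The sharp Young inequality in Euclidean spaces\<close>

text \<open>
  Integrate over the old coordinates first, with the new coordinate as a parameter. The induction
  hypothesis bounds the inner integral by powers of the partial integrals, which are functions of
  one variable to which the inequality on the line applies. The constants multiply.
\<close>

lemma sharp_young_PiM:
  fixes F1 F2 F3 :: "('i \<Rightarrow> real) \<Rightarrow> ennreal"
  assumes l: "l1 > 0" "l2 > 0" "l3 > 0" "l1 + l2 + l3 = 1" and I: "finite I"
    and "F1 \<in> borel_measurable (Pi\<^sub>M I (\<lambda>_. lborel))" "F2 \<in> borel_measurable (Pi\<^sub>M I (\<lambda>_. lborel))" "F3 \<in> borel_measurable (Pi\<^sub>M I (\<lambda>_. lborel))"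
  shows "(\<integral>\<^sup>+x. \<integral>\<^sup>+y. ennreal_powr (F1 x) (1-l1) * ennreal_powr (F2 y) (1-l2) * ennreal_powr (F3 (\<lambda>i\<in>I. x i + y i)) (1-l3)
            \<partial>Pi\<^sub>M I (\<lambda>_. lborel) \<partial>Pi\<^sub>M I (\<lambda>_. lborel))
     \<le> ennreal (young_const l1 * young_const l2 * young_const l3) ^ card I *
        (ennreal_powr (\<integral>\<^sup>+x. F1 x \<partial>Pi\<^sub>M I (\<lambda>_. lborel)) (1-l1) * ennreal_powr (\<integral>\<^sup>+x. F2 x \<partial>Pi\<^sub>M I (\<lambda>_. lborel)) (1-l2)
          * ennreal_powr (\<integral>\<^sup>+x. F3 x \<partial>Pi\<^sub>M I (\<lambda>_. lborel)) (1-l3))"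
  using I assms(6-8)
proof (induction I arbitrary: F1 F2 F3)
  case empty
  then show ?case by (simp add: PiM_empty nn_integral_count_space_finite restrict_def)
next
  case (insert i I)
  interpret product_sigma_finite "\<lambda>_::'i. lborel :: real measure" by standard
  interpret M: sigma_finite_measure "Pi\<^sub>M I (\<lambda>_. lborel :: real measure)"
    by (rule sigma_finite) fact
  interpret P: pair_sigma_finite "Pi\<^sub>M I (\<lambda>_. lborel :: real measure)" "lborel :: real measure" ..
  note [measurable] = insert.prems
  define A where "A = ennreal (young_const l1 * young_const l2 * young_const l3)"
  define G1 where "G1 s = (\<integral>\<^sup>+x. F1 (x(i := s)) \<partial>Pi\<^sub>M I (\<lambda>_. lborel))" for s
  define G2 where "G2 s = (\<integral>\<^sup>+x. F2 (x(i := s)) \<partial>Pi\<^sub>M I (\<lambda>_. lborel))" for s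
  define G3 where "G3 s = (\<integral>\<^sup>+x. F3 (x(i := s)) \<partial>Pi\<^sub>M I (\<lambda>_. lborel))" for s
  have G: "(\<integral>\<^sup>+x. F1 x \<partial>Pi\<^sub>M (insert i I) (\<lambda>_. lborel)) = (\<integral>\<^sup>+s. G1 s \<partial>lborel)"
     "(\<integral>\<^sup>+x. F2 x \<partial>Pi\<^sub>M (insert i I) (\<lambda>_. lborel)) = (\<integral>\<^sup>+s. G2 s \<partial>lborel)"
     "(\<integral>\<^sup>+x. F3 x \<partial>Pi\<^sub>M (insert i I) (\<lambda>_. lborel)) = (\<integral>\<^sup>+s. G3 s \<partial>lborel)"
    unfolding G1_def G2_def G3_def by (rule product_nn_integral_insert_rev[OF insert.hyps(1,2)]; fact)+
  have [measurable]: "G1 \<in> borel_measurable borel" "G2 \<in> borel_measurable borel" "G3 \<in> borel_measurable borel"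
    unfolding G1_def G2_def G3_def by measurable
  let ?M = "Pi\<^sub>M I (\<lambda>_. lborel :: real measure)"
  let ?N = "Pi\<^sub>M (insert i I) (\<lambda>_. lborel :: real measure)"
  let ?H = "\<lambda>x y. ennreal_powr (F1 x) (1-l1) * ennreal_powr (F2 y) (1-l2) * ennreal_powr (F3 (\<lambda>i\<in>insert i I. x i + y i)) (1-l3)"
  let ?h = "\<lambda>s t x y. ennreal_powr (F1 (x(i:=s))) (1-l1) * ennreal_powr (F2 (y(i:=t))) (1-l2) * ennreal_powr (F3 ((\<lambda>i\<in>I. x i + y i)(i := s + t))) (1-l3)"
  \<comment> \<open>The sum of two extended tuples extends the sum of the tuples.\<close>
  have upd: "(\<lambda>j\<in>insert i I. (x(i := s)) j + (y(i := t)) j) = (\<lambda>j\<in>I. x j + y j)(i := s + t)" for x y and s t :: real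
    using insert.hyps(2) by (auto simp: fun_eq_iff restrict_def)
  have mF3: "(\<lambda>(x, y). \<lambda>j\<in>insert i I. x j + y j) \<in> measurable (?N \<Otimes>\<^sub>M ?N) ?N"
    by measurable
  interpret N: sigma_finite_measure ?N
    by (rule sigma_finite) (use insert.hyps in simp)
  have mH: "(\<lambda>x. \<integral>\<^sup>+y. ?H x y \<partial>?N) \<in> borel_measurable ?N"
    by measurable
  have mh: "(\<lambda>p. ?h (fst (fst p)) (snd (fst p)) (fst (snd p)) (snd (snd p))) \<in> borel_measurable ((lborel \<Otimes>\<^sub>M lborel) \<Otimes>\<^sub>M (?M \<Otimes>\<^sub>M ?M))"
    by measurable
  have "(\<integral>\<^sup>+x. \<integral>\<^sup>+y. ?H x y \<partial>?N \<partial>?N) = (\<integral>\<^sup>+s. \<integral>\<^sup>+x. \<integral>\<^sup>+y. ?H (x(i := s)) y \<partial>?N \<partial>?M \<partial>lborel)"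
    by (rule product_nn_integral_insert_rev[OF insert.hyps(1,2) mH])
  also have "\<dots> = (\<integral>\<^sup>+s. \<integral>\<^sup>+x. \<integral>\<^sup>+t. \<integral>\<^sup>+y. ?h s t x y \<partial>?M \<partial>lborel \<partial>?M \<partial>lborel)"
  proof (intro nn_integral_cong)
    fix s :: real and x assume s: "s \<in> space lborel" and x: "x \<in> space ?M"
    have xs: "x(i := s) \<in> space ?N" using x by (auto simp: space_PiM PiE_def extensional_def)
    have "(\<lambda>y. ?H (x(i := s)) y) \<in> borel_measurable ?N"
      using xs by measurable
    then have "(\<integral>\<^sup>+y. ?H (x(i := s)) y \<partial>?N) = (\<integral>\<^sup>+t. \<integral>\<^sup>+y. ?H (x(i := s)) (y(i := t)) \<partial>?M \<partial>lborel)"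
      by (rule product_nn_integral_insert_rev[OF insert.hyps(1,2)])
    then show "(\<integral>\<^sup>+y. ?H (x(i := s)) y \<partial>?N) = (\<integral>\<^sup>+t. \<integral>\<^sup>+y. ?h s t x y \<partial>?M \<partial>lborel)"
      unfolding upd .
  qed
  also have "\<dots> = (\<integral>\<^sup>+s. \<integral>\<^sup>+t. \<integral>\<^sup>+x. \<integral>\<^sup>+y. ?h s t x y \<partial>?M \<partial>?M \<partial>lborel \<partial>lborel)"
  proof (intro nn_integral_cong)
    fix s :: real
    show "(\<integral>\<^sup>+x. \<integral>\<^sup>+t. \<integral>\<^sup>+y. ?h s t x y \<partial>?M \<partial>lborel \<partial>?M) = (\<integral>\<^sup>+t. \<integral>\<^sup>+x. \<integral>\<^sup>+y. ?h s t x y \<partial>?M \<partial>?M \<partial>lborel)"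
      by (rule P.Fubini'[symmetric]) measurable
  qed
  also have "\<dots> \<le> (\<integral>\<^sup>+s. \<integral>\<^sup>+t. A ^ card I * (ennreal_powr (G1 s) (1-l1) * ennreal_powr (G2 t) (1-l2) * ennreal_powr (G3 (s+t)) (1-l3)) \<partial>lborel \<partial>lborel)"
    unfolding G1_def G2_def G3_def A_def
    by (intro nn_integral_mono insert.IH) measurable
  also have "\<dots> = A ^ card I * (\<integral>\<^sup>+s. \<integral>\<^sup>+t. ennreal_powr (G1 s) (1-l1) * ennreal_powr (G2 t) (1-l2) * ennreal_powr (G3 (s+t)) (1-l3) \<partial>lborel \<partial>lborel)"
    by (subst nn_integral_cmult, measurable, rule nn_integral_cmult, measurable)
  also have "\<dots> \<le> A ^ card I * (A * (ennreal_powr (\<integral>\<^sup>+s. G1 s \<partial>lborel) (1-l1) * ennreal_powr (\<integral>\<^sup>+s. G2 s \<partial>lborel) (1-l2) * ennreal_powr (\<integral>\<^sup>+s. G3 s \<partial>lborel) (1-l3)))"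
    unfolding A_def by (intro mult_left_mono sharp_young_ennreal l) auto
  also have "\<dots> = A ^ card (insert i I) * (ennreal_powr (\<integral>\<^sup>+s. G1 s \<partial>lborel) (1-l1) * ennreal_powr (\<integral>\<^sup>+s. G2 s \<partial>lborel) (1-l2) * ennreal_powr (\<integral>\<^sup>+s. G3 s \<partial>lborel) (1-l3))"
    using insert.hyps by (simp add: mult_ac)
  finally show ?case unfolding G A_def .
qed

theorem sharp_young:
  fixes F1 F2 F3 :: "'a::euclidean_space \<Rightarrow> ennreal"
  assumes l: "l1 > 0" "l2 > 0" "l3 > 0" "l1 + l2 + l3 = 1"
    and [measurable]: "F1 \<in> borel_measurable borel" "F2 \<in> borel_measurable borel" "F3 \<in> borel_measurable borel"
  shows "(\<integral>\<^sup>+x. \<integral>\<^sup>+y. ennreal_powr (F1 x) (1-l1) * ennreal_powr (F2 y) (1-l2) * ennreal_powr (F3 (x+y)) (1-l3) \<partial>lborel \<partial>lborel)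
     \<le> ennreal (young_const l1 * young_const l2 * young_const l3) ^ DIM('a) *
        (ennreal_powr (\<integral>\<^sup>+x. F1 x \<partial>lborel) (1-l1) * ennreal_powr (\<integral>\<^sup>+x. F2 x \<partial>lborel) (1-l2) * ennreal_powr (\<integral>\<^sup>+x. F3 x \<partial>lborel) (1-l3))"
proof -
  define \<Phi> where "\<Phi> f = (\<Sum>b\<in>Basis. f b *\<^sub>R b)" for f :: "'a \<Rightarrow> real"
  let ?M = "Pi\<^sub>M (Basis :: 'a set) (\<lambda>_. lborel :: real measure)"
  have [measurable]: "\<Phi> \<in> borel_measurable ?M" unfolding \<Phi>_def by measurable
  have tr: "(\<integral>\<^sup>+x. F x \<partial>lborel) = (\<integral>\<^sup>+f. F (\<Phi> f) \<partial>?M)" if "F \<in> borel_measurable borel" for F :: "'a \<Rightarrow> ennreal"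
    using that by (subst lborel_eq) (subst nn_integral_distr, auto simp: \<Phi>_def)
  have add: "\<Phi> f + \<Phi> g = \<Phi> (\<lambda>b\<in>Basis. f b + g b)" for f g
    by (simp add: \<Phi>_def scaleR_add_left sum.distrib)
  have "(\<integral>\<^sup>+x. \<integral>\<^sup>+y. ennreal_powr (F1 x) (1-l1) * ennreal_powr (F2 y) (1-l2) * ennreal_powr (F3 (x+y)) (1-l3) \<partial>lborel \<partial>lborel)
    = (\<integral>\<^sup>+f. \<integral>\<^sup>+g. ennreal_powr (F1 (\<Phi> f)) (1-l1) * ennreal_powr (F2 (\<Phi> g)) (1-l2) * ennreal_powr (F3 (\<Phi> (\<lambda>b\<in>Basis. f b + g b))) (1-l3) \<partial>?M \<partial>?M)"
    by (subst tr, measurable, subst tr, measurable) (simp add: add)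
  also have "\<dots> \<le> ennreal (young_const l1 * young_const l2 * young_const l3) ^ DIM('a) *
        (ennreal_powr (\<integral>\<^sup>+f. F1 (\<Phi> f) \<partial>?M) (1-l1) * ennreal_powr (\<integral>\<^sup>+f. F2 (\<Phi> f) \<partial>?M) (1-l2) * ennreal_powr (\<integral>\<^sup>+f. F3 (\<Phi> f) \<partial>?M) (1-l3))"
    by (rule sharp_young_PiM[OF l finite_Basis, of "\<lambda>f. F1 (\<Phi> f)" "\<lambda>f. F2 (\<Phi> f)" "\<lambda>f. F3 (\<Phi> f)"]) measurable
  finally show ?thesis by (simp add: tr)
qed

section \<open>Gaussian and Bessel weight integrals\<close>

lemma nn_integral_gaussian:
  fixes m :: "'a::euclidean_space"
  assumes "t > 0"
  shows "(\<integral>\<^sup>+x. ennreal (exp (- t * (norm (x - m))\<^sup>2)) \<partial>lborel) = ennreal (sqrt (pi / t) ^ DIM('a))"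
proof -
  have "ennreal (exp (- t * (norm (x - m))\<^sup>2)) = (\<Prod>b\<in>Basis. ennreal (exp (- t * (x \<bullet> b - m \<bullet> b)\<^sup>2)))" for x
  proof -
    have "(norm (x - m))\<^sup>2 = (\<Sum>b\<in>Basis. (x \<bullet> b - m \<bullet> b)\<^sup>2)"
      unfolding power2_norm_eq_inner by (subst euclidean_inner) (simp add: inner_diff_left power2_eq_square)
    then show ?thesis
      by (simp add: prod_ennreal exp_sum[symmetric] sum_distrib_left)
  qed
  then have "(\<integral>\<^sup>+x. ennreal (exp (- t * (norm (x - m))\<^sup>2)) \<partial>lborel)
     = (\<Prod>b\<in>Basis. (\<integral>\<^sup>+x. ennreal (exp (- t * (x - m \<bullet> b)\<^sup>2)) \<partial>lborel))"
    by (simp only:) (rule nn_integral_lborel_prod; simp)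
  also have "\<dots> = ennreal (sqrt (pi / t) ^ DIM('a))"
    using assms by (simp only: nn_integral_gaussian_shift[OF assms] prod_constant ennreal_power) (simp add: ennreal_power)
  finally show ?thesis .
qed

text \<open>
  Represents \<open>a powr (- x)\<close> as a superposition of exponentials in \<open>a\<close>. For \<open>a = 1 + |k|\<^sup>2\<close> these
  are Gaussians in \<open>k\<close>, which is how the next integral is computed.
\<close>

lemma Gamma_scaled_nn_integral:
  assumes x: "x > (0::real)" and a: "a > 0"
  shows "(\<integral>\<^sup>+t. ennreal (indicator {0..} t * t powr (x - 1) * exp (- (a * t))) \<partial>lborel) = ennreal (Gamma x * a powr (- x))"
proof -
  have "ennreal (Gamma x) = (\<integral>\<^sup>+t. ennreal (indicator {0..} t * t powr (x - 1) / exp t) \<partial>lborel)"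
    using Gamma_conv_nn_integral_real[OF x] by simp
  also have "\<dots> = ennreal \<bar>a\<bar> * (\<integral>\<^sup>+t. ennreal (indicator {0..} (0 + a * t) * (0 + a * t) powr (x - 1) / exp (0 + a * t)) \<partial>lborel)"
    using a by (intro nn_integral_real_affine) auto
  also have "(\<lambda>t. ennreal (indicator {0..} (0 + a * t) * (0 + a * t) powr (x - 1) / exp (0 + a * t))) =
     (\<lambda>t. ennreal (a powr (x - 1)) * ennreal (indicator {0..} t * t powr (x - 1) * exp (- (a * t))))"
    using a by (intro ext) (auto simp: ennreal_mult[symmetric] powr_mult exp_minus field_simps zero_le_mult_iff split: split_indicator)
  also have "ennreal \<bar>a\<bar> * (\<integral>\<^sup>+t. ennreal (a powr (x - 1)) * ennreal (indicator {0..} t * t powr (x - 1) * exp (- (a * t))) \<partial>lborel)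
     = ennreal (a powr x) * (\<integral>\<^sup>+t. ennreal (indicator {0..} t * t powr (x - 1) * exp (- (a * t))) \<partial>lborel)"
    using a by (subst nn_integral_cmult) (auto simp: mult.assoc[symmetric] ennreal_mult[symmetric] powr_diff)
  finally have e: "ennreal (Gamma x) = ennreal (a powr x) * (\<integral>\<^sup>+t. ennreal (indicator {0..} t * t powr (x - 1) * exp (- (a * t))) \<partial>lborel)" .
  have "ennreal (a powr (- x)) * ennreal (Gamma x) = ennreal (a powr (- x)) * ennreal (a powr x) * (\<integral>\<^sup>+t. ennreal (indicator {0..} t * t powr (x - 1) * exp (- (a * t))) \<partial>lborel)"
    unfolding e by (simp add: mult.assoc)
  also have "ennreal (a powr (- x)) * ennreal (a powr x) = 1"
    using a by (simp add: ennreal_mult[symmetric] powr_add[symmetric])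
  finally show ?thesis
    using x by (simp add: ennreal_mult[symmetric] Gamma_real_pos less_imp_le mult.commute)
qed

lemma nn_integral_bessel_weight:
  fixes x :: real
  assumes x: "x > real DIM('a) / 2"
  shows "(\<integral>\<^sup>+k. ennreal ((1 + (norm k)\<^sup>2) powr (- x)) \<partial>(lborel :: 'a::euclidean_space measure))
     = ennreal (pi powr (real DIM('a) / 2) * (Gamma (x - real DIM('a) / 2) / Gamma x))"
proof -
  define d where "d = real DIM('a)"
  have x0: "x > 0" "x - d / 2 > 0" using x by (auto simp: d_def intro: le_less_trans[rotated])
  have G: "Gamma x > 0" using x0 by (simp add: Gamma_real_pos)
  let ?k = "\<lambda>(k::'a) t. ennreal (indicator {0..} t * t powr (x - 1) * exp (- ((1 + (norm k)\<^sup>2) * t)))"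
  have "ennreal (Gamma x) * (\<integral>\<^sup>+k. ennreal ((1 + (norm k)\<^sup>2) powr (- x)) \<partial>(lborel :: 'a measure))
     = (\<integral>\<^sup>+k. ennreal (Gamma x * (1 + (norm k)\<^sup>2) powr (- x)) \<partial>(lborel :: 'a measure))"
    using G by (subst nn_integral_cmult[symmetric]) (auto simp: ennreal_mult)
  also have "\<dots> = (\<integral>\<^sup>+k. \<integral>\<^sup>+t. ?k k t \<partial>lborel \<partial>lborel)"
    by (intro nn_integral_cong Gamma_scaled_nn_integral[symmetric] x0) (simp add: add_pos_nonneg)
  also have "\<dots> = (\<integral>\<^sup>+t. \<integral>\<^sup>+k. ?k k t \<partial>lborel \<partial>lborel)"
    by (rule lborel_pair.Fubini'[symmetric]) measurable
  also have "\<dots> = (\<integral>\<^sup>+t. ennreal (pi powr (d/2)) * ennreal (indicator {0..} t * t powr ((x - d/2) - 1) * exp (- (1 * t))) \<partial>lborel)"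
  proof (rule nn_integral_cong)
    fix t :: real
    show "(\<integral>\<^sup>+k. ?k k t \<partial>lborel) = ennreal (pi powr (d/2)) * ennreal (indicator {0..} t * t powr ((x - d/2) - 1) * exp (- (1 * t)))"
    proof (cases "t > 0")
      case True
      have "?k k t = ennreal (t powr (x - 1) * exp (- t)) * ennreal (exp (- t * (norm (k - 0))\<^sup>2))" for k
      proof -
        have "exp (- ((1 + (norm k)\<^sup>2) * t)) = exp (- t) * exp (- t * (norm (k - 0))\<^sup>2)"
          unfolding exp_add[symmetric] by (simp add: algebra_simps)
        then show ?thesis using True by (simp add: ennreal_mult[symmetric] mult_ac)
      qed
      then have "(\<integral>\<^sup>+k. ?k k t \<partial>lborel) = ennreal (t powr (x - 1) * exp (- t)) * ennreal (sqrt (pi / t) ^ DIM('a))"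
        by (simp only:) (subst nn_integral_cmult, simp, simp only: nn_integral_gaussian[OF True])
      also have "sqrt (pi / t) ^ DIM('a) = pi powr (d/2) * t powr (- (d/2))"
      proof -
        have "sqrt (pi / t) ^ DIM('a) = sqrt (pi / t) powr d"
          unfolding d_def by (rule powr_realpow[symmetric]) (use True in simp)
        also have "\<dots> = ((pi / t) powr (1/2)) powr d"
          using True by (simp add: powr_half_sqrt)
        also have "\<dots> = pi powr (d/2) * t powr (- (d/2))"
          using True by (simp add: powr_powr powr_divide powr_minus_divide)
        finally show ?thesis .
      qed
      also have "ennreal (t powr (x - 1) * exp (- t)) * ennreal (pi powr (d/2) * t powr (- (d/2))) =
          ennreal (pi powr (d/2)) * ennreal (t powr (x - 1) * t powr (- (d/2)) * exp (- t))"
        by (simp add: ennreal_mult[symmetric] mult_ac)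
      also have "t powr (x - 1) * t powr (- (d/2)) = t powr ((x - d/2) - 1)"
        by (subst powr_add[symmetric]) (simp add: algebra_simps)
      finally show ?thesis using True by simp
    next
      case False
      then have z: "t < 0 \<or> t = 0" by auto
      have "?k k t = 0" for k using z by (auto split: split_indicator)
      then show ?thesis using z by (auto split: split_indicator)
    qed
  qed
  also have "\<dots> = ennreal (pi powr (d/2)) * ennreal (Gamma (x - d/2) * 1 powr (- (x - d/2)))"
    by (subst nn_integral_cmult) (simp, simp only: Gamma_scaled_nn_integral[OF x0(2) zero_less_one])
  finally have e: "ennreal (Gamma x) * (\<integral>\<^sup>+k. ennreal ((1 + (norm k)\<^sup>2) powr (- x)) \<partial>(lborel :: 'a measure)) = ennreal (pi powr (d/2) * Gamma (x - d/2))"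
    using x0 by (simp add: ennreal_mult[symmetric] Gamma_real_pos less_imp_le)
  have "(\<integral>\<^sup>+k. ennreal ((1 + (norm k)\<^sup>2) powr (- x)) \<partial>(lborel :: 'a measure)) =
     ennreal (1 / Gamma x) * (ennreal (Gamma x) * (\<integral>\<^sup>+k. ennreal ((1 + (norm k)\<^sup>2) powr (- x)) \<partial>(lborel :: 'a measure)))"
    using G by (simp add: mult.assoc[symmetric] ennreal_mult[symmetric])
  also have "\<dots> = ennreal (pi powr (d/2) * (Gamma (x - d/2) / Gamma x))"
    unfolding e using G x0 by (simp add: ennreal_mult[symmetric] Gamma_real_pos less_imp_le)
  finally show ?thesis by (simp add: d_def)
qed

lemma integrable_bessel_weight:
  assumes "x > real DIM('a) / 2"
  shows "integrable lborel (\<lambda>k::'a::euclidean_space. (1 + (norm k)\<^sup>2) powr (- x))"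
    and "(LINT k|(lborel :: 'a measure). (1 + (norm k)\<^sup>2) powr (- x)) = pi powr (real DIM('a) / 2) * (Gamma (x - real DIM('a) / 2) / Gamma x)"
proof -
  have "0 \<le> real DIM('a) / 2" by simp
  then have G: "Gamma x > 0" "Gamma (x - real DIM('a) / 2) > 0" using assms by (auto intro!: Gamma_real_pos)
  show "integrable lborel (\<lambda>k::'a. (1 + (norm k)\<^sup>2) powr (- x))"
    by (rule integrableI_nonneg) (use nn_integral_bessel_weight[OF assms] in auto)
  show "(LINT k|(lborel :: 'a measure). (1 + (norm k)\<^sup>2) powr (- x)) = pi powr (real DIM('a) / 2) * (Gamma (x - real DIM('a) / 2) / Gamma x)"
    by (subst integral_eq_nn_integral) (use nn_integral_bessel_weight[OF assms] G in auto)
qed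

section \<open>The inequalities of Hoelder and Cauchy-Schwarz\<close>

text \<open>
  After normalizing both integrals to \<open>1\<close> this is the pointwise inequality between weighted
  geometric and arithmetic means.
\<close>

lemma nn_integral_Holder:
  fixes f g :: "'a \<Rightarrow> real"
  assumes ab: "\<alpha> > 0" "\<beta> > 0" "\<alpha> + \<beta> = 1"
    and f: "integrable M f" "\<And>x. f x \<ge> 0" and g: "integrable M g" "\<And>x. g x \<ge> 0"
  shows "(\<integral>\<^sup>+x. ennreal (f x powr \<alpha> * g x powr \<beta>) \<partial>M) \<le> ennreal ((LINT x|M. f x) powr \<alpha> * (LINT x|M. g x) powr \<beta>)"
proof -
  define A where "A = (LINT x|M. f x)"
  define B where "B = (LINT x|M. g x)"
  have AB: "A \<ge> 0" "B \<ge> 0" using f g by (auto simp: A_def B_def intro!: integral_nonneg_AE)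
  show ?thesis
  proof (cases "A = 0 \<or> B = 0")
    case True
    then have "(AE x in M. f x = 0) \<or> (AE x in M. g x = 0)"
      using integral_nonneg_eq_0_iff_AE[OF f(1)] integral_nonneg_eq_0_iff_AE[OF g(1)] f(2) g(2) by (auto simp: A_def B_def)
    then have "AE x in M. ennreal (f x powr \<alpha> * g x powr \<beta>) = 0"
      by (elim disjE) (auto elim!: eventually_mono)
    then have "(\<integral>\<^sup>+x. ennreal (f x powr \<alpha> * g x powr \<beta>) \<partial>M) = (\<integral>\<^sup>+x. 0 \<partial>M)"
      by (rule nn_integral_cong_AE)
    then show ?thesis by simp
  next
    case False
    then have pos: "A > 0" "B > 0" using AB by auto
    have le: "f x powr \<alpha> * g x powr \<beta> \<le> A powr \<alpha> * B powr \<beta> * (\<alpha> * (f x / A) + \<beta> * (g x / B))" for x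
    proof (cases "f x = 0 \<or> g x = 0")
      case True
      then show ?thesis using ab pos f(2)[of x] g(2)[of x] by (auto intro!: mult_nonneg_nonneg add_nonneg_nonneg)
    next
      case False
      then have "f x > 0" "g x > 0" using f(2)[of x] g(2)[of x] by (auto simp: less_le)
      then have "(f x / A) powr \<alpha> * (g x / B) powr \<beta> \<le> \<alpha> * (f x / A) + \<beta> * (g x / B)"
        using pos ab by (intro Youngs_inequality_0) auto
      then have "A powr \<alpha> * B powr \<beta> * ((f x / A) powr \<alpha> * (g x / B) powr \<beta>) \<le> A powr \<alpha> * B powr \<beta> * (\<alpha> * (f x / A) + \<beta> * (g x / B))"
        by (intro mult_left_mono) auto
      then show ?thesis using pos \<open>f x > 0\<close> \<open>g x > 0\<close> by (simp add: powr_divide)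
    qed
    have i: "integrable M (\<lambda>x. A powr \<alpha> * B powr \<beta> * (\<alpha> * (f x / A) + \<beta> * (g x / B)))"
      using f g by auto
    have "(\<integral>\<^sup>+x. ennreal (f x powr \<alpha> * g x powr \<beta>) \<partial>M) \<le> (\<integral>\<^sup>+x. ennreal (A powr \<alpha> * B powr \<beta> * (\<alpha> * (f x / A) + \<beta> * (g x / B))) \<partial>M)"
      by (intro nn_integral_mono ennreal_leI le)
    also have "\<dots> = ennreal (LINT x|M. A powr \<alpha> * B powr \<beta> * (\<alpha> * (f x / A) + \<beta> * (g x / B)))"
      by (rule nn_integral_eq_integral[OF i])
        (use f(2) g(2) ab pos in \<open>auto intro!: mult_nonneg_nonneg add_nonneg_nonneg\<close>)
    also have "(LINT x|M. A powr \<alpha> * B powr \<beta> * (\<alpha> * (f x / A) + \<beta> * (g x / B))) = A powr \<alpha> * B powr \<beta> * (\<alpha> * (A / A) + \<beta> * (B / B))"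
      using f g by (simp add: A_def B_def)
    also have "\<dots> = A powr \<alpha> * B powr \<beta>" using pos ab by simp
    finally show ?thesis by (simp add: A_def B_def)
  qed
qed

lemma nn_integral_Cauchy_Schwarz:
  fixes f g :: "'a \<Rightarrow> real"
  assumes f: "integrable M (\<lambda>x. (f x)\<^sup>2)" "\<And>x. f x \<ge> 0" and g: "integrable M (\<lambda>x. (g x)\<^sup>2)" "\<And>x. g x \<ge> 0"
  shows "(\<integral>\<^sup>+x. ennreal (f x * g x) \<partial>M) \<le> ennreal (sqrt (LINT x|M. (f x)\<^sup>2) * sqrt (LINT x|M. (g x)\<^sup>2))"
  using nn_integral_Holder[of "1/2" "1/2" M "\<lambda>x. (f x)\<^sup>2" "\<lambda>x. (g x)\<^sup>2"] f g
  by (simp add: powr_half_sqrt)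

section \<open>Weighted trilinear estimates\<close>

text \<open>
  The dual form of the statement that the convolution of \<open>u \<omega>1\<close> and \<open>v \<omega>2\<close> is square integrable
  with norm at most \<open>B\<close> times the norms of \<open>u\<close> and \<open>v\<close>. Being an inequality for nonnegative functions, it
  involves no question of convergence.
\<close>

definition trilinear_bound :: "('a::euclidean_space \<Rightarrow> real) \<Rightarrow> ('a \<Rightarrow> real) \<Rightarrow> real \<Rightarrow> bool" where
  "trilinear_bound \<omega>1 \<omega>2 B \<longleftrightarrow> (\<forall>u v h.
     u \<in> borel_measurable borel \<longrightarrow> v \<in> borel_measurable borel \<longrightarrow> h \<in> borel_measurable borel \<longrightarrow>
     (\<forall>x. u x \<ge> 0) \<longrightarrow> (\<forall>x. v x \<ge> 0) \<longrightarrow> (\<forall>x. h x \<ge> 0) \<longrightarrow>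
     integrable lborel (\<lambda>x. (u x)\<^sup>2) \<longrightarrow> integrable lborel (\<lambda>x. (v x)\<^sup>2) \<longrightarrow> integrable lborel (\<lambda>x. (h x)\<^sup>2) \<longrightarrow>
     (\<integral>\<^sup>+x. \<integral>\<^sup>+y. ennreal ((u x * \<omega>1 x) * (v y * \<omega>2 y) * h (x + y)) \<partial>lborel \<partial>lborel)
       \<le> ennreal (B * sqrt (LINT x|lborel. (u x)\<^sup>2) * sqrt (LINT x|lborel. (v x)\<^sup>2) * sqrt (LINT x|lborel. (h x)\<^sup>2)))"

lemma integral_lborel_translate:
  fixes f :: "'a::euclidean_space \<Rightarrow> 'b::{banach, second_countable_topology}"
  assumes "integrable lborel f"
  shows "integrable lborel (\<lambda>y. f (x + y))" "(LINT y|lborel. f (x + y)) = (LINT y|lborel. f y)"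
proof -
  have m: "f \<in> borel_measurable borel" using assms by auto
  have "integrable (distr lborel borel ((+) x)) f" using assms by (simp add: lborel_distr_plus)
  then show "integrable lborel (\<lambda>y. f (x + y))" using m by (subst (asm) integrable_distr_eq) auto
  have "(LINT y|lborel. f y) = (LINT y|distr lborel borel ((+) x). f y)" by (simp add: lborel_distr_plus)
  also have "\<dots> = (LINT y|lborel. f (x + y))" using m by (subst integral_distr) auto
  finally show "(LINT y|lborel. f (x + y)) = (LINT y|lborel. f y)" by simp
qed

text \<open>
  Here \<open>u \<omega>1\<close> is integrable, and a convolution with an integrable function is an average of
  translations.
\<close>

lemma trilinear_bound_square_integrable_left:
  fixes \<omega>1 \<omega>2 :: "'a::euclidean_space \<Rightarrow> real"
  assumes [measurable]: "\<omega>1 \<in> borel_measurable borel" "\<omega>2 \<in> borel_measurable borel"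
    and w1: "integrable lborel (\<lambda>x. (\<omega>1 x)\<^sup>2)" "\<And>x. \<omega>1 x \<ge> 0" and w2: "\<And>x. 0 \<le> \<omega>2 x" "\<And>x. \<omega>2 x \<le> 1"
  shows "trilinear_bound \<omega>1 \<omega>2 (sqrt (LINT x|lborel. (\<omega>1 x)\<^sup>2))"
  unfolding trilinear_bound_def
proof (intro allI impI)
  fix u v h :: "'a \<Rightarrow> real"
  assume [measurable]: "u \<in> borel_measurable borel" "v \<in> borel_measurable borel" "h \<in> borel_measurable borel"
    and nn: "\<forall>x. u x \<ge> 0" "\<forall>x. v x \<ge> 0" "\<forall>x. h x \<ge> 0"
    and sq: "integrable lborel (\<lambda>x. (u x)\<^sup>2)" "integrable lborel (\<lambda>x. (v x)\<^sup>2)" "integrable lborel (\<lambda>x. (h x)\<^sup>2)"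
  define N where "N f = sqrt (LINT x|lborel. (f x)\<^sup>2)" for f :: "'a \<Rightarrow> real"
  have Nn: "N f \<ge> 0" for f by (simp add: N_def)
  have "(\<integral>\<^sup>+x. \<integral>\<^sup>+y. ennreal ((u x * \<omega>1 x) * (v y * \<omega>2 y) * h (x + y)) \<partial>lborel \<partial>lborel)
    \<le> (\<integral>\<^sup>+x. ennreal (u x * \<omega>1 x) * ennreal (N v * N h) \<partial>lborel)"
  proof (rule nn_integral_mono)
    fix x :: 'a
    have "(\<integral>\<^sup>+y. ennreal ((u x * \<omega>1 x) * (v y * \<omega>2 y) * h (x + y)) \<partial>lborel) \<le> (\<integral>\<^sup>+y. ennreal (u x * \<omega>1 x) * ennreal (v y * h (x + y)) \<partial>lborel)"
    proof (intro nn_integral_mono)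
      fix y :: 'a
      have "v y * \<omega>2 y * h (x + y) \<le> v y * 1 * h (x + y)"
        by (intro mult_right_mono mult_left_mono) (use nn w2 in auto)
      then have "(u x * \<omega>1 x) * (v y * \<omega>2 y * h (x + y)) \<le> (u x * \<omega>1 x) * (v y * h (x + y))"
        using nn w1 by (intro mult_left_mono) auto
      then show "ennreal ((u x * \<omega>1 x) * (v y * \<omega>2 y) * h (x + y)) \<le> ennreal (u x * \<omega>1 x) * ennreal (v y * h (x + y))"
        using nn w1 by (subst ennreal_mult[symmetric]) (auto intro!: ennreal_leI simp: mult.assoc)
    qed
    also have "\<dots> = ennreal (u x * \<omega>1 x) * (\<integral>\<^sup>+y. ennreal (v y * h (x + y)) \<partial>lborel)"
      by (rule nn_integral_cmult) measurable
    also have "(\<integral>\<^sup>+y. ennreal (v y * h (x + y)) \<partial>lborel) \<le> ennreal (N v * N h)"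
      using nn_integral_Cauchy_Schwarz[of lborel v "\<lambda>y. h (x + y)"] sq nn integral_lborel_translate[OF sq(3), of x]
      by (simp add: N_def)
    finally show "(\<integral>\<^sup>+y. ennreal ((u x * \<omega>1 x) * (v y * \<omega>2 y) * h (x + y)) \<partial>lborel) \<le> ennreal (u x * \<omega>1 x) * ennreal (N v * N h)"
      by (simp add: mult_left_mono)
  qed
  also have "\<dots> = (\<integral>\<^sup>+x. ennreal (u x * \<omega>1 x) \<partial>lborel) * ennreal (N v * N h)"
    by (rule nn_integral_multc) measurable
  also have "\<dots> \<le> ennreal (N u * N \<omega>1) * ennreal (N v * N h)"
    by (rule mult_right_mono) (use nn_integral_Cauchy_Schwarz[of lborel u \<omega>1] sq nn w1 in \<open>auto simp: N_def\<close>)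
  also have "\<dots> = ennreal (N \<omega>1 * N u * N v * N h)"
    using Nn by (simp add: ennreal_mult[symmetric] mult_ac)
  finally show "(\<integral>\<^sup>+x. \<integral>\<^sup>+y. ennreal ((u x * \<omega>1 x) * (v y * \<omega>2 y) * h (x + y)) \<partial>lborel \<partial>lborel)
     \<le> ennreal (sqrt (LINT x|lborel. (\<omega>1 x)\<^sup>2) * sqrt (LINT x|lborel. (u x)\<^sup>2) * sqrt (LINT x|lborel. (v x)\<^sup>2) * sqrt (LINT x|lborel. (h x)\<^sup>2))"
    unfolding N_def .
qed

lemma trilinear_bound_commute:
  fixes \<omega>1 \<omega>2 :: "'a::euclidean_space \<Rightarrow> real"
  assumes [measurable]: "\<omega>1 \<in> borel_measurable borel" "\<omega>2 \<in> borel_measurable borel"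
    and tb: "trilinear_bound \<omega>1 \<omega>2 B"
  shows "trilinear_bound \<omega>2 \<omega>1 B"
  unfolding trilinear_bound_def
proof (intro allI impI)
  fix u v h :: "'a \<Rightarrow> real"
  assume [measurable]: "u \<in> borel_measurable borel" "v \<in> borel_measurable borel" "h \<in> borel_measurable borel"
    and nn: "\<forall>x. u x \<ge> 0" "\<forall>x. v x \<ge> 0" "\<forall>x. h x \<ge> 0"
    and sq: "integrable lborel (\<lambda>x. (u x)\<^sup>2)" "integrable lborel (\<lambda>x. (v x)\<^sup>2)" "integrable lborel (\<lambda>x. (h x)\<^sup>2)"
  have "(\<integral>\<^sup>+x. \<integral>\<^sup>+y. ennreal ((u x * \<omega>2 x) * (v y * \<omega>1 y) * h (x + y)) \<partial>lborel \<partial>lborel)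
     = (\<integral>\<^sup>+y. \<integral>\<^sup>+x. ennreal ((u x * \<omega>2 x) * (v y * \<omega>1 y) * h (x + y)) \<partial>lborel \<partial>lborel)"
    by (rule lborel_pair.Fubini') measurable
  also have "\<dots> = (\<integral>\<^sup>+y. \<integral>\<^sup>+x. ennreal ((v y * \<omega>1 y) * (u x * \<omega>2 x) * h (y + x)) \<partial>lborel \<partial>lborel)"
    by (simp only: mult_ac add.commute)
  also have "\<dots> \<le> ennreal (B * sqrt (LINT x|lborel. (v x)\<^sup>2) * sqrt (LINT x|lborel. (u x)\<^sup>2) * sqrt (LINT x|lborel. (h x)\<^sup>2))"
    by (rule tb[unfolded trilinear_bound_def, rule_format]) (use nn sq in auto)
  finally show "(\<integral>\<^sup>+x. \<integral>\<^sup>+y. ennreal ((u x * \<omega>2 x) * (v y * \<omega>1 y) * h (x + y)) \<partial>lborel \<partial>lborel)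
    \<le> ennreal (B * sqrt (LINT x|lborel. (u x)\<^sup>2) * sqrt (LINT x|lborel. (v x)\<^sup>2) * sqrt (LINT x|lborel. (h x)\<^sup>2))"
    by (simp add: mult_ac)
qed

text \<open>
  The inequality of Hoelder for \<open>u\<^sup>2\<close> and a power of \<open>\<omega>\<close>: a square integrable function times a weight
  lies in the Lebesgue space of exponent \<open>1 / (1 - l)\<close>, where \<open>l\<close> is the inverse of the exponent called
  \<open>p\<close> in the theorem.
\<close>

lemma weighted_power_integral_le:
  fixes u \<omega> :: "'a::euclidean_space \<Rightarrow> real"
  assumes [measurable]: "u \<in> borel_measurable borel" "\<omega> \<in> borel_measurable borel"
    and l: "0 < l" "l < 1 / 2"
    and u: "integrable lborel (\<lambda>x. (u x)\<^sup>2)" "\<And>x. u x \<ge> 0"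
    and w: "integrable lborel (\<lambda>x. \<omega> x powr (2 / (1 - 2 * l)))" "\<And>x. \<omega> x \<ge> 0"
  shows "ennreal_powr (\<integral>\<^sup>+x. ennreal ((u x * \<omega> x) powr (1 / (1 - l))) \<partial>lborel) (1 - l)
      \<le> ennreal (sqrt (LINT x|lborel. (u x)\<^sup>2) * (LINT x|lborel. \<omega> x powr (2 / (1 - 2 * l))) powr (1/2 - l))"
proof -
  define c where "c = 1 - l"
  define A where "A = (LINT x|lborel. (u x)\<^sup>2)"
  define W where "W = (LINT x|lborel. \<omega> x powr (2 / (1 - 2 * l)))"
  have c: "c > 0" using l by (simp add: c_def)
  have AW: "A \<ge> 0" "W \<ge> 0" by (auto simp: A_def W_def)
  have "(u x * \<omega> x) powr (1 / c) = ((u x)\<^sup>2) powr (1 / (2 * c)) * (\<omega> x powr (2 / (1 - 2 * l))) powr ((1 - 2 * l) / (2 * c))" for x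
  proof -
    have "((u x)\<^sup>2) powr (1 / (2 * c)) = (u x powr 2) powr (1 / (2 * c))"
      using u(2)[of x] by simp
    also have "\<dots> = u x powr (1 / c)" unfolding powr_powr using c by simp
    finally have "((u x)\<^sup>2) powr (1 / (2 * c)) = u x powr (1 / c)" .
    moreover have "2 / (1 - 2 * l) * ((1 - 2 * l) / (2 * c)) = 1 / c"
    proof -
      have "2 / a * (a / (2 * c)) = 1 / c" if "a \<noteq> 0" for a
        using that by simp
      from this[of "1 - 2 * l"] show ?thesis using l by argo
    qed
    ultimately show ?thesis
      using u(2)[of x] w(2)[of x] by (simp only: powr_powr powr_mult)
  qed
  then have "(\<integral>\<^sup>+x. ennreal ((u x * \<omega> x) powr (1 / c)) \<partial>lborel) \<le> ennreal (A powr (1 / (2 * c)) * W powr ((1 - 2 * l) / (2 * c)))"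
    unfolding A_def W_def
    by (simp only:) (rule nn_integral_Holder, use l u w in \<open>auto simp: c_def simp flip: add_divide_distrib\<close>)
  then obtain X where X: "(\<integral>\<^sup>+x. ennreal ((u x * \<omega> x) powr (1 / c)) \<partial>lborel) = ennreal X" "X \<ge> 0" "X \<le> A powr (1 / (2 * c)) * W powr ((1 - 2 * l) / (2 * c))"
    by (cases "(\<integral>\<^sup>+x. ennreal ((u x * \<omega> x) powr (1 / c)) \<partial>lborel)") (auto simp: top_unique)
  have "X powr c \<le> (A powr (1 / (2 * c)) * W powr ((1 - 2 * l) / (2 * c))) powr c"
    using X c by (intro powr_mono2) auto
  also have "\<dots> = A powr (1/2) * W powr (1/2 - l)"
  proof -
    have "1 / (2 * c) * c = 1/2" "(1 - 2 * l) / (2 * c) * c = 1/2 - l" using c by (simp_all add: field_simps)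
    then show ?thesis by (simp only: powr_mult powr_powr)
  qed
  also have "A powr (1/2) = sqrt A" using AW by (simp add: powr_half_sqrt)
  finally show ?thesis
    using X by (simp add: c_def[symmetric] A_def[symmetric] W_def[symmetric] ennreal_powr_ennreal ennreal_leI)
qed

text \<open>
  The exponents \<open>1 - l1\<close>, \<open>1 - l2\<close> and \<open>1/2\<close> add up to \<open>2\<close>, as the sharp inequality requires. The third
  factor of its constant is \<open>young_const (1/2) = 1\<close>.
\<close>

lemma trilinear_bound_sharp_young:
  fixes \<omega>1 \<omega>2 :: "'a::euclidean_space \<Rightarrow> real"
  assumes [measurable]: "\<omega>1 \<in> borel_measurable borel" "\<omega>2 \<in> borel_measurable borel"
    and l: "0 < l1" "0 < l2" "l1 + l2 = 1 / 2"
    and w1: "integrable lborel (\<lambda>x. \<omega>1 x powr (2 / (1 - 2 * l1)))" "\<And>x. \<omega>1 x \<ge> 0"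
    and w2: "integrable lborel (\<lambda>x. \<omega>2 x powr (2 / (1 - 2 * l2)))" "\<And>x. \<omega>2 x \<ge> 0"
  shows "trilinear_bound \<omega>1 \<omega>2 ((young_const l1 * young_const l2) ^ DIM('a) *
     ((LINT x|lborel. \<omega>1 x powr (2 / (1 - 2 * l1))) powr (1/2 - l1) * (LINT x|lborel. \<omega>2 x powr (2 / (1 - 2 * l2))) powr (1/2 - l2)))"
  unfolding trilinear_bound_def
proof (intro allI impI)
  fix u v h :: "'a \<Rightarrow> real"
  assume [measurable]: "u \<in> borel_measurable borel" "v \<in> borel_measurable borel" "h \<in> borel_measurable borel"
    and nn: "\<forall>x. u x \<ge> 0" "\<forall>x. v x \<ge> 0" "\<forall>x. h x \<ge> 0"
    and sq: "integrable lborel (\<lambda>x. (u x)\<^sup>2)" "integrable lborel (\<lambda>x. (v x)\<^sup>2)" "integrable lborel (\<lambda>x. (h x)\<^sup>2)"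
  have half: "l1 < 1/2" "l2 < 1/2" using l by auto
  define W1 where "W1 = (LINT x|lborel. \<omega>1 x powr (2 / (1 - 2 * l1))) powr (1/2 - l1)"
  define W2 where "W2 = (LINT x|lborel. \<omega>2 x powr (2 / (1 - 2 * l2))) powr (1/2 - l2)"
  define Nu where "Nu = sqrt (LINT x|lborel. (u x)\<^sup>2)"
  define Nv where "Nv = sqrt (LINT x|lborel. (v x)\<^sup>2)"
  define Nh where "Nh = sqrt (LINT x|lborel. (h x)\<^sup>2)"
  have N: "W1 \<ge> 0" "W2 \<ge> 0" "Nu \<ge> 0" "Nv \<ge> 0" "Nh \<ge> 0" by (auto simp: W1_def W2_def Nu_def Nv_def Nh_def)
  define F1 where "F1 x = ennreal ((u x * \<omega>1 x) powr (1 / (1 - l1)))" for x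
  define F2 where "F2 x = ennreal ((v x * \<omega>2 x) powr (1 / (1 - l2)))" for x
  define F3 where "F3 x = ennreal ((h x)\<^sup>2)" for x
  have [measurable]: "F1 \<in> borel_measurable borel" "F2 \<in> borel_measurable borel" "F3 \<in> borel_measurable borel"
    unfolding F1_def F2_def F3_def by measurable
  have yc: "young_const (1/2) = 1" by (simp add: young_const_def)
  have y0: "young_const l1 \<ge> 0" "young_const l2 \<ge> 0" by (auto simp: young_const_def)
  have e1: "ennreal_powr (F1 x) (1 - l1) = ennreal (u x * \<omega>1 x)" for x
    unfolding F1_def using half nn w1(2) by (simp add: ennreal_powr_ennreal powr_powr)
  have e2: "ennreal_powr (F2 x) (1 - l2) = ennreal (v x * \<omega>2 x)" for x
    unfolding F2_def using half nn w2(2) by (simp add: ennreal_powr_ennreal powr_powr)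
  have e3: "ennreal_powr (F3 x) (1 - 1/2) = ennreal (h x)" for x
    unfolding F3_def using nn by (simp add: ennreal_powr_ennreal powr_half_sqrt)
  have i3: "ennreal_powr (\<integral>\<^sup>+x. F3 x \<partial>lborel) (1 - 1/2) = ennreal Nh"
    unfolding F3_def Nh_def by (subst nn_integral_eq_integral[OF sq(3)]) (auto simp: ennreal_powr_ennreal powr_half_sqrt)
  have "(\<integral>\<^sup>+x. \<integral>\<^sup>+y. ennreal ((u x * \<omega>1 x) * (v y * \<omega>2 y) * h (x + y)) \<partial>lborel \<partial>lborel)
     = (\<integral>\<^sup>+x. \<integral>\<^sup>+y. ennreal_powr (F1 x) (1 - l1) * ennreal_powr (F2 y) (1 - l2) * ennreal_powr (F3 (x+y)) (1 - 1/2) \<partial>lborel \<partial>lborel)"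
    unfolding e1 e2 e3 using nn w1(2) w2(2) by (simp add: ennreal_mult)
  also have "\<dots> \<le> ennreal (young_const l1 * young_const l2 * young_const (1/2)) ^ DIM('a) *
        (ennreal_powr (\<integral>\<^sup>+x. F1 x \<partial>lborel) (1-l1) * ennreal_powr (\<integral>\<^sup>+x. F2 x \<partial>lborel) (1-l2) * ennreal_powr (\<integral>\<^sup>+x. F3 x \<partial>lborel) (1-1/2))"
    by (rule sharp_young) (use l in auto)
  also have "\<dots> \<le> ennreal (young_const l1 * young_const l2 * young_const (1/2)) ^ DIM('a) *
        (ennreal (Nu * W1) * ennreal (Nv * W2) * ennreal Nh)"
    unfolding i3 unfolding F1_def F2_def Nu_def Nv_def W1_def W2_def
    by (intro mult_left_mono mult_right_mono mult_mono weighted_power_integral_le) (use l half nn sq w1 w2 in auto)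
  also have "\<dots> = ennreal ((young_const l1 * young_const l2) ^ DIM('a) * (W1 * W2) * Nu * Nv * Nh)"
    using N y0 unfolding yc by (simp add: ennreal_mult[symmetric] ennreal_power mult_ac)
  finally show "(\<integral>\<^sup>+x. \<integral>\<^sup>+y. ennreal ((u x * \<omega>1 x) * (v y * \<omega>2 y) * h (x + y)) \<partial>lborel \<partial>lborel)
    \<le> ennreal ((young_const l1 * young_const l2) ^ DIM('a) *
     ((LINT x|lborel. \<omega>1 x powr (2 / (1 - 2 * l1))) powr (1/2 - l1) * (LINT x|lborel. \<omega>2 x powr (2 / (1 - 2 * l2))) powr (1/2 - l2))
      * sqrt (LINT x|lborel. (u x)\<^sup>2) * sqrt (LINT x|lborel. (v x)\<^sup>2) * sqrt (LINT x|lborel. (h x)\<^sup>2))"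
    unfolding W1_def W2_def Nu_def Nv_def Nh_def .
qed

section \<open>Fourier transforms of Gaussians\<close>

text \<open>
  The characteristic function of the standard normal distribution, rescaled.
\<close>

lemma gaussian_fourier_integral_real:
  fixes t a :: real
  assumes a: "a > 0"
  shows "integrable lborel (\<lambda>x. exp (- \<i> * complex_of_real (t * x)) * complex_of_real (exp (- (a / 2) * x\<^sup>2)))"
    and "(LINT x|lborel. exp (- \<i> * complex_of_real (t * x)) * complex_of_real (exp (- (a / 2) * x\<^sup>2)))
       = complex_of_real (sqrt (2 * pi / a) * exp (- t\<^sup>2 / (2 * a)))"
proof -
  have nn: "(\<integral>\<^sup>+x. ennreal (exp (- (a / 2) * (x - 0)\<^sup>2)) \<partial>lborel) = ennreal (sqrt (pi / (a / 2)))"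
    by (rule nn_integral_gaussian_shift) (use a in simp)
  have "integrable lborel (\<lambda>x. exp (- (a / 2) * (x - 0)\<^sup>2))"
    by (rule integrableI_nonneg) (use nn in auto)
  then have gi: "integrable lborel (\<lambda>x. exp (- (a / 2) * x\<^sup>2))" by simp
  show "integrable lborel (\<lambda>x. exp (- \<i> * complex_of_real (t * x)) * complex_of_real (exp (- (a / 2) * x\<^sup>2)))"
    by (rule Bochner_Integration.integrable_bound[OF gi]) (auto simp: norm_mult)
  define s where "s = - t / sqrt a"
  have sa: "sqrt a > 0" using a by simp
  have "complex_of_real (exp (- s\<^sup>2 / 2)) = (LINT x|lborel. std_normal_density x *\<^sub>R iexp (s * x))"
    using fun_cong[OF char_std_normal_distribution, of s] unfolding char_def
    by (subst (asm) integral_density) auto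
  also have "\<dots> = \<bar>sqrt a\<bar> *\<^sub>R (LINT x|lborel. std_normal_density (0 + sqrt a * x) *\<^sub>R iexp (s * (0 + sqrt a * x)))"
    by (rule lborel_integral_real_affine) (use a in simp)
  also have "(\<lambda>x. std_normal_density (0 + sqrt a * x) *\<^sub>R iexp (s * (0 + sqrt a * x)))
     = (\<lambda>x. complex_of_real (1 / sqrt (2 * pi)) * (exp (- \<i> * complex_of_real (t * x)) * complex_of_real (exp (- (a / 2) * x\<^sup>2))))"
    using a by (intro ext) (simp add: std_normal_density_def s_def power_mult_distrib scaleR_conv_of_real mult_ac)
  finally have "complex_of_real (exp (- s\<^sup>2 / 2)) = complex_of_real (sqrt a / sqrt (2 * pi)) * (LINT x|lborel. exp (- \<i> * complex_of_real (t * x)) * complex_of_real (exp (- (a / 2) * x\<^sup>2)))"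
    using a by (simp add: scaleR_conv_of_real)
  then have "complex_of_real (sqrt (2 * pi) / sqrt a) * complex_of_real (exp (- s\<^sup>2 / 2)) = (LINT x|lborel. exp (- \<i> * complex_of_real (t * x)) * complex_of_real (exp (- (a / 2) * x\<^sup>2)))"
    using a by simp
  then show "(LINT x|lborel. exp (- \<i> * complex_of_real (t * x)) * complex_of_real (exp (- (a / 2) * x\<^sup>2)))
       = complex_of_real (sqrt (2 * pi / a) * exp (- t\<^sup>2 / (2 * a)))"
    using a by (simp add: s_def power_divide real_sqrt_divide mult.commute)
qed

lemma integral_lborel_prod:
  fixes f :: "'a::euclidean_space \<Rightarrow> real \<Rightarrow> complex"
  assumes f: "\<And>b. b \<in> Basis \<Longrightarrow> integrable lborel (f b)"
  shows "(LINT x|lborel. (\<Prod>b\<in>Basis. f b (x \<bullet> b))) = (\<Prod>b\<in>Basis. LINT x|lborel. f b x)"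
proof -
  interpret product_sigma_finite "\<lambda>_::'a. lborel :: real measure" by standard
  have [measurable]: "f b \<in> borel_measurable borel" if "b \<in> Basis" for b using f[OF that] by auto
  have "(LINT x|lborel. (\<Prod>b\<in>Basis. f b (x \<bullet> b))) = (LINT x|Pi\<^sub>M Basis (\<lambda>_. lborel). (\<Prod>b\<in>Basis. f b ((\<Sum>b\<in>Basis. x b *\<^sub>R b) \<bullet> b)))"
    by (subst lborel_eq) (subst integral_distr, auto)
  also have "\<dots> = (LINT x|Pi\<^sub>M Basis (\<lambda>_. lborel). (\<Prod>b\<in>Basis. f b (x b)))"
    by (intro Bochner_Integration.integral_cong prod.cong refl) simp
  also have "\<dots> = (\<Prod>b\<in>Basis. LINT x|lborel. f b x)"
    by (rule product_integral_prod) (auto intro: f)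
  finally show ?thesis .
qed

lemma integrable_gaussian:
  fixes m :: "'a::euclidean_space"
  assumes "a > 0"
  shows "integrable lborel (\<lambda>x. exp (- (a * (norm (x - m))\<^sup>2)))"
  using nn_integral_gaussian[OF assms, of m] by (intro integrableI_nonneg) auto

lemma gaussian_fourier_integral:
  fixes k :: "real^'d::finite"
  assumes a: "a > 0"
  shows "(LINT x|lborel. exp (- \<i> * complex_of_real (k \<bullet> x)) * complex_of_real (exp (- (a / 2) * (norm x)\<^sup>2)))
       = complex_of_real ((2 * pi / a) powr (real CARD('d) / 2) * exp (- (norm k)\<^sup>2 / (2 * a)))"
proof -
  define f where "f b t = exp (- \<i> * complex_of_real ((k \<bullet> b) * t)) * complex_of_real (exp (- (a / 2) * t\<^sup>2))" for b :: "real^'d" and t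
  have nsq: "(norm x)\<^sup>2 = (\<Sum>b\<in>Basis. (x \<bullet> b)\<^sup>2)" for x :: "real^'d"
    unfolding power2_norm_eq_inner by (subst euclidean_inner) (simp add: power2_eq_square)
  have "exp (- \<i> * complex_of_real (k \<bullet> x)) * complex_of_real (exp (- (a / 2) * (norm x)\<^sup>2)) = (\<Prod>b\<in>Basis. f b (x \<bullet> b))" for x
  proof -
    have "exp (- \<i> * complex_of_real (k \<bullet> x)) = (\<Prod>b\<in>Basis. exp (- \<i> * complex_of_real ((k \<bullet> b) * (x \<bullet> b))))"
      by (subst euclidean_inner) (simp add: exp_sum[symmetric] sum_distrib_left sum_negf)
    moreover have "exp (- (a / 2) * (norm x)\<^sup>2) = (\<Prod>b\<in>Basis. exp (- (a / 2) * (x \<bullet> b)\<^sup>2))"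
      unfolding nsq by (simp add: exp_sum[symmetric] sum_distrib_left sum_negf)
    ultimately show ?thesis unfolding f_def by (simp add: prod.distrib)
  qed
  then have "(LINT x|lborel. exp (- \<i> * complex_of_real (k \<bullet> x)) * complex_of_real (exp (- (a / 2) * (norm x)\<^sup>2)))
     = (\<Prod>b\<in>Basis. LINT x|lborel. f b x)"
    using gaussian_fourier_integral_real(1)[OF a] by (simp only: f_def) (rule integral_lborel_prod, simp)
  also have "\<dots> = (\<Prod>b\<in>(Basis::(real^'d) set). complex_of_real (sqrt (2 * pi / a) * exp (- (k \<bullet> b)\<^sup>2 / (2 * a))))"
    unfolding f_def gaussian_fourier_integral_real(2)[OF a] ..
  also have "\<dots> = complex_of_real (sqrt (2 * pi / a) ^ CARD('d) * exp (- (norm k)\<^sup>2 / (2 * a)))"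
  proof -
    have "(\<Prod>b\<in>(Basis::(real^'d) set). sqrt (2 * pi / a) * exp (- (k \<bullet> b)\<^sup>2 / (2 * a))) = sqrt (2 * pi / a) ^ CARD('d) * exp (- (norm k)\<^sup>2 / (2 * a))"
    proof -
      have "(\<Sum>b\<in>(Basis::(real^'d) set). - (k \<bullet> b)\<^sup>2 / (2 * a)) = - (norm k)\<^sup>2 / (2 * a)"
        unfolding nsq by (simp only: sum_negf sum_divide_distrib[symmetric])
      then show ?thesis by (simp only: prod.distrib exp_sum[symmetric] finite_Basis prod_constant) simp
    qed
    then show ?thesis by (simp only: of_real_prod[symmetric])
  qed
  also have "sqrt (2 * pi / a) ^ CARD('d) = (2 * pi / a) powr (real CARD('d) / 2)"
  proof -
    have "sqrt (2 * pi / a) ^ CARD('d) = sqrt (2 * pi / a) powr real CARD('d)"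
      by (rule powr_realpow[symmetric]) (use a in simp)
    also have "\<dots> = ((2 * pi / a) powr (1/2)) powr real CARD('d)"
      using a by (simp add: powr_half_sqrt)
    finally show ?thesis by (simp add: powr_powr)
  qed
  finally show ?thesis .
qed

text \<open>
  Modulated Gaussians, and below their Fourier transforms. The factor \<open>a powr (-d/2)\<close> in the heat kernel makes
  its integral independent of the width \<open>a\<close>.
\<close>

definition gaussian_wave :: "real \<Rightarrow> real^'d::finite \<Rightarrow> real^'d \<Rightarrow> complex" where
  "gaussian_wave a y x = exp (\<i> * complex_of_real (y \<bullet> x)) * complex_of_real (exp (- (a / 2) * (norm x)\<^sup>2))"

definition heat_kernel :: "real \<Rightarrow> real^'d::finite \<Rightarrow> real^'d \<Rightarrow> real" where
  "heat_kernel a y x = a powr (- real CARD('d) / 2) * exp (- (norm (x - y))\<^sup>2 / (2 * a))"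

lemma heat_kernel_pos: "a > 0 \<Longrightarrow> heat_kernel a y x > 0"
  by (simp add: heat_kernel_def)

lemma measurable_gaussian_wave [measurable]: "gaussian_wave a y \<in> borel_measurable borel"
  unfolding gaussian_wave_def by measurable

lemma measurable_heat_kernel [measurable (raw)]:
  fixes f g :: "'a \<Rightarrow> real^'d::finite"
  assumes [measurable]: "f \<in> borel_measurable M" "g \<in> borel_measurable M"
  shows "(\<lambda>x. heat_kernel a (f x) (g x)) \<in> borel_measurable M"
  unfolding heat_kernel_def by measurable

lemma norm_gaussian_wave: "norm (gaussian_wave a y x) = exp (- (a / 2) * (norm x)\<^sup>2)"
  by (simp add: gaussian_wave_def norm_mult)

lemma integrable_gaussian_wave: "a > 0 \<Longrightarrow> integrable lborel (gaussian_wave a y)"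
  by (rule Bochner_Integration.integrable_bound[OF integrable_gaussian[of "a / 2" 0]])
    (auto simp: norm_gaussian_wave)

lemma fourier_gaussian_wave:
  fixes y k :: "real^'d::finite"
  assumes a: "a > 0"
  shows "fourier (gaussian_wave a y) k = complex_of_real (heat_kernel a y k)"
proof -
  have "exp (- \<i> * complex_of_real (k \<bullet> x)) * gaussian_wave a y x
     = exp (- \<i> * complex_of_real ((k - y) \<bullet> x)) * complex_of_real (exp (- (a / 2) * (norm x)\<^sup>2))" for x
    unfolding gaussian_wave_def mult.assoc[symmetric] exp_add[symmetric] by (simp add: inner_diff_left algebra_simps)
  then have "fourier (gaussian_wave a y) k = complex_of_real ((2 * pi) powr (- real CARD('d) / 2) * ((2 * pi / a) powr (real CARD('d) / 2) * exp (- (norm (k - y))\<^sup>2 / (2 * a))))"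
    unfolding fourier_def by (simp only: gaussian_fourier_integral[OF a] of_real_mult)
  also have "(2 * pi) powr (- real CARD('d) / 2) * ((2 * pi / a) powr (real CARD('d) / 2) * exp (- (norm (k - y))\<^sup>2 / (2 * a))) = heat_kernel a y k"
    unfolding heat_kernel_def using a by (simp add: powr_divide powr_minus_divide)
  finally show ?thesis .
qed

lemma heat_kernel_altdef: "a > 0 \<Longrightarrow> heat_kernel a y x = a powr (- real CARD('d) / 2) * exp (- (1 / (2 * a) * (norm (x - (y::real^'d::finite)))\<^sup>2))"
  by (simp add: heat_kernel_def)

lemma integrable_heat_kernel: "a > 0 \<Longrightarrow> integrable lborel (\<lambda>x. heat_kernel a y x)"
  by (simp only: heat_kernel_altdef) (intro integrable_mult_right integrable_gaussian, simp)

lemma nn_integral_heat_kernel: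
  fixes y :: "real^'d::finite"
  assumes "a > 0"
  shows "(\<integral>\<^sup>+x. ennreal (heat_kernel a y x) \<partial>lborel) = ennreal ((2 * pi) powr (real CARD('d) / 2))"
proof -
  have "sqrt (pi / (1 / (2 * a))) ^ CARD('d) = (2 * pi * a) powr (real CARD('d) / 2)"
  proof -
    have "sqrt (pi / (1 / (2 * a))) ^ CARD('d) = sqrt (2 * pi * a) powr real CARD('d)"
      using assms by (subst powr_realpow) (auto simp: mult_ac)
    also have "\<dots> = ((2 * pi * a) powr (1/2)) powr real CARD('d)"
      using assms by (simp add: powr_half_sqrt)
    finally show ?thesis by (simp add: powr_powr)
  qed
  then have "(\<integral>\<^sup>+x. ennreal (heat_kernel a y x) \<partial>lborel) = ennreal (a powr (- real CARD('d) / 2)) * ennreal ((2 * pi * a) powr (real CARD('d) / 2))"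
    using assms nn_integral_gaussian[of "1 / (2 * a)" y]
    by (simp add: heat_kernel_altdef ennreal_mult nn_integral_cmult)
  then show ?thesis using assms by (simp add: ennreal_mult[symmetric] powr_mult powr_minus_divide)
qed

lemma fourier_heat_kernel:
  fixes y x :: "real^'d::finite"
  assumes a: "a > 0"
  shows "fourier (\<lambda>k. complex_of_real (heat_kernel a y k)) x = gaussian_wave a y (- x)"
proof -
  have w0: "gaussian_wave (1 / a) 0 k = complex_of_real (exp (- (norm k)\<^sup>2 / (2 * a)))" for k :: "real^'d"
    by (simp add: gaussian_wave_def)
  define c where "c = complex_of_real (a powr (- real CARD('d) / 2))"
  have "(LINT k|lborel. exp (- \<i> * complex_of_real (x \<bullet> k)) * complex_of_real (heat_kernel a y k))
     = (LINT k|lborel. exp (- \<i> * complex_of_real (x \<bullet> (y + k))) * complex_of_real (heat_kernel a y (y + k)))"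
  proof (rule integral_lborel_translate(2)[symmetric, where x = y and f = "\<lambda>k. exp (- \<i> * complex_of_real (x \<bullet> k)) * complex_of_real (heat_kernel a y k)"])
    show "integrable lborel (\<lambda>k. exp (- \<i> * complex_of_real (x \<bullet> k)) * complex_of_real (heat_kernel a y k))"
      by (rule Bochner_Integration.integrable_bound[OF integrable_heat_kernel[OF a, of y]])
        (auto simp: norm_mult)
  qed
  also have "\<dots> = (LINT k|lborel. (c * exp (- \<i> * complex_of_real (x \<bullet> y))) * (exp (- \<i> * complex_of_real (x \<bullet> k)) * gaussian_wave (1 / a) 0 k))"
  proof (intro Bochner_Integration.integral_cong refl)
    fix k
    have "exp (- \<i> * complex_of_real (x \<bullet> (y + k))) = exp (- \<i> * complex_of_real (x \<bullet> y)) * exp (- \<i> * complex_of_real (x \<bullet> k))"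
      unfolding exp_add[symmetric] by (simp add: inner_add_right distrib_left)
    moreover have "complex_of_real (heat_kernel a y (y + k)) = c * gaussian_wave (1 / a) 0 k"
      unfolding w0 by (simp add: heat_kernel_def c_def)
    ultimately show "exp (- \<i> * complex_of_real (x \<bullet> (y + k))) * complex_of_real (heat_kernel a y (y + k))
       = (c * exp (- \<i> * complex_of_real (x \<bullet> y))) * (exp (- \<i> * complex_of_real (x \<bullet> k)) * gaussian_wave (1 / a) 0 k)"
      by (simp only: mult_ac)
  qed
  also have "\<dots> = (c * exp (- \<i> * complex_of_real (x \<bullet> y))) * (LINT k|lborel. exp (- \<i> * complex_of_real (x \<bullet> k)) * gaussian_wave (1 / a) 0 k)"
    by (rule integral_mult_right_zero)
  finally have "fourier (\<lambda>k. complex_of_real (heat_kernel a y k)) x = (c * exp (- \<i> * complex_of_real (x \<bullet> y))) * fourier (gaussian_wave (1 / a) 0) x"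
    unfolding fourier_def by (simp only: mult_ac)
  also have "\<dots> = (c * exp (- \<i> * complex_of_real (x \<bullet> y))) * complex_of_real ((1 / a) powr (- real CARD('d) / 2) * exp (- (a / 2) * (norm x)\<^sup>2))"
    using a by (simp add: fourier_gaussian_wave heat_kernel_def)
  also have "\<dots> = gaussian_wave a y (- x) * (c * complex_of_real ((1 / a) powr (- real CARD('d) / 2)))"
    by (simp add: gaussian_wave_def inner_commute)
  also have "c * complex_of_real ((1 / a) powr (- real CARD('d) / 2)) = 1"
    unfolding c_def using a by (simp add: powr_mult[symmetric] flip: of_real_mult)
  finally show ?thesis by simp
qed

lemma measurable_fourier [measurable (raw)]:
  assumes [measurable]: "f \<in> borel_measurable borel"
  shows "fourier f \<in> borel_measurable borel"
  unfolding fourier_def by measurable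

lemma integrable_fourier_kernel:
  "integrable lborel f \<Longrightarrow> integrable lborel (\<lambda>x. exp (- \<i> * complex_of_real (k \<bullet> x)) * f x)" for f :: "real^'d::finite \<Rightarrow> complex"
  by (rule Bochner_Integration.integrable_bound[where f = f]) (auto simp: norm_mult)

lemma norm_fourier_le:
  fixes f :: "real^'d::finite \<Rightarrow> complex"
  shows "norm (fourier f k) \<le> (2 * pi) powr (- real CARD('d) / 2) * (LINT x|lborel. norm (f x))"
proof -
  have "norm (LINT x|lborel. exp (- \<i> * complex_of_real (k \<bullet> x)) * f x) \<le> (LINT x|lborel. norm (exp (- \<i> * complex_of_real (k \<bullet> x)) * f x))"
    by (rule integral_norm_bound)
  then show ?thesis unfolding fourier_def by (simp add: norm_mult mult_left_mono)
qed

text \<open>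
  Both sides are the same double integral.
\<close>

lemma fourier_multiplication_formula:
  fixes f g :: "real^'d::finite \<Rightarrow> complex"
  assumes f: "integrable lborel f" and g: "integrable lborel g"
  shows "integrable lborel (\<lambda>k. fourier f k * g k)"
    and "(LINT k|lborel. fourier f k * g k) = (LINT x|lborel. f x * fourier g x)"
proof -
  have [measurable]: "f \<in> borel_measurable borel" "g \<in> borel_measurable borel" using f g by auto
  show "integrable lborel (\<lambda>k. fourier f k * g k)"
  proof (rule Bochner_Integration.integrable_bound)
    show "integrable lborel (\<lambda>k. ((2 * pi) powr (- real CARD('d) / 2) * (LINT x|lborel. norm (f x))) *\<^sub>R norm (g k))"
      using g by auto
    show "AE x in lborel. norm (fourier f x * g x) \<le> norm (((2 * pi) powr (- real CARD('d) / 2) * (LINT x|lborel. norm (f x))) *\<^sub>R norm (g x))"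
      using norm_fourier_le[of f] by (auto simp: norm_mult intro!: mult_right_mono)
  qed measurable
  define c where "c = complex_of_real ((2 * pi) powr (- real CARD('d) / 2))"
  define K where "K x k = exp (- \<i> * complex_of_real (k \<bullet> x)) * f x * g k" for x k :: "real^'d"
  have Km: "case_prod K \<in> borel_measurable (lborel \<Otimes>\<^sub>M lborel)"
    unfolding K_def split_beta by measurable
  have nK: "norm (K x k) = norm (f x) * norm (g k)" for x k
    by (simp add: K_def norm_mult)
  have Ki: "integrable (lborel \<Otimes>\<^sub>M lborel) (case_prod K)"
  proof (rule lborel_pair.Fubini_integrable[OF Km])
    show "integrable lborel (\<lambda>x. LINT y|lborel. norm (case (x, y) of (x, y) \<Rightarrow> K x y))"
      using f g by (simp add: nK)
    show "AE x in lborel. integrable lborel (\<lambda>y. case (x, y) of (x, y) \<Rightarrow> K x y)"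
    proof (rule AE_I2)
      fix x
      have "integrable lborel (\<lambda>k. norm (f x) * norm (g k))" using g by auto
      moreover have "K x \<in> borel_measurable lborel" unfolding K_def by measurable
      ultimately show "integrable lborel (\<lambda>y. case (x, y) of (x, y) \<Rightarrow> K x y)"
        by (simp, elim Bochner_Integration.integrable_bound) (auto simp: nK)
    qed
  qed
  have "(LINT k|lborel. fourier f k * g k) = (LINT k|lborel. c * (LINT x|lborel. K x k))"
    unfolding fourier_def c_def[symmetric] K_def
    unfolding integral_mult_left_zero by (simp only: mult.assoc)
  also have "\<dots> = c * (LINT k|lborel. LINT x|lborel. K x k)" by simp
  also have "(LINT k|lborel. LINT x|lborel. K x k) = (LINT x|lborel. LINT k|lborel. K x k)"
    by (rule lborel_pair.Fubini_integral[OF Ki])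
  also have "c * \<dots> = (LINT x|lborel. c * (LINT k|lborel. K x k))" by simp
  also have "\<dots> = (LINT x|lborel. f x * fourier g x)"
  proof (intro Bochner_Integration.integral_cong refl)
    fix x
    have "(LINT k|lborel. K x k) = (LINT k|lborel. f x * (exp (- \<i> * complex_of_real (x \<bullet> k)) * g k))"
      unfolding K_def by (intro Bochner_Integration.integral_cong refl) (simp add: inner_commute mult_ac)
    then show "c * (LINT k|lborel. K x k) = f x * fourier g x"
      by (simp add: fourier_def c_def mult_ac)
  qed
  finally show "(LINT k|lborel. fourier f k * g k) = (LINT x|lborel. f x * fourier g x)" .
qed

section \<open>The Bessel inequality for the Fourier transform\<close>

lemma heat_kernel_nonneg: "a > 0 \<Longrightarrow> heat_kernel a y x \<ge> 0"
  using heat_kernel_pos less_imp_le by blast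

lemma heat_kernel_le: "a > 0 \<Longrightarrow> heat_kernel a y x \<le> a powr (- real CARD('d) / 2)" for x y :: "real^'d::finite"
  unfolding heat_kernel_def by (intro mult_left_le) auto

lemma measurable_cnj [measurable (raw)]: "f \<in> borel_measurable M \<Longrightarrow> (\<lambda>x. cnj (f x)) \<in> borel_measurable M"
  by (rule measurable_compose[of f M borel]) (auto intro!: borel_measurable_continuous_onI continuous_intros)

lemma heat_kernel_commute: "heat_kernel a y x = heat_kernel a x y"
  by (simp add: heat_kernel_def norm_minus_commute)

lemma integrable_heat_kernel_center: "a > 0 \<Longrightarrow> integrable lborel (\<lambda>y. heat_kernel a y (x :: real^'d::finite))"
  by (subst heat_kernel_commute) (rule integrable_heat_kernel)

lemma integral_heat_kernel:
  fixes y :: "real^'d::finite"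
  assumes "a > 0"
  shows "(LINT x|lborel. heat_kernel a y x) = (2 * pi) powr (real CARD('d) / 2)"
  using nn_integral_heat_kernel[OF assms, of y] assms
  by (subst integral_eq_nn_integral) (auto simp: heat_kernel_nonneg)

lemma lborel_reflect:
  fixes f :: "'a::euclidean_space \<Rightarrow> 'b::{banach, second_countable_topology}"
  assumes [measurable]: "f \<in> borel_measurable borel"
  shows "integrable lborel (\<lambda>x. f (- x)) \<longleftrightarrow> integrable lborel f"
    and "(LINT x|lborel. f (- x)) = (LINT x|lborel. f x)"
proof -
  have d: "distr lborel borel uminus = (lborel :: 'a measure)"
    using lborel_affine[of "-1" "0::'a"] by (simp add: density_1 one_ennreal_def[symmetric])
  show "integrable lborel (\<lambda>x. f (- x)) \<longleftrightarrow> integrable lborel f"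
    using integrable_distr_eq[of uminus lborel borel f] by (simp add: d)
  show "(LINT x|lborel. f (- x)) = (LINT x|lborel. f x)"
    using integral_distr[of uminus lborel borel f] by (simp add: d)
qed

lemma fourier_cnj_reflect:
  fixes f :: "real^'d::finite \<Rightarrow> complex"
  assumes [measurable]: "f \<in> borel_measurable borel"
  shows "fourier (\<lambda>x. cnj (f (- x))) k = cnj (fourier f k)"
proof -
  have "cnj (LINT x|lborel. exp (- \<i> * complex_of_real (k \<bullet> x)) * f x) = (LINT x|lborel. cnj (exp (- \<i> * complex_of_real (k \<bullet> x)) * f x))"
    by (rule Bochner_Integration.integral_cnj[symmetric])
  also have "\<dots> = (LINT x|lborel. exp (- \<i> * complex_of_real (k \<bullet> (- x))) * cnj (f x))"
    by (intro Bochner_Integration.integral_cong refl) (simp add: exp_cnj)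
  also have "\<dots> = (LINT x|lborel. exp (- \<i> * complex_of_real (k \<bullet> (- (- x)))) * cnj (f (- x)))"
    by (rule lborel_reflect(2)[symmetric]) measurable
  finally show ?thesis unfolding fourier_def by simp
qed

text \<open>
  The form \<open>2 f(x) f(y) \<le> f(x)\<^sup>2 + f(y)\<^sup>2\<close> of Schur's test: the kernel is symmetric and its
  integral in either variable is \<open>(2 pi) powr (d/2)\<close>.
\<close>

lemma nn_integral_heat_kernel_smoothing_le:
  fixes f :: "real^'d::finite \<Rightarrow> real"
  assumes [measurable]: "f \<in> borel_measurable borel" and a: "a > 0" and nn: "\<And>x. f x \<ge> 0"
  shows "(\<integral>\<^sup>+x. \<integral>\<^sup>+y. ennreal (f x * f y * heat_kernel a y x) \<partial>lborel \<partial>lborel)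
     \<le> ennreal ((2 * pi) powr (real CARD('d) / 2)) * (\<integral>\<^sup>+x. ennreal ((f x)\<^sup>2) \<partial>lborel)"
proof -
  let ?c = "ennreal ((2 * pi) powr (real CARD('d) / 2))"
  have hk: "heat_kernel a y x \<ge> 0" for x y :: "real^'d" using a by (rule heat_kernel_nonneg)
  have one: "(\<integral>\<^sup>+x. \<integral>\<^sup>+y. ennreal ((f x)\<^sup>2) * ennreal (heat_kernel a y x) \<partial>lborel \<partial>lborel) = ?c * (\<integral>\<^sup>+x. ennreal ((f x)\<^sup>2) \<partial>lborel)"
  proof -
    have "(\<integral>\<^sup>+y. ennreal ((f x)\<^sup>2) * ennreal (heat_kernel a y x) \<partial>lborel) = ?c * ennreal ((f x)\<^sup>2)" for x
    proof -
      have "(\<integral>\<^sup>+y. ennreal ((f x)\<^sup>2) * ennreal (heat_kernel a x y) \<partial>lborel) = ennreal ((f x)\<^sup>2) * (\<integral>\<^sup>+y. ennreal (heat_kernel a x y) \<partial>lborel)"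
        by (rule nn_integral_cmult) measurable
      then show ?thesis
        by (simp only: heat_kernel_commute[of a _ x] nn_integral_heat_kernel[OF a] mult.commute)
    qed
    then show ?thesis by (simp add: nn_integral_cmult)
  qed
  have two: "(\<integral>\<^sup>+x. \<integral>\<^sup>+y. ennreal ((f y)\<^sup>2) * ennreal (heat_kernel a y x) \<partial>lborel \<partial>lborel) = ?c * (\<integral>\<^sup>+x. ennreal ((f x)\<^sup>2) \<partial>lborel)"
  proof -
    have "(\<integral>\<^sup>+x. \<integral>\<^sup>+y. ennreal ((f y)\<^sup>2) * ennreal (heat_kernel a y x) \<partial>lborel \<partial>lborel)
       = (\<integral>\<^sup>+y. \<integral>\<^sup>+x. ennreal ((f y)\<^sup>2) * ennreal (heat_kernel a y x) \<partial>lborel \<partial>lborel)"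
      by (rule lborel_pair.Fubini') measurable
    also have "\<dots> = (\<integral>\<^sup>+y. \<integral>\<^sup>+x. ennreal ((f y)\<^sup>2) * ennreal (heat_kernel a x y) \<partial>lborel \<partial>lborel)"
      by (simp only: heat_kernel_commute)
    finally show ?thesis using one by simp
  qed
  have "2 * (\<integral>\<^sup>+x. \<integral>\<^sup>+y. ennreal (f x * f y * heat_kernel a y x) \<partial>lborel \<partial>lborel)
     = (\<integral>\<^sup>+x. \<integral>\<^sup>+y. 2 * ennreal (f x * f y * heat_kernel a y x) \<partial>lborel \<partial>lborel)"
    by (simp add: nn_integral_cmult)
  also have "\<dots> \<le> (\<integral>\<^sup>+x. \<integral>\<^sup>+y. ennreal ((f x)\<^sup>2) * ennreal (heat_kernel a y x) + ennreal ((f y)\<^sup>2) * ennreal (heat_kernel a y x) \<partial>lborel \<partial>lborel)"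
  proof (intro nn_integral_mono)
    fix x y
    have "2 * (f x * f y) \<le> (f x)\<^sup>2 + (f y)\<^sup>2" using sum_squares_bound[of "f x" "f y"] by simp
    then have "2 * (f x * f y) * heat_kernel a y x \<le> ((f x)\<^sup>2 + (f y)\<^sup>2) * heat_kernel a y x"
      using hk by (intro mult_right_mono)
    then have "ennreal (2 * (f x * f y * heat_kernel a y x)) \<le> ennreal ((f x)\<^sup>2 * heat_kernel a y x + (f y)\<^sup>2 * heat_kernel a y x)"
      by (intro ennreal_leI) (simp add: algebra_simps)
    then show "2 * ennreal (f x * f y * heat_kernel a y x) \<le> ennreal ((f x)\<^sup>2) * ennreal (heat_kernel a y x) + ennreal ((f y)\<^sup>2) * ennreal (heat_kernel a y x)"
      using hk[of y x] nn[of x] nn[of y] by (simp add: ennreal_mult)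
  qed
  also have "\<dots> = ?c * (\<integral>\<^sup>+x. ennreal ((f x)\<^sup>2) \<partial>lborel) + ?c * (\<integral>\<^sup>+x. ennreal ((f x)\<^sup>2) \<partial>lborel)"
  proof -
    have "(\<integral>\<^sup>+x. \<integral>\<^sup>+y. ennreal ((f x)\<^sup>2) * ennreal (heat_kernel a y x) + ennreal ((f y)\<^sup>2) * ennreal (heat_kernel a y x) \<partial>lborel \<partial>lborel)
      = (\<integral>\<^sup>+x. \<integral>\<^sup>+y. ennreal ((f x)\<^sup>2) * ennreal (heat_kernel a y x) \<partial>lborel \<partial>lborel) + (\<integral>\<^sup>+x. \<integral>\<^sup>+y. ennreal ((f y)\<^sup>2) * ennreal (heat_kernel a y x) \<partial>lborel \<partial>lborel)"
      by (simp add: nn_integral_add)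
    then show ?thesis by (simp only: one two)
  qed
  also have "\<dots> = 2 * (?c * (\<integral>\<^sup>+x. ennreal ((f x)\<^sup>2) \<partial>lborel))" by (rule mult_2[symmetric])
  finally show ?thesis
    by (subst (asm) ennreal_mult_le_mult_iff) (auto simp del: mult_2)
qed

text \<open>
  With a Gaussian convergence factor, the integral of the squared transform is, by two applications
  of the multiplication formula, a double integral of \<open>f\<close> against the heat kernel, which the previous
  lemma bounds. Fatou's lemma removes the factor.
\<close>

lemma fourier_square_integrable:
  fixes f :: "real^'d::finite \<Rightarrow> complex"
  assumes f: "integrable lborel f" and f2: "integrable lborel (\<lambda>x. (norm (f x))\<^sup>2)"
  shows "integrable lborel (\<lambda>k. (norm (fourier f k))\<^sup>2)"
    and "(LINT k|lborel. (norm (fourier f k))\<^sup>2) \<le> (LINT x|lborel. (norm (f x))\<^sup>2)"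
proof -
  have [measurable]: "f \<in> borel_measurable borel" using f by auto
  define N where "N = (LINT x|lborel. (norm (f x))\<^sup>2)"
  have N: "N \<ge> 0" by (simp add: N_def)
  define F where "F = fourier f"
  have [measurable]: "F \<in> borel_measurable borel" unfolding F_def by measurable
  define f' where "f' x = cnj (f (- x))" for x
  have f'i: "integrable lborel f'"
    unfolding f'_def using f by (subst lborel_reflect(1)) auto
  have F': "fourier f' k = cnj (F k)" for k
    unfolding f'_def F_def by (rule fourier_cnj_reflect) measurable
  have bound: "(\<integral>\<^sup>+k. ennreal ((norm (F k))\<^sup>2 * exp (- (\<epsilon> / 2) * (norm k)\<^sup>2)) \<partial>lborel) \<le> ennreal N" if e: "\<epsilon> > 0" for \<epsilon>
  proof -
    let ?G = "\<lambda>k :: real^'d. exp (- (\<epsilon> / 2) * (norm k)\<^sup>2)"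
    define g where "g k = cnj (F k) * gaussian_wave \<epsilon> 0 k" for k
    have Gw: "gaussian_wave \<epsilon> 0 k = complex_of_real (?G k)" for k :: "real^'d"
      by (simp add: gaussian_wave_def)
    have gi: "integrable lborel g"
      unfolding g_def F'[symmetric] by (rule fourier_multiplication_formula(1)[OF f'i integrable_gaussian_wave[OF e]])
    have gh: "fourier g x = complex_of_real ((2 * pi) powr (- real CARD('d) / 2)) * (LINT y|lborel. cnj (f y) * complex_of_real (heat_kernel \<epsilon> y x))" for x
    proof -
      have "(LINT k|lborel. exp (- \<i> * complex_of_real (x \<bullet> k)) * g k) = (LINT k|lborel. fourier f' k * gaussian_wave \<epsilon> (- x) k)"
        unfolding g_def F' by (intro Bochner_Integration.integral_cong refl) (simp add: gaussian_wave_def)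
      also have "\<dots> = (LINT y|lborel. f' y * fourier (gaussian_wave \<epsilon> (- x)) y)"
        by (rule fourier_multiplication_formula(2)[OF f'i integrable_gaussian_wave[OF e]])
      also have "\<dots> = (LINT y|lborel. cnj (f (- y)) * complex_of_real (heat_kernel \<epsilon> (- y) x))"
      proof -
        have "heat_kernel \<epsilon> (- x) y = heat_kernel \<epsilon> (- y) x" for y
          by (simp add: heat_kernel_def add.commute)
        then show ?thesis unfolding f'_def fourier_gaussian_wave[OF e] by simp
      qed
      also have "\<dots> = (LINT y|lborel. cnj (f y) * complex_of_real (heat_kernel \<epsilon> y x))"
        by (rule lborel_reflect(2)) (simp add: heat_kernel_commute[of _ _ x])
      finally show ?thesis unfolding fourier_def by simp
    qed
    have "(LINT k|lborel. complex_of_real ((norm (F k))\<^sup>2 * ?G k)) = (LINT k|lborel. F k * g k)"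
      unfolding g_def Gw by (intro Bochner_Integration.integral_cong refl)
        (simp only: of_real_mult complex_norm_square mult.assoc)
    also have "\<dots> = (LINT x|lborel. f x * fourier g x)"
      unfolding F_def by (rule fourier_multiplication_formula(2)[OF f gi])
    finally have e1: "complex_of_real (LINT k|lborel. (norm (F k))\<^sup>2 * ?G k) = (LINT x|lborel. f x * fourier g x)"
      by (simp only: integral_complex_of_real)
    have ii: "integrable lborel (\<lambda>k. (norm (F k))\<^sup>2 * ?G k)"
    proof -
      have "integrable lborel (\<lambda>k. F k * g k)"
        unfolding F_def by (rule fourier_multiplication_formula(1)[OF f gi])
      then have "integrable lborel (\<lambda>k. norm (F k * g k))" by (rule integrable_norm)
      then show ?thesis by (simp add: g_def Gw norm_mult power2_eq_square mult_ac)
    qed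
    let ?c = "(2 * pi) powr (- real CARD('d) / 2)"
    have "(\<integral>\<^sup>+k. ennreal ((norm (F k))\<^sup>2 * ?G k) \<partial>lborel) = ennreal (LINT k|lborel. (norm (F k))\<^sup>2 * ?G k)"
      by (rule nn_integral_eq_integral[OF ii]) simp
    also have "ennreal (LINT k|lborel. (norm (F k))\<^sup>2 * ?G k) \<le> ennreal (norm (LINT x|lborel. f x * fourier g x))"
      unfolding e1[symmetric] norm_of_real by (intro ennreal_leI abs_ge_self)
    also have "\<dots> \<le> (\<integral>\<^sup>+x. norm (f x * fourier g x) \<partial>lborel)"
      by (rule integral_norm_bound_ennreal)
        (use fourier_multiplication_formula(1)[OF gi f] in \<open>simp add: mult.commute\<close>)
    also have "\<dots> \<le> (\<integral>\<^sup>+x. \<integral>\<^sup>+y. ennreal ?c * ennreal (norm (f x) * norm (f y) * heat_kernel \<epsilon> y x) \<partial>lborel \<partial>lborel)"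
    proof (rule nn_integral_mono)
      fix x :: "real^'d"
      have hk: "heat_kernel \<epsilon> y x > 0" for y using heat_kernel_pos[OF e] .
      have hi: "integrable lborel (\<lambda>y. cnj (f y) * complex_of_real (heat_kernel \<epsilon> y x))"
      proof (rule Bochner_Integration.integrable_bound)
        show "integrable lborel (\<lambda>y. \<epsilon> powr (- real CARD('d) / 2) *\<^sub>R f y)" using f by auto
        show "AE y in lborel. norm (cnj (f y) * complex_of_real (heat_kernel \<epsilon> y x)) \<le> norm (\<epsilon> powr (- real CARD('d) / 2) *\<^sub>R f y)"
        proof (rule AE_I2)
          fix y
          have "norm (f y) * heat_kernel \<epsilon> y x \<le> norm (f y) * \<epsilon> powr (- real CARD('d) / 2)"
            by (intro mult_left_mono heat_kernel_le e) simp
          then show "norm (cnj (f y) * complex_of_real (heat_kernel \<epsilon> y x)) \<le> norm (\<epsilon> powr (- real CARD('d) / 2) *\<^sub>R f y)"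
            using heat_kernel_nonneg[OF e, of y x] by (simp add: norm_mult mult.commute)
        qed
        show "(\<lambda>y. cnj (f y) * complex_of_real (heat_kernel \<epsilon> y x)) \<in> borel_measurable lborel"
          by (simp add: heat_kernel_commute[of _ _ x])
      qed
      have "ennreal (norm (f x * fourier g x)) = ennreal (norm (f x) * ?c) * ennreal (norm (LINT y|lborel. cnj (f y) * complex_of_real (heat_kernel \<epsilon> y x)))"
        unfolding gh by (simp add: norm_mult ennreal_mult[symmetric] mult_ac)
      also have "\<dots> \<le> ennreal (norm (f x) * ?c) * (\<integral>\<^sup>+y. norm (cnj (f y) * complex_of_real (heat_kernel \<epsilon> y x)) \<partial>lborel)"
        by (intro mult_left_mono integral_norm_bound_ennreal hi) simp
      also have "\<dots> = (\<integral>\<^sup>+y. ennreal (norm (f x) * ?c) * norm (cnj (f y) * complex_of_real (heat_kernel \<epsilon> y x)) \<partial>lborel)"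
        using hi by (intro nn_integral_cmult[symmetric]) auto
      also have "\<dots> = (\<integral>\<^sup>+y. ennreal ?c * ennreal (norm (f x) * norm (f y) * heat_kernel \<epsilon> y x) \<partial>lborel)"
        by (intro nn_integral_cong) (use hk in \<open>simp add: norm_mult ennreal_mult[symmetric] less_imp_le mult_ac\<close>)
      finally show "ennreal (norm (f x * fourier g x)) \<le> (\<integral>\<^sup>+y. ennreal ?c * ennreal (norm (f x) * norm (f y) * heat_kernel \<epsilon> y x) \<partial>lborel)" .
    qed
    also have "\<dots> = ennreal ?c * (\<integral>\<^sup>+x. \<integral>\<^sup>+y. ennreal (norm (f x) * norm (f y) * heat_kernel \<epsilon> y x) \<partial>lborel \<partial>lborel)"
      by (subst nn_integral_cmult, measurable, rule nn_integral_cmult, measurable)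
    also have "\<dots> \<le> ennreal ?c * (ennreal ((2 * pi) powr (real CARD('d) / 2)) * (\<integral>\<^sup>+x. ennreal ((norm (f x))\<^sup>2) \<partial>lborel))"
      by (intro mult_left_mono nn_integral_heat_kernel_smoothing_le) (use e in auto)
    also have "\<dots> = (\<integral>\<^sup>+x. ennreal ((norm (f x))\<^sup>2) \<partial>lborel)"
      by (simp add: mult.assoc[symmetric] ennreal_mult[symmetric] powr_minus_divide)
    also have "\<dots> = ennreal N" unfolding N_def by (rule nn_integral_eq_integral[OF f2]) simp
    finally show ?thesis .
  qed
  have "(\<integral>\<^sup>+k. ennreal ((norm (F k))\<^sup>2) \<partial>lborel) = (\<integral>\<^sup>+k. liminf (\<lambda>n. ennreal ((norm (F k))\<^sup>2 * exp (- (inverse (real (Suc n)) / 2) * (norm k)\<^sup>2))) \<partial>lborel)"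
  proof (rule nn_integral_cong)
    fix k :: "real^'d"
    have "(\<lambda>n. (norm (F k))\<^sup>2 * exp (- (inverse (real (Suc n)) / 2) * (norm k)\<^sup>2)) \<longlonglongrightarrow> (norm (F k))\<^sup>2 * exp (- (0 / 2) * (norm k)\<^sup>2)"
      by (intro tendsto_intros LIMSEQ_inverse_real_of_nat) simp
    then have "(\<lambda>n. (norm (F k))\<^sup>2 * exp (- (inverse (real (Suc n)) / 2) * (norm k)\<^sup>2)) \<longlonglongrightarrow> (norm (F k))\<^sup>2"
      by (simp only: div_0 minus_zero mult_zero_left exp_zero mult_1_right)
    from lim_imp_Liminf[OF trivial_limit_sequentially tendsto_ennrealI[OF this]]
    show "ennreal ((norm (F k))\<^sup>2) = liminf (\<lambda>n. ennreal ((norm (F k))\<^sup>2 * exp (- (inverse (real (Suc n)) / 2) * (norm k)\<^sup>2)))"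
      by (rule sym)
  qed
  also have "\<dots> \<le> liminf (\<lambda>n. \<integral>\<^sup>+k. ennreal ((norm (F k))\<^sup>2 * exp (- (inverse (real (Suc n)) / 2) * (norm k)\<^sup>2)) \<partial>lborel)"
    by (rule nn_integral_liminf) measurable
  also have "\<dots> \<le> liminf (\<lambda>n. ennreal N)"
    by (intro Liminf_mono always_eventually allI bound) simp
  also have "\<dots> = ennreal N" by (simp add: Liminf_const)
  finally have le: "(\<integral>\<^sup>+k. ennreal ((norm (F k))\<^sup>2) \<partial>lborel) \<le> ennreal N" .
  show i: "integrable lborel (\<lambda>k. (norm (fourier f k))\<^sup>2)"
    unfolding F_def[symmetric] by (rule integrableI_nonneg) (simp, simp, rule le_less_trans[OF le], simp)
  show "(LINT k|lborel. (norm (fourier f k))\<^sup>2) \<le> (LINT x|lborel. (norm (f x))\<^sup>2)"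
    using le nn_integral_eq_integral[OF i] N unfolding F_def N_def by (simp add: ennreal_le_iff)
qed

section \<open>Functions are determined by their Gaussian averages\<close>

text \<open>
  Positive and negative part are densities of measures that agree on boxes, hence everywhere.
\<close>

lemma AE_zero_if_box_integrals_zero:
  fixes g :: "'a::euclidean_space \<Rightarrow> real"
  assumes [measurable]: "g \<in> borel_measurable borel"
    and i: "\<And>l u. integrable lborel (\<lambda>x. indicator (box l u) x * g x)"
    and z: "\<And>l u. (LINT x|lborel. indicator (box l u) x * g x) = 0"
  shows "AE x in lborel. g x = 0"
proof -
  define M where "M = density lborel (\<lambda>x. ennreal (g x))"
  define N where "N = density lborel (\<lambda>x. ennreal (- g x))"
  let ?E = "range (\<lambda>(a, b). box a b::'a set)"
  let ?A = "\<lambda>n::nat. box (- (real n *\<^sub>R One)) (real n *\<^sub>R One) :: 'a set"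
  have nn: "(\<integral>\<^sup>+x. ennreal (g x) * indicator (box l u) x \<partial>lborel) = (\<integral>\<^sup>+x. ennreal (- g x) * indicator (box l u) x \<partial>lborel)
      \<and> (\<integral>\<^sup>+x. ennreal (g x) * indicator (box l u) x \<partial>lborel) < \<infinity>" for l u
  proof -
    let ?I = "\<lambda>x. indicator (box l u) x * g x"
    have ip: "integrable lborel (\<lambda>x. max 0 (?I x))" "integrable lborel (\<lambda>x. max 0 (- ?I x))"
      using i[of l u] by (auto intro!: integrable_max)
    have e: "(\<integral>\<^sup>+x. ennreal (g x) * indicator (box l u) x \<partial>lborel) = ennreal (LINT x|lborel. max 0 (?I x))"
      by (subst nn_integral_eq_integral[OF ip(1), symmetric]) (auto intro!: nn_integral_cong split: split_indicator simp: ennreal_neg max_def)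
    have e': "(\<integral>\<^sup>+x. ennreal (- g x) * indicator (box l u) x \<partial>lborel) = ennreal (LINT x|lborel. max 0 (- ?I x))"
      by (subst nn_integral_eq_integral[OF ip(2), symmetric]) (auto intro!: nn_integral_cong split: split_indicator simp: ennreal_neg max_def)
    have "(LINT x|lborel. max 0 (?I x)) - (LINT x|lborel. max 0 (- ?I x)) = (LINT x|lborel. max 0 (?I x) - max 0 (- ?I x))"
      by (rule Bochner_Integration.integral_diff[symmetric]) (rule ip)+
    also have "\<dots> = (LINT x|lborel. ?I x)" by (intro Bochner_Integration.integral_cong) (auto simp: max_def)
    finally show ?thesis using z[of l u] unfolding e e' by simp
  qed
  have "M = N"
  proof (rule measure_eqI_generator_eq)
    show "Int_stable ?E" by (auto simp: Int_stable_def box_Int_box)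
    show "?E \<subseteq> Pow UNIV" "sets M = sigma_sets UNIV ?E" "sets N = sigma_sets UNIV ?E"
      by (simp_all add: borel_eq_box M_def N_def)
    show "range ?A \<subseteq> ?E" "(\<Union>i. ?A i) = UNIV" unfolding UN_box_eq_UNIV by auto
    show "emeasure M (?A i) \<noteq> \<infinity>" for i
      using nn[of "- (real i *\<^sub>R One)" "real i *\<^sub>R One"] unfolding M_def by (subst emeasure_density) auto
    show "emeasure M X = emeasure N X" if "X \<in> ?E" for X
      using that nn unfolding M_def N_def by (auto simp: emeasure_density)
  qed
  then have "AE x in lborel. ennreal (g x) = ennreal (- g x)"
    unfolding M_def N_def by (intro sigma_finite_measure.density_unique[OF sigma_finite_lborel]) auto
  then show ?thesis
  proof eventually_elim
    case (elim x)
    then show ?case by (cases "g x \<ge> 0") (auto simp: ennreal_neg ennreal_eq_0_iff)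
  qed
qed

text \<open>
  Half of the exponent is split off: it supplies decay, while the other half is again a heat
  kernel, whose integral does not depend on \<open>a\<close>.
\<close>

lemma heat_kernel_double:
  fixes x y :: "real^'d::finite"
  assumes a: "a > 0"
  shows "heat_kernel a y x = 2 powr (real CARD('d) / 2) * exp (- (norm (x - y))\<^sup>2 / (4 * a)) * heat_kernel (2 * a) y x"
proof -
  have "exp (- (norm (x - y))\<^sup>2 / (2 * a)) = exp (- (norm (x - y))\<^sup>2 / (4 * a)) * exp (- (norm (x - y))\<^sup>2 / (2 * (2 * a)))"
    unfolding exp_add[symmetric] using a by (simp add: field_simps)
  moreover have "a powr (- real CARD('d) / 2) = 2 powr (real CARD('d) / 2) * (2 * a) powr (- real CARD('d) / 2)"
    using a by (simp add: powr_mult powr_minus_divide)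
  ultimately show ?thesis unfolding heat_kernel_def by simp
qed

lemma norm_square_le_shift:
  fixes x y :: "'a::real_normed_vector"
  assumes "norm y \<le> R"
  shows "(norm x)\<^sup>2 / 2 - R\<^sup>2 \<le> (norm (x - y))\<^sup>2"
proof -
  have "norm x \<le> norm (x - y) + R" using norm_triangle_sub[of x y] assms by linarith
  moreover have "R \<ge> 0" using assms norm_ge_zero order_trans by blast
  ultimately have "(norm x)\<^sup>2 \<le> (norm (x - y) + R)\<^sup>2" by (intro power_mono) auto
  also have "\<dots> \<le> 2 * (norm (x - y))\<^sup>2 + 2 * R\<^sup>2"
    using sum_squares_bound[of "norm (x - y)" R] by (simp add: power2_sum)
  finally show ?thesis by simp
qed

text \<open>
  Integrating the hypothesis over the center \<open>y\<close> in a box \<open>S\<close> shows that \<open>h\<close> is orthogonal to the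
  heat flow of the indicator function of \<open>S\<close>. As the time \<open>a\<close> tends to zero this flow tends to a
  multiple of the indicator outside of the boundary of \<open>S\<close>, dominated by one Gaussian for all
  \<open>a \<le> 1\<close>; so \<open>h\<close> has integral zero over every box.
\<close>

lemma heat_kernel_uniqueness:
  fixes h :: "real^'d::finite \<Rightarrow> complex"
  assumes [measurable]: "h \<in> borel_measurable borel"
    and i: "\<And>a. a > 0 \<Longrightarrow> integrable lborel (\<lambda>x. norm (h x) * exp (- (a * (norm x)\<^sup>2)))"
    and z: "\<And>a y. 0 < a \<Longrightarrow> a \<le> 1 \<Longrightarrow> (LINT x|lborel. h x * complex_of_real (heat_kernel a y x)) = 0"
  shows "AE x in lborel. h x = 0"
proof -
  let ?D = "(2 * pi) powr (real CARD('d) / 2)"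
  let ?T = "2 powr (real CARD('d) / 2) :: real"
  have ibox: "integrable lborel (\<lambda>x. indicator (box l u) x *\<^sub>R h x) \<and> (LINT x|lborel. indicator (box l u) x *\<^sub>R h x) = 0" for l u
  proof -
    define S where "S = box l u"
    have [measurable]: "S \<in> sets borel" by (simp add: S_def)
    have "bounded S" by (simp add: S_def)
    then obtain R where R: "\<And>y. y \<in> S \<Longrightarrow> norm y \<le> R" by (auto simp: bounded_iff)
    have Sfin: "emeasure lborel S < \<infinity>" using emeasure_lborel_box_finite by (simp add: S_def)
    have Sint: "integrable lborel (indicator S :: _ \<Rightarrow> real)" using Sfin by (intro integrable_real_indicator) auto
    define k where "k a x = (LINT y|lborel. indicator S y * heat_kernel a y x)" for a x
    have ki: "integrable lborel (\<lambda>y. indicator S y * heat_kernel a y x)" if "a > 0" for a x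
      using integrable_mult_indicator[OF _ integrable_heat_kernel_center[OF that, of x], of S] by simp
    have [measurable]: "k a \<in> borel_measurable borel" for a unfolding k_def by measurable
    have kz: "(LINT x|lborel. h x * complex_of_real (k a x)) = 0" if a: "0 < a" "a \<le> 1" for a
    proof -
      define C where "C = a powr (- real CARD('d) / 2) * exp (R\<^sup>2 / (2 * a))"
      have B1: "heat_kernel a y x \<le> C * exp (- (1 / (4 * a) * (norm x)\<^sup>2))" if "y \<in> S" for x y
      proof -
        have "- (norm (x - y))\<^sup>2 / (2 * a) \<le> R\<^sup>2 / (2 * a) + - (1 / (4 * a) * (norm x)\<^sup>2)"
          using norm_square_le_shift[OF R[OF that], of x] a by (simp add: field_simps)
        then have "exp (- (norm (x - y))\<^sup>2 / (2 * a)) \<le> exp (R\<^sup>2 / (2 * a)) * exp (- (1 / (4 * a) * (norm x)\<^sup>2))"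
          unfolding exp_add[symmetric] by simp
        then show ?thesis unfolding heat_kernel_def C_def mult.assoc by (intro mult_left_mono) auto
      qed
      define K where "K y x = complex_of_real (indicator S y) * (h x * complex_of_real (heat_kernel a y x))" for x y
      have K: "integrable (lborel \<Otimes>\<^sub>M lborel) (case_prod K)"
      proof (rule Bochner_Integration.integrable_bound)
        show "integrable (lborel \<Otimes>\<^sub>M lborel) (\<lambda>p. (indicator S (fst p) * C) * (norm (h (snd p)) * exp (- (1 / (4 * a) * (norm (snd p))\<^sup>2))))"
          (is "integrable _ ?q")
        proof (rule lborel_pair.Fubini_integrable)
          show "?q \<in> borel_measurable (lborel \<Otimes>\<^sub>M lborel)" by measurable
          show "integrable lborel (\<lambda>x. LINT y|lborel. norm (?q (x, y)))"
            using i[of "1 / (4 * a)"] a Sint by (simp add: norm_mult C_def)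
          show "AE x in lborel. integrable lborel (\<lambda>y. ?q (x, y))"
            using i[of "1 / (4 * a)"] a by auto
        qed
        show "case_prod K \<in> borel_measurable (lborel \<Otimes>\<^sub>M lborel)" unfolding K_def split_beta by measurable
        show "AE p in lborel \<Otimes>\<^sub>M lborel. norm (case_prod K p) \<le> norm (?q p)"
        proof (intro AE_I2)
          fix p :: "(real^'d) \<times> (real^'d)"
          obtain y x where p: "p = (y, x)" by (cases p)
          show "norm (case_prod K p) \<le> norm (?q p)"
          proof (cases "y \<in> S")
            case True
            have "norm (h x) * heat_kernel a y x \<le> norm (h x) * (C * exp (- (1 / (4 * a) * (norm x)\<^sup>2)))"
              by (intro mult_left_mono B1 True) simp
            then show ?thesis using True heat_kernel_nonneg[OF a(1), of y x]
              by (simp add: p K_def norm_mult C_def mult_ac)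
          qed (simp add: p K_def)
        qed
      qed
      have "(LINT x|lborel. h x * complex_of_real (k a x)) = (LINT x|lborel. LINT y|lborel. K y x)"
      proof (intro Bochner_Integration.integral_cong refl)
        fix x
        have "(LINT y|lborel. K y x) = (LINT y|lborel. h x * complex_of_real (indicator S y * heat_kernel a y x))"
          unfolding K_def by (intro Bochner_Integration.integral_cong refl) simp
        also have "\<dots> = h x * (LINT y|lborel. complex_of_real (indicator S y * heat_kernel a y x))"
          by (rule integral_mult_right_zero)
        also have "\<dots> = h x * complex_of_real (k a x)" unfolding k_def integral_complex_of_real ..
        finally show "h x * complex_of_real (k a x) = (LINT y|lborel. K y x)" by simp
      qed
      also have "\<dots> = (LINT y|lborel. LINT x|lborel. K y x)"
        by (rule lborel_pair.Fubini_integral[OF K])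
      also have "\<dots> = (LINT y|(lborel :: (real^'d) measure). 0)"
        unfolding K_def integral_mult_right_zero by (simp only: z[OF a] mult_zero_right)
      finally show ?thesis by simp
    qed
    have k0: "k a x \<ge> 0" if "a > 0" for a x
      unfolding k_def using that by (intro integral_nonneg_AE AE_I2) (simp add: heat_kernel_nonneg)
    have kbound: "k a x \<le> (?T * exp (R\<^sup>2 / 4) * ?D) * exp (- (1 / 8 * (norm x)\<^sup>2))" if a: "0 < a" "a \<le> 1" for a x
    proof -
      have "k a x \<le> (LINT y|lborel. ?T * exp (R\<^sup>2 / 4) * exp (- (1 / 8 * (norm x)\<^sup>2)) * heat_kernel (2 * a) y x)"
        unfolding k_def
      proof (rule integral_mono)
        show "integrable lborel (\<lambda>y. indicator S y * heat_kernel a y x)" by (rule ki[OF a(1)])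
        show "integrable lborel (\<lambda>y. ?T * exp (R\<^sup>2 / 4) * exp (- (1 / 8 * (norm x)\<^sup>2)) * heat_kernel (2 * a) y x)"
          using a by (intro integrable_mult_right integrable_heat_kernel_center) simp
        fix y :: "real^'d"
        have h0: "heat_kernel (2 * a) y x \<ge> 0" using a by (intro heat_kernel_nonneg) simp
        show "indicator S y * heat_kernel a y x \<le> ?T * exp (R\<^sup>2 / 4) * exp (- (1 / 8 * (norm x)\<^sup>2)) * heat_kernel (2 * a) y x"
        proof (cases "y \<in> S")
          case True
          have "(norm (x - y))\<^sup>2 / 4 \<le> (norm (x - y))\<^sup>2 / (4 * a)"
            using a by (intro divide_left_mono) auto
          then have "- (norm (x - y))\<^sup>2 / (4 * a) \<le> R\<^sup>2 / 4 + - (1 / 8 * (norm x)\<^sup>2)"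
            using norm_square_le_shift[OF R[OF True], of x] by simp
          then have "exp (- (norm (x - y))\<^sup>2 / (4 * a)) \<le> exp (R\<^sup>2 / 4) * exp (- (1 / 8 * (norm x)\<^sup>2))"
            unfolding exp_add[symmetric] by simp
          then have "?T * exp (- (norm (x - y))\<^sup>2 / (4 * a)) * heat_kernel (2 * a) y x \<le> ?T * (exp (R\<^sup>2 / 4) * exp (- (1 / 8 * (norm x)\<^sup>2))) * heat_kernel (2 * a) y x"
            using h0 by (intro mult_right_mono mult_left_mono) auto
          then show ?thesis using True by (simp add: heat_kernel_double[OF a(1)] mult.assoc)
        qed (use h0 in simp)
      qed
      also have "\<dots> = (?T * exp (R\<^sup>2 / 4) * ?D) * exp (- (1 / 8 * (norm x)\<^sup>2))"
        using a integral_heat_kernel[of "2 * a" x] by (simp add: heat_kernel_commute[of _ _ x])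
      finally show ?thesis .
    qed
    \<comment> \<open>Only a vanishing part of the heat kernel lies at distance \<open>\<delta>\<close> or more from its center.\<close>
    have tail: "(LINT y|lborel. indicator A y * heat_kernel a y x) \<le> ?T * exp (- (\<delta>\<^sup>2 / 4) / a) * ?D"
      if a: "a > 0" and A: "A \<in> sets borel" "A \<inter> ball x \<delta> = {}" and d: "\<delta> > 0" for A :: "(real^'d) set" and a x \<delta>
    proof -
      have "(LINT y|lborel. indicator A y * heat_kernel a y x) \<le> (LINT y|lborel. ?T * exp (- (\<delta>\<^sup>2 / 4) / a) * heat_kernel (2 * a) y x)"
      proof (rule integral_mono)
        show "integrable lborel (\<lambda>y. indicator A y * heat_kernel a y x)"
          using integrable_mult_indicator[OF _ integrable_heat_kernel_center[OF a, of x], of A] A by simp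
        show "integrable lborel (\<lambda>y. ?T * exp (- (\<delta>\<^sup>2 / 4) / a) * heat_kernel (2 * a) y x)"
          using a by (intro integrable_mult_right integrable_heat_kernel_center) simp
        fix y :: "real^'d"
        have h0: "heat_kernel (2 * a) y x \<ge> 0" using a by (intro heat_kernel_nonneg) simp
        show "indicator A y * heat_kernel a y x \<le> ?T * exp (- (\<delta>\<^sup>2 / 4) / a) * heat_kernel (2 * a) y x"
        proof (cases "y \<in> A")
          case True
          then have "\<delta> \<le> norm (x - y)" using A by (auto simp: dist_norm disjoint_iff)
          then have "\<delta>\<^sup>2 \<le> (norm (x - y))\<^sup>2" using d by (intro power_mono) auto
          then have "exp (- (norm (x - y))\<^sup>2 / (4 * a)) \<le> exp (- (\<delta>\<^sup>2 / 4) / a)"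
            using a by (simp add: field_simps)
          then have "?T * exp (- (norm (x - y))\<^sup>2 / (4 * a)) * heat_kernel (2 * a) y x \<le> ?T * exp (- (\<delta>\<^sup>2 / 4) / a) * heat_kernel (2 * a) y x"
            using h0 by (intro mult_right_mono mult_left_mono) auto
          then show ?thesis using True by (simp add: heat_kernel_double[OF a(1)])
        qed (use h0 in simp)
      qed
      also have "\<dots> = ?T * exp (- (\<delta>\<^sup>2 / 4) / a) * ?D"
        using a integral_heat_kernel[of "2 * a" x] by (simp add: heat_kernel_commute[of _ _ x])
      finally show ?thesis .
    qed
    define \<epsilon> where "\<epsilon> n = inverse (real (Suc n))" for n
    have e: "\<epsilon> n > 0" "\<epsilon> n \<le> 1" for n by (auto simp: \<epsilon>_def inverse_le_1_iff)
    have etail: "(\<lambda>n. ?T * exp (- (\<delta>\<^sup>2 / 4) / \<epsilon> n) * ?D) \<longlonglongrightarrow> 0" if "\<delta> > 0" for \<delta>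
    proof -
      have "(\<lambda>n. exp (- (\<delta>\<^sup>2 / 4)) ^ Suc n) \<longlonglongrightarrow> 0"
        by (rule LIMSEQ_Suc[OF LIMSEQ_realpow_zero]) (use that in auto)
      moreover have "exp (- (\<delta>\<^sup>2 / 4)) ^ Suc n = exp (- (\<delta>\<^sup>2 / 4) / \<epsilon> n)" for n
      proof -
        have "- (\<delta>\<^sup>2 / 4) / \<epsilon> n = real (Suc n) * - (\<delta>\<^sup>2 / 4)"
          unfolding \<epsilon>_def divide_inverse[of "- (\<delta>\<^sup>2 / 4)"] inverse_inverse_eq by (rule mult.commute)
        then show ?thesis by (simp only: exp_of_nat_mult)
      qed
      ultimately have "(\<lambda>n. exp (- (\<delta>\<^sup>2 / 4) / \<epsilon> n)) \<longlonglongrightarrow> 0" by (simp only:)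
      from tendsto_mult_left_zero[OF tendsto_mult_right_zero[OF this]] show ?thesis .
    qed
    have "AE x in lborel. x \<notin> frontier S"
    proof -
      have "negligible (frontier S)" unfolding S_def by (intro negligible_convex_frontier convex_box)
      then have "AE x in lebesgue. x \<notin> frontier S" using negligible_iff_null_sets AE_not_in by blast
      then show ?thesis by (simp add: AE_completion_iff)
    qed
    then have lim: "AE x in lborel. (\<lambda>n. k (\<epsilon> n) x) \<longlonglongrightarrow> indicator S x * ?D"
    proof eventually_elim
      case (elim x)
      show ?case
      proof (cases "x \<in> S")
        case True
        then obtain \<delta> where d: "\<delta> > 0" "ball x \<delta> \<subseteq> S" using open_box unfolding S_def open_contains_ball by blast
        have "(\<lambda>n. ?D - k (\<epsilon> n) x) \<longlonglongrightarrow> 0"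
        proof (rule tendsto_sandwich[OF _ _ tendsto_const etail[OF d(1)]])
          have eq: "?D - k a x = (LINT y|lborel. indicator (- S) y * heat_kernel a y x)" if a: "a > 0" for a
          proof -
            have "?D - k a x = (LINT y|lborel. heat_kernel a y x) - k a x"
              using integral_heat_kernel[OF a, of x] by (simp add: heat_kernel_commute[of _ _ x])
            also have "\<dots> = (LINT y|lborel. heat_kernel a y x - indicator S y * heat_kernel a y x)"
              unfolding k_def by (rule Bochner_Integration.integral_diff[symmetric]) (rule integrable_heat_kernel_center[OF a] ki[OF a])+
            also have "\<dots> = (LINT y|lborel. indicator (- S) y * heat_kernel a y x)"
              by (intro Bochner_Integration.integral_cong) (auto split: split_indicator)
            finally show ?thesis .
          qed
          show "\<forall>\<^sub>F n in sequentially. 0 \<le> ?D - k (\<epsilon> n) x"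
            unfolding eq[OF e(1)] using e(1) by (intro always_eventually allI integral_nonneg_AE AE_I2) (simp add: heat_kernel_nonneg)
          show "\<forall>\<^sub>F n in sequentially. ?D - k (\<epsilon> n) x \<le> ?T * exp (- (\<delta>\<^sup>2 / 4) / \<epsilon> n) * ?D"
            unfolding eq[OF e(1)] by (intro always_eventually allI tail e) (use d in auto)
        qed
        then have "(\<lambda>n. ?D - (?D - k (\<epsilon> n) x)) \<longlonglongrightarrow> ?D - 0" by (intro tendsto_diff tendsto_const)
        then show ?thesis using True by simp
      next
        case False
        then have "x \<notin> closure S" using elim False interior_subset[of S] by (auto simp: frontier_def)
        then obtain \<delta> where d: "\<delta> > 0" "ball x \<delta> \<subseteq> - closure S" using open_Compl[OF closed_closure, of S] unfolding open_contains_ball by blast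
        then have dis: "S \<inter> ball x \<delta> = {}" using closure_subset[of S] by blast
        have "(\<lambda>n. k (\<epsilon> n) x) \<longlonglongrightarrow> 0"
        proof (rule tendsto_sandwich[OF _ _ tendsto_const etail[OF d(1)]])
          show "\<forall>\<^sub>F n in sequentially. 0 \<le> k (\<epsilon> n) x" using k0[OF e(1)] by simp
          show "\<forall>\<^sub>F n in sequentially. k (\<epsilon> n) x \<le> ?T * exp (- (\<delta>\<^sup>2 / 4) / \<epsilon> n) * ?D"
            unfolding k_def by (intro always_eventually allI tail e) (use d dis in auto)
        qed
        then show ?thesis using False by simp
      qed
    qed
    define C where "C = ?T * exp (R\<^sup>2 / 4) * ?D"
    have wi: "integrable lborel (\<lambda>x. C * (norm (h x) * exp (- (1 / 8 * (norm x)\<^sup>2))))"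
      by (intro integrable_mult_right i) simp
    have conv: "AE x in lborel. (\<lambda>n. h x * complex_of_real (k (\<epsilon> n) x)) \<longlonglongrightarrow> h x * complex_of_real (indicator S x * ?D)"
      using lim by eventually_elim (intro tendsto_intros)
    have dom: "AE x in lborel. norm (h x * complex_of_real (k (\<epsilon> n) x)) \<le> C * (norm (h x) * exp (- (1 / 8 * (norm x)\<^sup>2)))" for n
    proof (rule AE_I2)
      fix x
      have "norm (h x) * k (\<epsilon> n) x \<le> norm (h x) * (C * exp (- (1 / 8 * (norm x)\<^sup>2)))"
        unfolding C_def by (intro mult_left_mono kbound e) simp
      then show "norm (h x * complex_of_real (k (\<epsilon> n) x)) \<le> C * (norm (h x) * exp (- (1 / 8 * (norm x)\<^sup>2)))"
        using k0[OF e(1)] by (simp add: norm_mult mult_ac)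
    qed
    have m1: "(\<lambda>x. h x * complex_of_real (indicator S x * ?D)) \<in> borel_measurable lborel" by measurable
    have m2: "(\<lambda>x. h x * complex_of_real (k (\<epsilon> n) x)) \<in> borel_measurable lborel" for n by measurable
    have I: "integrable lborel (\<lambda>x. h x * complex_of_real (indicator S x * ?D))"
      by (rule integrable_dominated_convergence[OF m1 m2 wi conv dom])
    have "(\<lambda>n. LINT x|lborel. h x * complex_of_real (k (\<epsilon> n) x)) \<longlonglongrightarrow> (LINT x|lborel. h x * complex_of_real (indicator S x * ?D))"
      by (rule integral_dominated_convergence[OF m1 m2 wi conv dom])
    then have Z: "(LINT x|lborel. h x * complex_of_real (indicator S x * ?D)) = 0"
      unfolding kz[OF e] using LIMSEQ_unique tendsto_const by blast
    have eq: "indicator S x *\<^sub>R h x = complex_of_real (1 / ?D) * (h x * complex_of_real (indicator S x * ?D))" for x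
      by (simp add: scaleR_conv_of_real)
    show ?thesis unfolding S_def[symmetric] eq
      by (intro conjI integrable_mult_right I) (simp only: integral_mult_right_zero Z mult_zero_right)
  qed
  have r: "AE x in lborel. Re (h x) = 0"
  proof (rule AE_zero_if_box_integrals_zero)
    fix l u
    have eq: "indicator (box l u) x * Re (h x) = Re (indicator (box l u) x *\<^sub>R h x)" for x by simp
    show "integrable lborel (\<lambda>x. indicator (box l u) x * Re (h x))" "(LINT x|lborel. indicator (box l u) x * Re (h x)) = 0"
      unfolding eq using ibox[of l u] by (auto simp only: integral_Re integrable_Re zero_complex.sel)
  qed measurable
  have im: "AE x in lborel. Im (h x) = 0"
  proof (rule AE_zero_if_box_integrals_zero)
    fix l u
    have eq: "indicator (box l u) x * Im (h x) = Im (indicator (box l u) x *\<^sub>R h x)" for x by simp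
    show "integrable lborel (\<lambda>x. indicator (box l u) x * Im (h x))" "(LINT x|lborel. indicator (box l u) x * Im (h x)) = 0"
      unfolding eq using ibox[of l u] by (auto simp only: integral_Im integrable_Im zero_complex.sel)
  qed measurable
  show ?thesis using r im by eventually_elim (simp add: complex_eq_iff)
qed

section \<open>The Fourier transform of square integrable functions\<close>

lemma L2_D:
  assumes "u \<in> L2"
  shows "u \<in> borel_measurable borel" "integrable lborel (\<lambda>x. (norm (u x))\<^sup>2)"
  using assms by (auto simp: L2_def)

lemma L2_norm_nonneg: "L2_norm u \<ge> 0"
  by (simp add: L2_norm_def)

lemma L2_norm_square: "(L2_norm u)\<^sup>2 = (LINT x|lborel. (norm (u x))\<^sup>2)"
  by (simp add: L2_norm_def)

lemma L2_I_bound: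
  assumes m: "u \<in> borel_measurable borel" and b: "(\<integral>\<^sup>+x. ennreal ((norm (u x))\<^sup>2) \<partial>lborel) \<le> ennreal (C\<^sup>2)" and C: "C \<ge> 0"
  shows "u \<in> L2" "L2_norm u \<le> C"
proof -
  have i: "integrable lborel (\<lambda>x. (norm (u x))\<^sup>2)"
    by (rule integrableI_nonneg) (use m in simp, simp, rule le_less_trans[OF b], simp)
  then show "u \<in> L2" using m by (simp add: L2_def)
  have "(LINT x|lborel. (norm (u x))\<^sup>2) \<le> C\<^sup>2"
    using b nn_integral_eq_integral[OF i] by (simp add: ennreal_le_iff)
  then show "L2_norm u \<le> C" unfolding L2_norm_def using C real_le_lsqrt by simp
qed

lemma nn_integral_L2:
  "u \<in> L2 \<Longrightarrow> (\<integral>\<^sup>+x. ennreal ((norm (u x))\<^sup>2) \<partial>lborel) = ennreal ((L2_norm u)\<^sup>2)"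
  unfolding L2_norm_square by (rule nn_integral_eq_integral) (auto dest: L2_D)

lemma L2_mult:
  fixes u v :: "real^'d::finite \<Rightarrow> complex"
  assumes u: "u \<in> L2" and v: "v \<in> L2"
  shows "integrable lborel (\<lambda>x. u x * v x)" "(LINT x|lborel. norm (u x * v x)) \<le> L2_norm u * L2_norm v"
    "norm (LINT x|lborel. u x * v x) \<le> L2_norm u * L2_norm v"
proof -
  note [measurable] = L2_D(1)[OF u] L2_D(1)[OF v]
  have cs: "(\<integral>\<^sup>+x. ennreal (norm (u x) * norm (v x)) \<partial>lborel) \<le> ennreal (L2_norm u * L2_norm v)"
    unfolding L2_norm_def by (rule nn_integral_Cauchy_Schwarz) (use L2_D(2)[OF u] L2_D(2)[OF v] in auto)
  then have cs': "(\<integral>\<^sup>+x. ennreal (norm (u x * v x)) \<partial>lborel) \<le> ennreal (L2_norm u * L2_norm v)"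
    by (simp add: norm_mult)
  show i: "integrable lborel (\<lambda>x. u x * v x)"
    by (rule integrableI_bounded) (simp, rule le_less_trans[OF cs'], simp)
  show "(LINT x|lborel. norm (u x * v x)) \<le> L2_norm u * L2_norm v"
    using cs' nn_integral_eq_integral[OF integrable_norm[OF i]] L2_norm_nonneg[of u] L2_norm_nonneg[of v]
    by (simp add: ennreal_le_iff)
  then show "norm (LINT x|lborel. u x * v x) \<le> L2_norm u * L2_norm v"
    by (rule order_trans[OF integral_norm_bound])
qed

lemma L2_diff:
  fixes u v :: "real^'d::finite \<Rightarrow> complex"
  assumes u: "u \<in> L2" and v: "v \<in> L2"
  shows "(\<lambda>x. u x - v x) \<in> L2" "(L2_norm (\<lambda>x. u x - v x))\<^sup>2 \<le> 2 * (L2_norm u)\<^sup>2 + 2 * (L2_norm v)\<^sup>2"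
proof -
  note [measurable] = L2_D(1)[OF u] L2_D(1)[OF v]
  have b: "(norm (u x - v x))\<^sup>2 \<le> 2 * (norm (u x))\<^sup>2 + 2 * (norm (v x))\<^sup>2" for x
  proof -
    have "(norm (u x - v x))\<^sup>2 \<le> (norm (u x) + norm (v x))\<^sup>2" by (intro power_mono norm_triangle_ineq4) simp
    also have "\<dots> \<le> 2 * (norm (u x))\<^sup>2 + 2 * (norm (v x))\<^sup>2"
      using sum_squares_bound[of "norm (u x)" "norm (v x)"] by (simp add: power2_sum)
    finally show ?thesis .
  qed
  have bi: "integrable lborel (\<lambda>x. 2 * (norm (u x))\<^sup>2 + 2 * (norm (v x))\<^sup>2)"
    using L2_D(2)[OF u] L2_D(2)[OF v] by auto
  have i: "integrable lborel (\<lambda>x. (norm (u x - v x))\<^sup>2)"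
  proof (rule Bochner_Integration.integrable_bound[OF bi])
    show "AE x in lborel. norm ((norm (u x - v x))\<^sup>2) \<le> norm (2 * (norm (u x))\<^sup>2 + 2 * (norm (v x))\<^sup>2)"
      unfolding real_norm_def by (intro AE_I2 order_trans[OF _ abs_ge_self]) (simp add: b)
  qed measurable
  then show "(\<lambda>x. u x - v x) \<in> L2" by (simp add: L2_def)
  show "(L2_norm (\<lambda>x. u x - v x))\<^sup>2 \<le> 2 * (L2_norm u)\<^sup>2 + 2 * (L2_norm v)\<^sup>2"
    unfolding L2_norm_square using integral_mono[OF i bi b] L2_D(2)[OF u] L2_D(2)[OF v] by simp
qed

lemma fourier_L2:
  assumes "integrable lborel f" "f \<in> L2"
  shows "fourier f \<in> L2" "L2_norm (fourier f) \<le> L2_norm f"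
  using fourier_square_integrable[OF assms(1) L2_D(2)[OF assms(2)]] L2_D(1)[OF assms(2)] measurable_fourier[OF L2_D(1)[OF assms(2)]]
  by (auto simp: L2_def L2_norm_def)

lemma fourier_diff:
  fixes f g :: "real^'d::finite \<Rightarrow> complex"
  assumes "integrable lborel f" "integrable lborel g"
  shows "fourier (\<lambda>x. f x - g x) k = fourier f k - fourier g k"
  unfolding fourier_def using integrable_fourier_kernel[OF assms(1), of k] integrable_fourier_kernel[OF assms(2), of k]
  by (simp add: right_diff_distrib)

text \<open>
  Multiplication by a wide Gaussian makes a square integrable function integrable.
\<close>

definition gaussian_cutoff :: "(real^'d::finite \<Rightarrow> complex) \<Rightarrow> nat \<Rightarrow> real^'d \<Rightarrow> complex" where
  "gaussian_cutoff U n x = U x * complex_of_real (exp (- (inverse (real (Suc n)) * (norm x)\<^sup>2)))"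

lemma gaussian_L2: "a > 0 \<Longrightarrow> (\<lambda>x. complex_of_real (exp (- (a * (norm (x::real^'d::finite))\<^sup>2)))) \<in> L2"
  using integrable_gaussian[of "2 * a" "0 :: real^'d"]
  by (simp add: L2_def power2_eq_square exp_add[symmetric] mult_2[symmetric] mult.assoc)

lemma norm_gaussian_cutoff_le: "norm (gaussian_cutoff U n x) \<le> norm (U x)"
  unfolding gaussian_cutoff_def norm_mult by (intro mult_left_le) auto

lemma measurable_gaussian_cutoff [measurable (raw)]:
  assumes [measurable]: "U \<in> borel_measurable borel"
  shows "gaussian_cutoff U n \<in> borel_measurable borel"
  unfolding gaussian_cutoff_def by measurable

lemma gaussian_cutoff_integrable:
  assumes "U \<in> L2"
  shows "integrable lborel (gaussian_cutoff U n)"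
  unfolding gaussian_cutoff_def[abs_def] by (rule L2_mult(1)[OF assms gaussian_L2]) simp

lemma gaussian_cutoff_L2:
  assumes "U \<in> L2"
  shows "gaussian_cutoff U n \<in> L2" "L2_norm (gaussian_cutoff U n) \<le> L2_norm U"
proof -
  note [measurable] = L2_D(1)[OF assms]
  have "(\<integral>\<^sup>+x. ennreal ((norm (gaussian_cutoff U n x))\<^sup>2) \<partial>lborel) \<le> (\<integral>\<^sup>+x. ennreal ((norm (U x))\<^sup>2) \<partial>lborel)"
    by (intro nn_integral_mono ennreal_leI power_mono norm_gaussian_cutoff_le) simp
  also have "\<dots> = ennreal ((L2_norm U)\<^sup>2)" by (rule nn_integral_L2[OF assms])
  finally have b: "(\<integral>\<^sup>+x. ennreal ((norm (gaussian_cutoff U n x))\<^sup>2) \<partial>lborel) \<le> ennreal ((L2_norm U)\<^sup>2)" .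
  have m: "gaussian_cutoff U n \<in> borel_measurable borel" by measurable
  show "gaussian_cutoff U n \<in> L2" by (rule L2_I_bound(1)[OF m b L2_norm_nonneg])
  show "L2_norm (gaussian_cutoff U n) \<le> L2_norm U" by (rule L2_I_bound(2)[OF m b L2_norm_nonneg])
qed

lemma gaussian_cutoff_tendsto: "(\<lambda>n. gaussian_cutoff U n x) \<longlonglongrightarrow> U x"
proof -
  have "(\<lambda>n. U x * complex_of_real (exp (- (inverse (real (Suc n)) * (norm x)\<^sup>2)))) \<longlonglongrightarrow> U x * complex_of_real (exp (- (0 * (norm x)\<^sup>2)))"
    by (intro tendsto_mult tendsto_const tendsto_of_real tendsto_exp tendsto_minus LIMSEQ_inverse_real_of_nat)
  then show ?thesis by (simp add: gaussian_cutoff_def)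
qed

lemma gaussian_cutoff_L2_tendsto:
  fixes U :: "real^'d::finite \<Rightarrow> complex"
  assumes "U \<in> L2"
  shows "(\<lambda>n. (L2_norm (\<lambda>x. gaussian_cutoff U n x - U x))\<^sup>2) \<longlonglongrightarrow> 0"
proof -
  note [measurable] = L2_D(1)[OF assms]
  have "(\<lambda>n. LINT x|lborel. (norm (gaussian_cutoff U n x - U x))\<^sup>2) \<longlonglongrightarrow> (LINT x|(lborel :: (real^'d) measure). (0::real))"
  proof (rule integral_dominated_convergence)
    show "integrable lborel (\<lambda>x. 4 * (norm (U x))\<^sup>2)" using L2_D(2)[OF assms] by simp
    show "AE x in lborel. (\<lambda>n. (norm (gaussian_cutoff U n x - U x))\<^sup>2) \<longlonglongrightarrow> 0"
    proof (rule AE_I2)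
      fix x
      have "(\<lambda>n. (norm (gaussian_cutoff U n x - U x))\<^sup>2) \<longlonglongrightarrow> (norm (U x - U x))\<^sup>2"
        by (intro tendsto_power tendsto_norm tendsto_diff tendsto_const gaussian_cutoff_tendsto)
      then show "(\<lambda>n. (norm (gaussian_cutoff U n x - U x))\<^sup>2) \<longlonglongrightarrow> 0" by simp
    qed
    show "AE x in lborel. norm ((norm (gaussian_cutoff U n x - U x))\<^sup>2) \<le> 4 * (norm (U x))\<^sup>2" for n
    proof (rule AE_I2)
      fix x
      have "norm (gaussian_cutoff U n x - U x) \<le> 2 * norm (U x)"
        using norm_triangle_ineq4[of "gaussian_cutoff U n x" "U x"] norm_gaussian_cutoff_le[of U n x] by linarith
      then have "(norm (gaussian_cutoff U n x - U x))\<^sup>2 \<le> (2 * norm (U x))\<^sup>2" by (intro power_mono) auto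
      then show "norm ((norm (gaussian_cutoff U n x - U x))\<^sup>2) \<le> 4 * (norm (U x))\<^sup>2" by (simp add: power_mult_distrib)
    qed
  qed measurable
  then show ?thesis by (simp add: L2_norm_square)
qed

text \<open>
  By the Bessel inequality the transforms of the cutoffs form a Cauchy sequence. A subsequence
  converges almost everywhere, Fatou's lemma bounds the limit and shows convergence in norm,
  and the multiplication formula passes to the limit.
\<close>

theorem L2_fourier_transform_exists:
  fixes U :: "real^'d::finite \<Rightarrow> complex"
  assumes U: "U \<in> L2"
  obtains W r where "W \<in> L2" "L2_norm W \<le> L2_norm U" "strict_mono r"
    "AE x in lborel. (\<lambda>n. fourier (gaussian_cutoff U (r n)) x) \<longlonglongrightarrow> W x"
    "\<And>\<phi>. integrable lborel \<phi> \<Longrightarrow> \<phi> \<in> L2 \<Longrightarrow> (LINT x|lborel. U x * fourier \<phi> x) = (LINT x|lborel. W x * \<phi> x)"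
proof -
  note [measurable] = L2_D(1)[OF U]
  define F where "F n = fourier (gaussian_cutoff U n)" for n
  define \<rho> where "\<rho> n = (L2_norm (\<lambda>x. gaussian_cutoff U n x - U x))\<^sup>2" for n
  have \<rho>: "\<rho> \<longlonglongrightarrow> 0" unfolding \<rho>_def by (rule gaussian_cutoff_L2_tendsto[OF U])
  have \<rho>0: "\<rho> n \<ge> 0" for n by (simp add: \<rho>_def)
  have FL: "F n \<in> L2" "L2_norm (F n) \<le> L2_norm U" for n
    using fourier_L2[OF gaussian_cutoff_integrable[OF U, of n] gaussian_cutoff_L2(1)[OF U, of n]] gaussian_cutoff_L2(2)[OF U, of n]
    by (auto simp: F_def)
  have [measurable]: "F n \<in> borel_measurable borel" for n by (rule L2_D(1)[OF FL(1)])
  have Fd: "(L2_norm (\<lambda>x. F n x - F m x))\<^sup>2 \<le> 2 * \<rho> n + 2 * \<rho> m" for n m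
  proof -
    let ?d = "\<lambda>x. gaussian_cutoff U n x - gaussian_cutoff U m x"
    have "(\<lambda>x. F n x - F m x) = fourier ?d"
      unfolding F_def by (rule ext) (rule fourier_diff[symmetric]; rule gaussian_cutoff_integrable[OF U])
    moreover have "L2_norm (fourier ?d) \<le> L2_norm ?d"
      by (rule fourier_L2(2)) (intro Bochner_Integration.integrable_diff gaussian_cutoff_integrable[OF U] L2_diff gaussian_cutoff_L2[OF U])+
    ultimately have "(L2_norm (\<lambda>x. F n x - F m x))\<^sup>2 \<le> (L2_norm ?d)\<^sup>2"
      by (simp add: power_mono L2_norm_nonneg)
    also have "?d = (\<lambda>x. (gaussian_cutoff U n x - U x) - (gaussian_cutoff U m x - U x))" by simp
    also have "(L2_norm \<dots>)\<^sup>2 \<le> 2 * \<rho> n + 2 * \<rho> m"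
      unfolding \<rho>_def by (intro L2_diff gaussian_cutoff_L2[OF U] U)
    finally show ?thesis .
  qed
  \<comment> \<open>A positive square integrable factor turns the Cauchy property in the mean square into one in the mean.\<close>
  define G where "G x = complex_of_real (exp (- (1 * (norm x)\<^sup>2)))" for x :: "real^'d"
  have GL: "G \<in> L2" unfolding G_def by (rule gaussian_L2) simp
  have G0: "G x \<noteq> 0" for x by (simp add: G_def)
  obtain r where r: "strict_mono r" "AE x in lborel. Cauchy (\<lambda>i. F (r i) x * G x)"
  proof (rule cauchy_L1_AE_cauchy_subseq[of lborel "\<lambda>n x. F n x * G x"])
    show "integrable lborel (\<lambda>x. F n x * G x)" for n by (rule L2_mult(1)[OF FL(1) GL])
    fix e :: real assume e: "e > 0"
    define c where "c = L2_norm G + 1"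
    have c: "c > 0" "L2_norm G \<le> c" using L2_norm_nonneg[of G] by (auto simp: c_def)
    have "\<forall>\<^sub>F n in sequentially. \<rho> n < (e / c)\<^sup>2 / 8"
      by (rule order_tendstoD(2)[OF \<rho>]) (use e c in simp)
    then obtain N where N: "\<And>n. n \<ge> N \<Longrightarrow> \<rho> n < (e / c)\<^sup>2 / 8" by (auto simp: eventually_sequentially)
    show "\<exists>N. \<forall>i\<ge>N. \<forall>j\<ge>N. (LINT x|lborel. norm (F i x * G x - F j x * G x)) < e"
    proof (intro exI[of _ N] allI impI)
      fix i j assume ij: "i \<ge> N" "j \<ge> N"
      let ?n = "L2_norm (\<lambda>x. F i x - F j x)"
      have "?n\<^sup>2 < (e / c)\<^sup>2"
      proof -
        have "(e / c)\<^sup>2 > 0" using e c by simp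
        then show ?thesis using Fd[of i j] N[OF ij(1)] N[OF ij(2)] by linarith
      qed
      then have n: "?n < e / c" by (rule power2_less_imp_less) (use e c in simp)
      have "(LINT x|lborel. norm (F i x * G x - F j x * G x)) = (LINT x|lborel. norm ((F i x - F j x) * G x))"
        by (simp add: left_diff_distrib)
      also have "\<dots> \<le> ?n * L2_norm G" by (rule L2_mult(2)[OF L2_diff(1)[OF FL(1) FL(1)] GL])
      also have "\<dots> \<le> ?n * c" by (intro mult_left_mono c L2_norm_nonneg)
      also have "\<dots> < e" using n c by (simp add: pos_less_divide_eq)
      finally show "(LINT x|lborel. norm (F i x * G x - F j x * G x)) < e" .
    qed
  qed blast
  define W where "W x = lim (\<lambda>i. F (r i) x)" for x
  have [measurable]: "W \<in> borel_measurable borel" unfolding W_def by measurable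
  have W: "AE x in lborel. (\<lambda>i. F (r i) x) \<longlonglongrightarrow> W x"
    using r(2)
  proof eventually_elim
    case (elim x)
    then obtain L where "(\<lambda>i. F (r i) x * G x) \<longlonglongrightarrow> L" using Cauchy_convergent_iff convergent_def by blast
    then have "(\<lambda>i. F (r i) x * G x / G x) \<longlonglongrightarrow> L / G x" using G0 by (intro tendsto_divide tendsto_const) auto
    then have "convergent (\<lambda>i. F (r i) x)" using G0 by (auto simp: convergent_def)
    then show ?case by (simp add: W_def convergent_LIMSEQ_iff)
  qed
  have fatou: "(\<integral>\<^sup>+x. ennreal ((norm (W x - V x))\<^sup>2) \<partial>lborel) \<le> ennreal b"
    if [measurable]: "V \<in> borel_measurable borel" and VL: "\<And>n. (\<lambda>x. F n x - V x) \<in> L2"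
      and bn: "\<And>n. (L2_norm (\<lambda>x. F (r n) x - V x))\<^sup>2 \<le> bb n" and lim: "bb \<longlonglongrightarrow> b" for V bb b
  proof -
    have "(\<integral>\<^sup>+x. ennreal ((norm (W x - V x))\<^sup>2) \<partial>lborel) = (\<integral>\<^sup>+x. liminf (\<lambda>n. ennreal ((norm (F (r n) x - V x))\<^sup>2)) \<partial>lborel)"
    proof (rule nn_integral_cong_AE, use W in eventually_elim)
      case (elim x)
      have "(\<lambda>n. (norm (F (r n) x - V x))\<^sup>2) \<longlonglongrightarrow> (norm (W x - V x))\<^sup>2"
        by (intro tendsto_power tendsto_norm tendsto_diff tendsto_const elim)
      from lim_imp_Liminf[OF trivial_limit_sequentially tendsto_ennrealI[OF this]] show ?case by (rule sym)
    qed
    also have "\<dots> \<le> liminf (\<lambda>n. \<integral>\<^sup>+x. ennreal ((norm (F (r n) x - V x))\<^sup>2) \<partial>lborel)"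
      by (rule nn_integral_liminf) measurable
    also have "\<dots> \<le> liminf (\<lambda>n. ennreal (bb n))"
      unfolding nn_integral_L2[OF VL] by (intro Liminf_mono always_eventually allI ennreal_leI bn)
    also have "\<dots> = ennreal b" by (rule lim_imp_Liminf[OF trivial_limit_sequentially tendsto_ennrealI[OF lim]])
    finally show ?thesis .
  qed
  have Wm: "W \<in> borel_measurable borel" by measurable
  have b0: "(\<integral>\<^sup>+x. ennreal ((norm (W x))\<^sup>2) \<partial>lborel) \<le> ennreal ((L2_norm U)\<^sup>2)"
    using fatou[of "\<lambda>_. 0" "\<lambda>_. (L2_norm U)\<^sup>2" "(L2_norm U)\<^sup>2"] FL by (simp add: power_mono L2_norm_nonneg)
  have WL: "W \<in> L2" "L2_norm W \<le> L2_norm U"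
    using L2_I_bound[OF Wm b0 L2_norm_nonneg] by auto
  have Wd: "(L2_norm (\<lambda>x. W x - F (r n) x))\<^sup>2 \<le> 2 * \<rho> (r n)" for n
  proof -
    have "(\<integral>\<^sup>+x. ennreal ((norm (W x - F (r n) x))\<^sup>2) \<partial>lborel) \<le> ennreal (2 * 0 + 2 * \<rho> (r n))"
    proof (rule fatou)
      show "(\<lambda>m. 2 * \<rho> (r m) + 2 * \<rho> (r n)) \<longlonglongrightarrow> 2 * 0 + 2 * \<rho> (r n)"
        by (intro tendsto_add tendsto_mult tendsto_const LIMSEQ_subseq_LIMSEQ[OF \<rho> r(1), unfolded comp_def])
    qed (auto intro: L2_diff FL Fd)
    then show ?thesis
      unfolding nn_integral_L2[OF L2_diff(1)[OF WL(1) FL(1)]] using \<rho>0 by (simp add: ennreal_le_iff)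
  qed
  have parseval: "(LINT x|lborel. U x * fourier \<phi> x) = (LINT x|lborel. W x * \<phi> x)"
    if \<phi>: "integrable lborel \<phi>" "\<phi> \<in> L2" for \<phi>
  proof -
    note [measurable] = L2_D(1)[OF \<phi>(2)]
    have \<phi>h: "fourier \<phi> \<in> L2" by (rule fourier_L2(1)[OF \<phi>])
    have eq: "(LINT x|lborel. F (r n) x * \<phi> x) = (LINT x|lborel. gaussian_cutoff U (r n) x * fourier \<phi> x)" for n
      unfolding F_def by (rule fourier_multiplication_formula(2)[OF gaussian_cutoff_integrable[OF U] \<phi>(1)])
    have l1: "(\<lambda>n. LINT x|lborel. gaussian_cutoff U (r n) x * fourier \<phi> x) \<longlonglongrightarrow> (LINT x|lborel. U x * fourier \<phi> x)"
    proof (rule integral_dominated_convergence)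
      show "integrable lborel (\<lambda>x. norm (U x * fourier \<phi> x))" by (intro integrable_norm L2_mult(1)[OF U \<phi>h])
      show "AE x in lborel. (\<lambda>n. gaussian_cutoff U (r n) x * fourier \<phi> x) \<longlonglongrightarrow> U x * fourier \<phi> x"
        by (intro AE_I2 tendsto_mult tendsto_const LIMSEQ_subseq_LIMSEQ[OF gaussian_cutoff_tendsto r(1), unfolded comp_def])
      show "AE x in lborel. norm (gaussian_cutoff U (r n) x * fourier \<phi> x) \<le> norm (U x * fourier \<phi> x)" for n
        unfolding norm_mult by (intro AE_I2 mult_right_mono norm_gaussian_cutoff_le) simp
    qed measurable
    have l2: "(\<lambda>n. (LINT x|lborel. W x * \<phi> x) - (LINT x|lborel. F (r n) x * \<phi> x)) \<longlonglongrightarrow> 0"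
    proof (rule Lim_null_comparison)
      have "norm ((LINT x|lborel. W x * \<phi> x) - (LINT x|lborel. F (r n) x * \<phi> x)) \<le> sqrt (2 * \<rho> (r n)) * L2_norm \<phi>" for n
      proof -
        have "(LINT x|lborel. W x * \<phi> x) - (LINT x|lborel. F (r n) x * \<phi> x) = (LINT x|lborel. (W x - F (r n) x) * \<phi> x)"
          using L2_mult(1)[OF WL(1) \<phi>(2)] L2_mult(1)[OF FL(1) \<phi>(2), of "r n"] by (simp add: left_diff_distrib)
        also have "norm \<dots> \<le> L2_norm (\<lambda>x. W x - F (r n) x) * L2_norm \<phi>"
          by (rule L2_mult(3)[OF L2_diff(1)[OF WL(1) FL(1)] \<phi>(2)])
        also have "\<dots> \<le> sqrt (2 * \<rho> (r n)) * L2_norm \<phi>"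
          by (intro mult_right_mono L2_norm_nonneg real_le_rsqrt Wd)
        finally show ?thesis .
      qed
      then show "\<forall>\<^sub>F n in sequentially. norm ((LINT x|lborel. W x * \<phi> x) - (LINT x|lborel. F (r n) x * \<phi> x)) \<le> sqrt (2 * \<rho> (r n)) * L2_norm \<phi>"
        by simp
      have "(\<lambda>n. sqrt (2 * \<rho> (r n)) * L2_norm \<phi>) \<longlonglongrightarrow> sqrt (2 * 0) * L2_norm \<phi>"
        by (intro tendsto_mult tendsto_const tendsto_real_sqrt LIMSEQ_subseq_LIMSEQ[OF \<rho> r(1), unfolded comp_def])
      then show "(\<lambda>n. sqrt (2 * \<rho> (r n)) * L2_norm \<phi>) \<longlonglongrightarrow> 0" by simp
    qed
    have "(\<lambda>n. (LINT x|lborel. W x * \<phi> x) - ((LINT x|lborel. W x * \<phi> x) - (LINT x|lborel. F (r n) x * \<phi> x))) \<longlonglongrightarrow> (LINT x|lborel. W x * \<phi> x) - 0"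
      by (intro tendsto_diff tendsto_const l2)
    then have "(\<lambda>n. LINT x|lborel. F (r n) x * \<phi> x) \<longlonglongrightarrow> (LINT x|lborel. W x * \<phi> x)" by simp
    then show ?thesis using l1 unfolding eq by (rule LIMSEQ_unique[rotated])
  qed
  show ?thesis
    by (rule that[OF WL r(1)]) (use W parseval in \<open>auto simp: F_def\<close>)
qed

section \<open>Schwartz functions and Gaussians\<close>

text \<open>
  The supremum in \<open>schwartz_seminorm\<close> is over a set that is bounded above, because there are
  finitely many lists of bounded length.
\<close>

lemma schwartz_seminorm_bound:
  fixes \<phi> :: "real^'d::finite \<Rightarrow> complex"
  assumes "\<phi> \<in> schwartz"
  shows "(1 + norm x) ^ N * norm (\<phi> x) \<le> schwartz_seminorm N \<phi>"
proof -
  define A where "A = {is :: 'd list. length is \<le> N}"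
  have fin: "finite A" using finite_lists_length_le[of "UNIV :: 'd set" N] by (simp add: A_def)
  have "\<exists>B. \<forall>x. (1 + norm x) ^ N * norm (iter_partial is \<phi> x) \<le> B" for "is"
  proof -
    have "bounded (range (\<lambda>x. (1 + norm x) ^ N *\<^sub>R iter_partial is \<phi> x))"
      using assms by (auto simp: schwartz_def)
    then obtain B where "\<And>x. norm ((1 + norm x) ^ N *\<^sub>R iter_partial is \<phi> x) \<le> B"
      unfolding bounded_iff by auto
    moreover have "\<bar>1 + norm x\<bar> = 1 + norm x" for x :: "real^'d" by (rule abs_of_nonneg) simp
    ultimately show ?thesis by (auto simp: power_abs)
  qed
  then obtain B where B: "\<And>is x. (1 + norm x) ^ N * norm (iter_partial is \<phi> x) \<le> B is" by metis
  have B0: "B is \<ge> 0" for "is"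
    using B[of 0 "is"] by (rule order_trans[rotated]) simp
  have bdd: "bdd_above ((\<lambda>(is, x). (1 + norm x) ^ N * norm (iter_partial is \<phi> x)) ` (A \<times> UNIV))"
  proof (rule bdd_aboveI2)
    fix p assume "p \<in> A \<times> (UNIV :: (real^'d) set)"
    then obtain "is" x where p: "p = (is, x)" "is \<in> A" by (cases p) auto
    have "(1 + norm x) ^ N * norm (iter_partial is \<phi> x) \<le> B is" by (rule B)
    also have "\<dots> \<le> sum B A" by (rule member_le_sum) (use p fin B0 in auto)
    finally show "(case p of (is, x) \<Rightarrow> (1 + norm x) ^ N * norm (iter_partial is \<phi> x)) \<le> sum B A" by (simp add: p)
  qed
  have "(case ([], x) of (is, x) \<Rightarrow> (1 + norm x) ^ N * norm (iter_partial is \<phi> x)) \<le> schwartz_seminorm N \<phi>"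
    unfolding schwartz_seminorm_def A_def[symmetric] by (rule cSUP_upper[OF _ bdd]) (simp add: A_def)
  then show ?thesis by simp
qed

lemma schwartz_measurable:
  assumes "\<phi> \<in> schwartz"
  shows "\<phi> \<in> borel_measurable borel"
proof -
  have "iter_partial [] \<phi> differentiable (at x)" for x using assms unfolding schwartz_def by blast
  then have "continuous_on UNIV \<phi>"
    by (auto intro!: continuous_at_imp_continuous_on differentiable_imp_continuous_within)
  then show ?thesis by (rule borel_measurable_continuous_onI)
qed

lemma schwartz_square_integrable:
  fixes \<phi> :: "real^'d::finite \<Rightarrow> complex"
  assumes \<phi>: "\<phi> \<in> schwartz"
  shows "integrable lborel \<phi>" "\<phi> \<in> L2"
    "L2_norm \<phi> \<le> sqrt (LINT k|(lborel :: (real^'d) measure). (1 + (norm k)\<^sup>2) powr (- real (Suc CARD('d)))) * schwartz_seminorm (Suc CARD('d)) \<phi>"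
proof -
  let ?N = "Suc CARD('d)"
  define S where "S = schwartz_seminorm ?N \<phi>"
  note [measurable] = schwartz_measurable[OF \<phi>]
  have b: "norm (\<phi> x) \<le> S * (1 + (norm x)\<^sup>2) powr (- (real ?N / 2))" for x
  proof -
    have "1 + (norm x)\<^sup>2 \<le> (1 + norm x)\<^sup>2" by (simp add: power2_sum)
    then have "(1 + (norm x)\<^sup>2) powr (real ?N / 2) \<le> ((1 + norm x)\<^sup>2) powr (real ?N / 2)" by (intro powr_mono2) auto
    also have "((1 + norm x)\<^sup>2) powr (real ?N / 2) = (1 + norm x) ^ ?N"
    proof -
      have p: "1 + norm x > 0" by (simp add: add_pos_nonneg)
      have "((1 + norm x)\<^sup>2) powr (real ?N / 2) = ((1 + norm x) powr 2) powr (real ?N / 2)" using p by simp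
      also have "\<dots> = (1 + norm x) powr real ?N"
      proof -
        have "2 * (real ?N / 2) = real ?N" by (simp add: add_divide_distrib)
        then show ?thesis by (simp only: powr_powr)
      qed
      finally show ?thesis using p by (simp only: powr_realpow)
    qed
    finally have "(1 + (norm x)\<^sup>2) powr (real ?N / 2) * norm (\<phi> x) \<le> (1 + norm x) ^ ?N * norm (\<phi> x)"
      by (rule mult_right_mono) simp
    also have "\<dots> \<le> S" unfolding S_def by (rule schwartz_seminorm_bound[OF \<phi>])
    finally have "(1 + (norm x)\<^sup>2) powr (real ?N / 2) * norm (\<phi> x) \<le> S" .
    moreover have "(1 + (norm x)\<^sup>2) powr (real ?N / 2) > 0"
      using add_pos_nonneg[of 1 "(norm x)\<^sup>2"] by simp
    ultimately show ?thesis
      unfolding powr_minus_divide times_divide_eq_right mult_1_right by (subst pos_le_divide_eq) (simp_all only: mult.commute)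
  qed
  have S0: "S \<ge> 0"
    unfolding S_def by (rule order_trans[OF _ schwartz_seminorm_bound[OF \<phi>, of 0]]) simp
  show "integrable lborel \<phi>"
  proof (rule Bochner_Integration.integrable_bound)
    show "integrable lborel (\<lambda>x::real^'d. S * (1 + (norm x)\<^sup>2) powr (- (real ?N / 2)))"
      by (intro integrable_mult_right integrable_bessel_weight(1)) simp
    show "AE x in lborel. norm (\<phi> x) \<le> norm (S * (1 + (norm x)\<^sup>2) powr (- (real ?N / 2)))"
      unfolding real_norm_def by (intro AE_I2 order_trans[OF b abs_ge_self])
  qed measurable
  define I where "I = (LINT k|(lborel :: (real^'d) measure). (1 + (norm k)\<^sup>2) powr (- real ?N))"
  have ii: "integrable lborel (\<lambda>k::real^'d. (1 + (norm k)\<^sup>2) powr (- real ?N))"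
    by (rule integrable_bessel_weight(1)) simp
  have I0: "I \<ge> 0" unfolding I_def by simp
  have "(\<integral>\<^sup>+x. ennreal ((norm (\<phi> x))\<^sup>2) \<partial>lborel) \<le> (\<integral>\<^sup>+x. ennreal (S\<^sup>2 * (1 + (norm x)\<^sup>2) powr (- real ?N)) \<partial>(lborel :: (real^'d) measure))"
  proof (intro nn_integral_mono ennreal_leI)
    fix x
    have "(norm (\<phi> x))\<^sup>2 \<le> (S * (1 + (norm x)\<^sup>2) powr (- (real ?N / 2)))\<^sup>2" by (intro power_mono b) simp
    also have "\<dots> = S\<^sup>2 * (1 + (norm x)\<^sup>2) powr (- real ?N)"
      unfolding power_mult_distrib by (simp add: power2_eq_square powr_add[symmetric])
    finally show "(norm (\<phi> x))\<^sup>2 \<le> S\<^sup>2 * (1 + (norm x)\<^sup>2) powr (- real ?N)" .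
  qed
  also have "\<dots> = ennreal (S\<^sup>2 * I)"
    unfolding I_def by (subst nn_integral_eq_integral) (use ii in auto)
  also have "S\<^sup>2 * I = (sqrt I * S)\<^sup>2" using I0 by (simp add: power_mult_distrib)
  finally have n: "(\<integral>\<^sup>+x. ennreal ((norm (\<phi> x))\<^sup>2) \<partial>lborel) \<le> ennreal ((sqrt I * S)\<^sup>2)" .
  have "\<phi> \<in> borel_measurable borel" by measurable
  from L2_I_bound[OF this n] I0 S0
  show "\<phi> \<in> L2" "L2_norm \<phi> \<le> sqrt (LINT k|(lborel :: (real^'d) measure). (1 + (norm k)\<^sup>2) powr (- real ?N)) * schwartz_seminorm ?N \<phi>"
    by (auto simp: I_def S_def)
qed

definition gauss_exp :: "real \<Rightarrow> real^'d::finite \<Rightarrow> real^'d \<Rightarrow> real^'d \<Rightarrow> complex" where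
  "gauss_exp a p q x = exp (complex_of_real (- (a / 2) * (x \<bullet> x) + p \<bullet> x) + \<i> * complex_of_real (q \<bullet> x))"

text \<open>
  Closed under partial derivatives by construction, so membership alone shows that all iterated
  partial derivatives exist and decay. The powers of \<open>1 + |x|\<^sup>2\<close> are needed because the test functions
  have to absorb the Sobolev weight.
\<close>

inductive_set gauss_class :: "real \<Rightarrow> real^'d::finite \<Rightarrow> real^'d \<Rightarrow> (real^'d \<Rightarrow> complex) set" for a p q where
  base: "(\<lambda>x. complex_of_real ((1 + x \<bullet> x) powr s) * gauss_exp a p q x) \<in> gauss_class a p q"
| add: "f \<in> gauss_class a p q \<Longrightarrow> g \<in> gauss_class a p q \<Longrightarrow> (\<lambda>x. f x + g x) \<in> gauss_class a p q"
| scale: "f \<in> gauss_class a p q \<Longrightarrow> (\<lambda>x. c * f x) \<in> gauss_class a p q"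
| coord: "f \<in> gauss_class a p q \<Longrightarrow> (\<lambda>x. complex_of_real (x $ i) * f x) \<in> gauss_class a p q"

lemma gauss_exp_eq: "gauss_exp a p q x = complex_of_real (exp (- (a / 2) * (x \<bullet> x) + p \<bullet> x)) * exp (\<i> * complex_of_real (q \<bullet> x))"
  by (simp only: gauss_exp_def exp_add exp_of_real)

lemma gauss_class_derivative:
  fixes f :: "real^'d::finite \<Rightarrow> complex"
  assumes "f \<in> gauss_class a p q"
  shows "\<exists>D. (\<forall>x. (f has_derivative D x) (at x)) \<and> (\<forall>i. (\<lambda>x. D x (axis i 1)) \<in> gauss_class a p q)"
  using assms
proof (induction rule: gauss_class.induct)
  case (base s)
  define D where "D x h = complex_of_real (s * (1 + x \<bullet> x) powr (s - 1) * (2 * (x \<bullet> h))) * gauss_exp a p q x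
      + complex_of_real ((1 + x \<bullet> x) powr s) * (gauss_exp a p q x * (complex_of_real (- a * (x \<bullet> h) + p \<bullet> h) + \<i> * complex_of_real (q \<bullet> h)))" for x h
  have dp: "((\<lambda>x. (1 + x \<bullet> x) powr s) has_derivative (\<lambda>h. s * (1 + x \<bullet> x) powr (s - 1) * (2 * (x \<bullet> h)))) (at x)" for x :: "real^'d"
  proof -
    have "1 + x \<bullet> x > 0" by (simp add: add_pos_nonneg)
    then have "((\<lambda>z. z powr s) has_real_derivative s * (1 + x \<bullet> x) powr (s - 1)) (at (1 + x \<bullet> x))"
      by (rule has_real_derivative_powr)
    moreover have "((\<lambda>x. 1 + x \<bullet> x) has_derivative (\<lambda>h. 2 * (x \<bullet> h))) (at x)"
      by (auto intro!: derivative_eq_intros simp: inner_commute)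
    ultimately show ?thesis
      using DERIV_compose_FDERIV[of "\<lambda>z. z powr s" "s * (1 + x \<bullet> x) powr (s - 1)" "\<lambda>x. 1 + x \<bullet> x"] by (simp add: mult.commute)
  qed
  have de: "(gauss_exp a p q has_derivative (\<lambda>h. gauss_exp a p q x * (complex_of_real (- a * (x \<bullet> h) + p \<bullet> h) + \<i> * complex_of_real (q \<bullet> h)))) (at x)" for x
  proof -
    have arg: "((\<lambda>x. complex_of_real (- (a / 2) * (x \<bullet> x) + p \<bullet> x) + \<i> * complex_of_real (q \<bullet> x)) has_derivative
        (\<lambda>h. complex_of_real (- a * (x \<bullet> h) + p \<bullet> h) + \<i> * complex_of_real (q \<bullet> h))) (at x)"
      by (auto intro!: derivative_eq_intros simp: inner_commute algebra_simps)
    have "(exp has_derivative (*) (gauss_exp a p q x)) (at (complex_of_real (- (a / 2) * (x \<bullet> x) + p \<bullet> x) + \<i> * complex_of_real (q \<bullet> x)))"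
      using DERIV_exp unfolding has_field_derivative_def gauss_exp_def by blast
    from has_derivative_compose[OF arg this] show ?thesis
      unfolding gauss_exp_def[abs_def] by simp
  qed
  have "((\<lambda>x. complex_of_real ((1 + x \<bullet> x) powr s) * gauss_exp a p q x) has_derivative D x) (at x)" for x
    unfolding D_def by (rule has_derivative_eq_rhs[OF has_derivative_mult[OF has_derivative_of_real[OF dp] de]]) (auto simp: add.commute)
  moreover have "(\<lambda>x. D x (axis i 1)) \<in> gauss_class a p q" for i
  proof -
    let ?B = "\<lambda>s x. complex_of_real ((1 + x \<bullet> x) powr s) * gauss_exp a p q x"
    have "(\<lambda>x. complex_of_real (2 * s) * (complex_of_real (x $ i) * ?B (s - 1) x) + (complex_of_real (- a) * (complex_of_real (x $ i) * ?B s x) + (complex_of_real (p $ i) + \<i> * complex_of_real (q $ i)) * ?B s x)) \<in> gauss_class a p q"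
      by (intro gauss_class.intros)
    also have "(\<lambda>x. complex_of_real (2 * s) * (complex_of_real (x $ i) * ?B (s - 1) x) + (complex_of_real (- a) * (complex_of_real (x $ i) * ?B s x) + (complex_of_real (p $ i) + \<i> * complex_of_real (q $ i)) * ?B s x)) = (\<lambda>x. D x (axis i 1))"
      by (rule ext) (simp add: D_def inner_axis algebra_simps)
    finally show ?thesis .
  qed
  ultimately show ?case by blast
next
  case (add f g)
  then obtain D E where "\<forall>x. (f has_derivative D x) (at x)" "\<forall>i. (\<lambda>x. D x (axis i 1)) \<in> gauss_class a p q"
    "\<forall>x. (g has_derivative E x) (at x)" "\<forall>i. (\<lambda>x. E x (axis i 1)) \<in> gauss_class a p q" by blast
  then show ?case
    by (intro exI[of _ "\<lambda>x h. D x h + E x h"]) (auto intro!: has_derivative_add gauss_class.intros)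
next
  case (scale f c)
  then obtain D where "\<forall>x. (f has_derivative D x) (at x)" "\<forall>i. (\<lambda>x. D x (axis i 1)) \<in> gauss_class a p q" by blast
  then show ?case
    by (intro exI[of _ "\<lambda>x h. c * D x h"]) (auto intro!: has_derivative_mult_right gauss_class.intros)
next
  case (coord f i)
  then obtain D where D: "\<And>x. (f has_derivative D x) (at x)" "\<And>i. (\<lambda>x. D x (axis i 1)) \<in> gauss_class a p q" by blast
  have dx: "((\<lambda>x::real^'d. complex_of_real (x $ i)) has_derivative (\<lambda>h. complex_of_real (h $ i))) (at x)" for x
    by (intro has_derivative_of_real bounded_linear_imp_has_derivative bounded_linear_vec_nth)
  show ?case
  proof (intro exI[of _ "\<lambda>x h. complex_of_real (x $ i) * D x h + complex_of_real (h $ i) * f x"] conjI allI)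
    show "((\<lambda>x. complex_of_real (x $ i) * f x) has_derivative (\<lambda>h. complex_of_real (x $ i) * D x h + complex_of_real (h $ i) * f x)) (at x)" for x
      by (rule has_derivative_mult[OF dx D(1)])
    show "(\<lambda>x. complex_of_real (x $ i) * D x (axis j 1) + complex_of_real (axis j 1 $ i) * f x) \<in> gauss_class a p q" for j
      by (intro gauss_class.add gauss_class.coord gauss_class.scale D coord.hyps)
  qed
qed

text \<open>
  For the generators, \<open>1 + r \<le> exp r\<close> bounds all polynomial factors by \<open>exp (K r)\<close>, and
  \<open>K r - (a/2) r\<^sup>2\<close> is at most \<open>K\<^sup>2 / (2 a)\<close>.
\<close>

lemma gauss_class_decay:
  fixes f :: "real^'d::finite \<Rightarrow> complex"
  assumes "a > 0" "f \<in> gauss_class a p q"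
  shows "\<exists>B. \<forall>x. (1 + norm x) ^ N * norm (f x) \<le> B"
  using assms(2)
proof (induction arbitrary: N rule: gauss_class.induct)
  case (base s)
  define K where "K = real N + 2 * \<bar>s\<bar> + norm p"
  show ?case
  proof (intro exI allI)
    fix x :: "real^'d"
    define r where "r = norm x"
    have r: "r \<ge> 0" by (simp add: r_def)
    have e: "1 + r \<le> exp r" by simp
    have xx: "x \<bullet> x = r\<^sup>2" by (simp add: r_def power2_norm_eq_inner)
    have n: "norm (gauss_exp a p q x) = exp (- (a / 2) * r\<^sup>2 + p \<bullet> x)"
      by (simp add: gauss_exp_def norm_exp_eq_Re xx)
    have i1: "(1 + r) ^ N \<le> exp (real N * r)"
      unfolding exp_of_nat_mult using r by (intro power_mono e) simp
    have i2: "(1 + x \<bullet> x) powr s \<le> exp (2 * \<bar>s\<bar> * r)"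
    proof -
      have "1 + x \<bullet> x \<ge> 1" by simp
      then have "(1 + x \<bullet> x) powr s \<le> (1 + x \<bullet> x) powr \<bar>s\<bar>" by (intro powr_mono) auto
      also have "\<dots> \<le> ((1 + r)\<^sup>2) powr \<bar>s\<bar>" using r by (intro powr_mono2) (auto simp: xx power2_sum)
      also have "\<dots> \<le> ((exp r)\<^sup>2) powr \<bar>s\<bar>" using r by (intro powr_mono2 power_mono e) auto
      also have "\<dots> = exp (2 * \<bar>s\<bar> * r)" by (simp add: powr_def ln_realpow mult_ac)
      finally show ?thesis .
    qed
    have i3: "exp (- (a / 2) * r\<^sup>2 + p \<bullet> x) \<le> exp (- (a / 2) * r\<^sup>2 + norm p * r)"
      using norm_cauchy_schwarz[of p x] by (simp add: r_def)
    have "(1 + norm x) ^ N * norm (complex_of_real ((1 + x \<bullet> x) powr s) * gauss_exp a p q x)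
       = (1 + r) ^ N * ((1 + x \<bullet> x) powr s * exp (- (a / 2) * r\<^sup>2 + p \<bullet> x))"
      by (simp add: norm_mult n r_def[symmetric])
    also have "\<dots> \<le> exp (real N * r) * (exp (2 * \<bar>s\<bar> * r) * exp (- (a / 2) * r\<^sup>2 + norm p * r))"
      by (intro mult_mono i1 i2 i3) (use r in auto)
    also have "\<dots> = exp (K * r - (a / 2) * r\<^sup>2)"
      unfolding exp_add[symmetric] K_def by (simp add: algebra_simps)
    also have "\<dots> \<le> exp (K\<^sup>2 / (2 * a))"
    proof -
      have "0 \<le> (K - a * r)\<^sup>2" by simp
      then have "2 * a * (K * r - (a / 2) * r\<^sup>2) \<le> K\<^sup>2"
        by (simp add: power2_eq_square algebra_simps)
      then have "K * r - (a / 2) * r\<^sup>2 \<le> K\<^sup>2 / (2 * a)"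
        using assms(1) by (simp add: pos_le_divide_eq mult.commute)
      then show ?thesis by simp
    qed
    finally show "(1 + norm x) ^ N * norm (complex_of_real ((1 + x \<bullet> x) powr s) * gauss_exp a p q x) \<le> exp (K\<^sup>2 / (2 * a))" .
  qed
next
  case (add f g)
  from add.IH(1)[of N] add.IH(2)[of N] obtain B C where
    B: "\<And>x. (1 + norm x) ^ N * norm (f x) \<le> B" and C: "\<And>x. (1 + norm x) ^ N * norm (g x) \<le> C" by blast
  show ?case
  proof (intro exI allI)
    fix x
    have "(1 + norm x) ^ N * norm (f x + g x) \<le> (1 + norm x) ^ N * (norm (f x) + norm (g x))"
      by (intro mult_left_mono norm_triangle_ineq) simp
    then show "(1 + norm x) ^ N * norm (f x + g x) \<le> B + C"
      using B[of x] C[of x] by (simp add: distrib_left)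
  qed
next
  case (scale f c)
  from scale.IH[of N] obtain B where B: "\<And>x. (1 + norm x) ^ N * norm (f x) \<le> B" by blast
  show ?case
  proof (intro exI allI)
    fix x
    show "(1 + norm x) ^ N * norm (c * f x) \<le> norm c * B"
      using mult_left_mono[OF B[of x], of "norm c"] by (simp add: norm_mult mult_ac)
  qed
next
  case (coord f i)
  from coord.IH[of "Suc N"] obtain B where B: "\<And>x. (1 + norm x) ^ Suc N * norm (f x) \<le> B" by blast
  show ?case
  proof (intro exI allI)
    fix x
    have "\<bar>x $ i\<bar> \<le> 1 + norm x" using component_le_norm_cart[of x i] by simp
    then have "(1 + norm x) ^ N * (\<bar>x $ i\<bar> * norm (f x)) \<le> (1 + norm x) ^ N * ((1 + norm x) * norm (f x))"
      by (intro mult_left_mono mult_right_mono) auto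
    also have "\<dots> \<le> B" using B[of x] by (simp add: mult_ac)
    finally show "(1 + norm x) ^ N * norm (complex_of_real (x $ i) * f x) \<le> B" by (simp add: norm_mult)
  qed
qed

lemma gauss_class_iter_partial:
  assumes "f \<in> gauss_class a p q"
  shows "iter_partial is f \<in> gauss_class a p q"
proof (induction "is")
  case Nil
  then show ?case using assms by simp
next
  case (Cons i "is")
  obtain D where D: "\<And>x. (iter_partial is f has_derivative D x) (at x)" "\<And>i. (\<lambda>x. D x (axis i 1)) \<in> gauss_class a p q"
    using gauss_class_derivative[OF Cons] by blast
  have "frechet_derivative (iter_partial is f) (at x) = D x" for x
    using frechet_derivative_at[OF D(1)] by simp
  then show ?case using D(2) by simp
qed

lemma gauss_class_schwartz:
  fixes f :: "real^'d::finite \<Rightarrow> complex"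
  assumes a: "a > 0" and f: "f \<in> gauss_class a p q"
  shows "f \<in> schwartz"
  unfolding schwartz_def
proof (intro CollectI conjI allI)
  fix "is" x
  show "iter_partial is f differentiable (at x)"
    using gauss_class_derivative[OF gauss_class_iter_partial[OF f]] unfolding differentiable_def by blast
next
  fix "is" N
  obtain B where "\<And>x. (1 + norm x) ^ N * norm (iter_partial is f x) \<le> B"
    using gauss_class_decay[OF a gauss_class_iter_partial[OF f]] by blast
  moreover have "\<bar>1 + norm x\<bar> = 1 + norm x" for x :: "real^'d" by (rule abs_of_nonneg) simp
  ultimately show "bounded (range (\<lambda>x. (1 + norm x) ^ N *\<^sub>R iter_partial is f x))"
    by (intro boundedI[of _ B]) (auto simp: power_abs)
qed

lemma weighted_gaussian_wave_schwartz:
  assumes "a > 0"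
  shows "(\<lambda>x. complex_of_real ((1 + (norm x)\<^sup>2) powr s) * gaussian_wave a y x) \<in> schwartz"
proof -
  have "gaussian_wave a y x = gauss_exp a 0 y x" for x
    by (simp add: gaussian_wave_def gauss_exp_eq power2_norm_eq_inner mult.commute)
  then have "(\<lambda>x. complex_of_real ((1 + (norm x)\<^sup>2) powr s) * gaussian_wave a y x) = (\<lambda>x. complex_of_real ((1 + x \<bullet> x) powr s) * gauss_exp a 0 y x)"
    by (simp only: power2_norm_eq_inner)
  then show ?thesis
    by (simp only: gauss_class_schwartz[OF assms gauss_class.base])
qed

lemma heat_kernel_schwartz:
  fixes y :: "real^'d::finite"
  assumes a: "a > 0"
  shows "(\<lambda>x. complex_of_real (heat_kernel a y x)) \<in> schwartz"
proof -
  define c where "c = a powr (- real CARD('d) / 2) * exp (- (norm y)\<^sup>2 / (2 * a))"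
  have "complex_of_real (heat_kernel a y x) = complex_of_real c * (complex_of_real ((1 + x \<bullet> x) powr 0) * gauss_exp (1 / a) ((1 / a) *\<^sub>R y) 0 x)" for x
  proof -
    have "- (norm (x - y))\<^sup>2 / (2 * a) = - (norm y)\<^sup>2 / (2 * a) + (- (1 / a / 2) * (x \<bullet> x) + ((1 / a) *\<^sub>R y) \<bullet> x)"
      using a by (simp add: power2_norm_eq_inner inner_diff_left inner_diff_right inner_commute field_simps)
    then have "heat_kernel a y x = c * exp (- (1 / a / 2) * (x \<bullet> x) + ((1 / a) *\<^sub>R y) \<bullet> x)"
      unfolding heat_kernel_def c_def mult.assoc exp_add[symmetric] by simp
    moreover have "1 + x \<bullet> x \<noteq> 0" using inner_ge_zero[of x] by linarith
    ultimately show ?thesis by (simp add: gauss_exp_eq)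
  qed
  then have eq: "(\<lambda>x. complex_of_real (heat_kernel a y x)) = (\<lambda>x. complex_of_real c * (complex_of_real ((1 + x \<bullet> x) powr 0) * gauss_exp (1 / a) ((1 / a) *\<^sub>R y) 0 x))"
    by (rule ext)
  have "(\<lambda>x. complex_of_real c * (complex_of_real ((1 + x \<bullet> x) powr 0) * gauss_exp (1 / a) ((1 / a) *\<^sub>R y) 0 x)) \<in> gauss_class (1 / a) ((1 / a) *\<^sub>R y) 0"
    by (intro gauss_class.intros)
  then show ?thesis unfolding eq by (rule gauss_class_schwartz[rotated]) (use a in simp)
qed

section \<open>Products of Fourier transforms\<close>

lemma convolution_integrable_and_fourier:
  fixes A B :: "real^'d::finite \<Rightarrow> complex"
  assumes A: "integrable lborel A" and B: "integrable lborel B"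
  shows "integrable lborel (\<lambda>z. LINT x|lborel. A x * B (z - x))"
    and "fourier (\<lambda>z. LINT x|lborel. A x * B (z - x)) k = complex_of_real ((2 * pi) powr (real CARD('d) / 2)) * (fourier A k * fourier B k)"
proof -
  have [measurable]: "A \<in> borel_measurable borel" "B \<in> borel_measurable borel" using A B by auto
  have shift: "integrable lborel (\<lambda>z. B (z - x))" "(LINT z|lborel. F (z - x)) = (LINT z|lborel. F z)" if "integrable lborel F" for x and F :: "real^'d \<Rightarrow> 'z::{banach, second_countable_topology}"
    using integral_lborel_translate[OF B, of "- x"] integral_lborel_translate[OF that, of "- x"] by auto
  define K where "K c x z = c z * (A x * B (z - x))" for c :: "real^'d \<Rightarrow> complex" and x z
  have Ki: "integrable (lborel \<Otimes>\<^sub>M lborel) (case_prod (K c))"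
    if [measurable]: "c \<in> borel_measurable borel" and c1: "\<And>z. norm (c z) = 1" for c
  proof (rule lborel_pair.Fubini_integrable)
    show "case_prod (K c) \<in> borel_measurable (lborel \<Otimes>\<^sub>M lborel)" unfolding K_def split_beta by measurable
    have "(LINT y|lborel. norm (case (x, y) of (x, y) \<Rightarrow> K c x y)) = norm (A x) * (LINT z|lborel. norm (B z))" for x
      by (simp add: K_def norm_mult c1 shift(2)[OF integrable_norm[OF B]])
    then show "integrable lborel (\<lambda>x. LINT y|lborel. norm (case (x, y) of (x, y) \<Rightarrow> K c x y))"
      using integrable_norm[OF A] by simp
    show "AE x in lborel. integrable lborel (\<lambda>y. case (x, y) of (x, y) \<Rightarrow> K c x y)"
    proof (rule AE_I2)
      fix x
      have i: "integrable lborel (\<lambda>y. A x * B (y - x))" using shift(1)[OF B, of x] by simp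
      have "K c x \<in> borel_measurable lborel" unfolding K_def by measurable
      then show "integrable lborel (\<lambda>y. case (x, y) of (x, y) \<Rightarrow> K c x y)"
        by (simp, intro Bochner_Integration.integrable_bound[OF i]) (auto simp: K_def norm_mult c1)
    qed
  qed
  have "integrable lborel (\<lambda>z. LINT x|lborel. K (\<lambda>_. 1) x z)"
    by (rule lborel_pair.integrable_snd[OF Ki]) auto
  then show "integrable lborel (\<lambda>z. LINT x|lborel. A x * B (z - x))" by (simp add: K_def)
  define e where "e z = exp (- \<i> * complex_of_real (k \<bullet> z))" for z
  have e1: "norm (e z) = 1" for z by (simp add: e_def)
  have [measurable]: "e \<in> borel_measurable borel" unfolding e_def by measurable
  have eadd: "e (x + y) = e x * e y" for x y
    unfolding e_def exp_add[symmetric] by (simp add: inner_add_right distrib_left)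
  have eB: "integrable lborel (\<lambda>y. e y * B y)" unfolding e_def by (rule integrable_fourier_kernel[OF B])
  have "(LINT z|lborel. e z * (LINT x|lborel. A x * B (z - x))) = (LINT z|lborel. LINT x|lborel. K e x z)"
    by (simp add: K_def)
  also have "\<dots> = (LINT x|lborel. LINT z|lborel. K e x z)"
    by (rule lborel_pair.Fubini_integral[OF Ki]) (auto simp: e1)
  also have "\<dots> = (LINT x|lborel. (e x * A x) * (LINT y|lborel. e y * B y))"
  proof (intro Bochner_Integration.integral_cong refl)
    fix x
    have "(LINT z|lborel. K e x z) = (LINT z|lborel. (e x * A x) * (e (z - x) * B (z - x)))"
    proof (intro Bochner_Integration.integral_cong refl)
      fix z
      have "e z = e x * e (z - x)" using eadd[of x "z - x"] by simp
      then show "K e x z = (e x * A x) * (e (z - x) * B (z - x))" by (simp add: K_def)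
    qed
    also have "\<dots> = (e x * A x) * (LINT z|lborel. e (z - x) * B (z - x))" by (rule integral_mult_right_zero)
    also have "(LINT z|lborel. e (z - x) * B (z - x)) = (LINT z|lborel. e z * B z)" by (rule shift(2)[OF eB])
    finally show "(LINT z|lborel. K e x z) = (e x * A x) * (LINT y|lborel. e y * B y)" .
  qed
  also have "\<dots> = (LINT x|lborel. e x * A x) * (LINT y|lborel. e y * B y)" by (rule integral_mult_left_zero)
  finally have main: "(LINT z|lborel. e z * (LINT x|lborel. A x * B (z - x))) = (LINT x|lborel. e x * A x) * (LINT y|lborel. e y * B y)" .
  have "complex_of_real ((2 * pi) powr (real CARD('d) / 2)) * complex_of_real ((2 * pi) powr (- real CARD('d) / 2)) = 1"
    by (simp add: powr_minus_divide flip: of_real_mult)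
  then show "fourier (\<lambda>z. LINT x|lborel. A x * B (z - x)) k = complex_of_real ((2 * pi) powr (real CARD('d) / 2)) * (fourier A k * fourier B k)"
    unfolding fourier_def e_def[symmetric] main by (simp add: mult.assoc[symmetric])
qed

text \<open>
  The dual bound is applied to truncations \<open>h\<close> of the convolution of the absolute values itself:
  it then reads \<open>s\<^sup>2 \<le> P s\<close> for the norm \<open>s\<close> of \<open>h\<close>, which is finite by truncation. Fatou's lemma
  removes the truncation.
\<close>

lemma convolution_L2_bound:
  fixes A B :: "real^'d::finite \<Rightarrow> complex"
  assumes A: "integrable lborel A" and B: "integrable lborel B" and P: "P \<ge> 0"
    and dual: "\<And>h. h \<in> borel_measurable borel \<Longrightarrow> (\<And>x. h x \<ge> 0) \<Longrightarrow> integrable lborel (\<lambda>x. (h x)\<^sup>2) \<Longrightarrow>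
      (\<integral>\<^sup>+x. \<integral>\<^sup>+y. ennreal (norm (A x) * norm (B y) * h (x + y)) \<partial>lborel \<partial>lborel) \<le> ennreal (P * sqrt (LINT x|lborel. (h x)\<^sup>2))"
  shows "(\<integral>\<^sup>+z. ennreal ((norm (LINT x|lborel. A x * B (z - x)))\<^sup>2) \<partial>lborel) \<le> ennreal (P\<^sup>2)"
proof -
  have [measurable]: "A \<in> borel_measurable borel" "B \<in> borel_measurable borel" using A B by auto
  define Z where "Z z = (\<integral>\<^sup>+x. ennreal (norm (A x) * norm (B (z - x))) \<partial>lborel)" for z
  have [measurable]: "Z \<in> borel_measurable borel" unfolding Z_def by measurable
  have subst: "(\<integral>\<^sup>+y. F y \<partial>lborel) = (\<integral>\<^sup>+z. F (z - x) \<partial>lborel)" if [measurable]: "F \<in> borel_measurable borel" for F :: "real^'d \<Rightarrow> ennreal" and x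
  proof -
    have "(\<integral>\<^sup>+y. F y \<partial>lborel) = (\<integral>\<^sup>+y. F y \<partial>distr lborel borel ((+) (- x)))" by (simp only: lborel_distr_plus)
    then show ?thesis by (simp add: nn_integral_distr)
  qed
  have Fub: "(\<integral>\<^sup>+z. Z z * ennreal (h z) \<partial>lborel) = (\<integral>\<^sup>+x. \<integral>\<^sup>+y. ennreal (norm (A x) * norm (B y) * h (x + y)) \<partial>lborel \<partial>lborel)"
    if [measurable]: "h \<in> borel_measurable borel" and h0: "\<And>x. h x \<ge> 0" for h
  proof -
    have "(\<integral>\<^sup>+x. \<integral>\<^sup>+y. ennreal (norm (A x) * norm (B y) * h (x + y)) \<partial>lborel \<partial>lborel)
        = (\<integral>\<^sup>+x. \<integral>\<^sup>+z. ennreal (norm (A x) * norm (B (z - x)) * h z) \<partial>lborel \<partial>lborel)"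
    proof (rule nn_integral_cong)
      fix x
      show "(\<integral>\<^sup>+y. ennreal (norm (A x) * norm (B y) * h (x + y)) \<partial>lborel) = (\<integral>\<^sup>+z. ennreal (norm (A x) * norm (B (z - x)) * h z) \<partial>lborel)"
        by (subst subst[of _ x]) simp_all
    qed
    also have "\<dots> = (\<integral>\<^sup>+z. \<integral>\<^sup>+x. ennreal (norm (A x) * norm (B (z - x)) * h z) \<partial>lborel \<partial>lborel)"
      by (rule lborel_pair.Fubini') measurable
    also have "\<dots> = (\<integral>\<^sup>+z. Z z * ennreal (h z) \<partial>lborel)"
    proof (intro nn_integral_cong)
      fix z
      show "(\<integral>\<^sup>+x. ennreal (norm (A x) * norm (B (z - x)) * h z) \<partial>lborel) = Z z * ennreal (h z)"
        unfolding Z_def using h0[of z] by (subst nn_integral_multc[symmetric]) (auto simp: ennreal_mult)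
    qed
    finally show ?thesis by simp
  qed
  have "(\<integral>\<^sup>+z. Z z \<partial>lborel) = (\<integral>\<^sup>+x. \<integral>\<^sup>+y. ennreal (norm (A x) * norm (B y)) \<partial>lborel \<partial>lborel)"
    using Fub[of "\<lambda>_. 1"] by simp
  also have "\<dots> = (\<integral>\<^sup>+x. ennreal (norm (A x)) \<partial>lborel) * (\<integral>\<^sup>+y. ennreal (norm (B y)) \<partial>lborel)"
    by (simp add: ennreal_mult nn_integral_cmult nn_integral_multc)
  also have "\<dots> < \<infinity>"
    using nn_integral_eq_integral[OF integrable_norm[OF A]] nn_integral_eq_integral[OF integrable_norm[OF B]]
    by (simp add: ennreal_mult_less_top)
  finally have "AE z in lborel. Z z \<noteq> \<infinity>" by (intro nn_integral_PInf_AE) auto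
  \<comment> \<open>Truncated in height and in space, so that its square is integrable.\<close>
  define h where "h N z = (if Z z \<le> of_nat N \<and> norm z \<le> real N then enn2real (Z z) else 0)" for N :: nat and z
  have [measurable]: "h N \<in> borel_measurable borel" for N unfolding h_def by measurable
  have h0: "h N z \<ge> 0" for N z by (simp add: h_def)
  have hZ: "ennreal (h N z) \<le> Z z" for N z
    by (cases "Z z") (auto simp: h_def top_unique)
  have hN: "h N z \<le> real N * indicator (cball 0 (real N)) z" for N z
  proof (cases "Z z \<le> of_nat N \<and> norm z \<le> real N")
    case True
    then have "enn2real (Z z) \<le> enn2real (of_nat N)" by (intro enn2real_mono) (auto simp: of_nat_less_top)
    then show ?thesis using True by (simp add: h_def)
  next
    case False
    then have "h N z = 0" by (auto simp: h_def)
    then show ?thesis by simp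
  qed
  have hint: "integrable lborel (\<lambda>z. (h N z)\<^sup>2)" for N
  proof (rule Bochner_Integration.integrable_bound)
    show "integrable lborel (\<lambda>z::real^'d. (real N)\<^sup>2 * indicator (cball 0 (real N)) z)"
      by (intro integrable_mult_right integrable_real_indicator emeasure_bounded_finite bounded_cball) simp
    show "AE z in lborel. norm ((h N z)\<^sup>2) \<le> norm ((real N)\<^sup>2 * indicator (cball 0 (real N)) z)"
    proof (rule AE_I2)
      fix z
      have "(h N z)\<^sup>2 \<le> (real N * indicator (cball 0 (real N)) z)\<^sup>2" by (intro power_mono hN h0)
      then show "norm ((h N z)\<^sup>2) \<le> norm ((real N)\<^sup>2 * indicator (cball 0 (real N)) z)"
        by (cases "z \<in> cball 0 (real N)") (simp_all add: power_mult_distrib)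
    qed
  qed measurable
  have hb: "(\<integral>\<^sup>+z. ennreal ((h N z)\<^sup>2) \<partial>lborel) \<le> ennreal (P\<^sup>2)" for N
  proof -
    define s where "s = sqrt (LINT z|lborel. (h N z)\<^sup>2)"
    have s: "s \<ge> 0" "(\<integral>\<^sup>+z. ennreal ((h N z)\<^sup>2) \<partial>lborel) = ennreal (s\<^sup>2)"
      unfolding s_def using nn_integral_eq_integral[OF hint] by auto
    have "ennreal (s\<^sup>2) \<le> (\<integral>\<^sup>+z. Z z * ennreal (h N z) \<partial>lborel)"
      unfolding s(2)[symmetric]
    proof (rule nn_integral_mono)
      fix z
      have "ennreal ((h N z)\<^sup>2) = ennreal (h N z) * ennreal (h N z)"
        using h0 by (simp add: power2_eq_square ennreal_mult)
      also have "\<dots> \<le> Z z * ennreal (h N z)" by (intro mult_right_mono hZ) simp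
      finally show "ennreal ((h N z)\<^sup>2) \<le> Z z * ennreal (h N z)" .
    qed
    also have "\<dots> \<le> ennreal (P * s)"
      unfolding s_def by (subst Fub) (auto intro!: dual hint h0)
    finally have "s\<^sup>2 \<le> P * s" using P s by (simp add: ennreal_le_iff)
    then have "s \<le> P" using s(1) P by (cases "s = 0") (auto simp: power2_eq_square)
    then show ?thesis unfolding s(2) using s(1) by (intro ennreal_leI power_mono)
  qed
  have "(\<integral>\<^sup>+z. ennreal ((norm (LINT x|lborel. A x * B (z - x)))\<^sup>2) \<partial>lborel) \<le> (\<integral>\<^sup>+z. liminf (\<lambda>N. ennreal ((h N z)\<^sup>2)) \<partial>lborel)"
  proof (rule nn_integral_mono_AE, use \<open>AE z in lborel. Z z \<noteq> \<infinity>\<close> in eventually_elim)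
    case (elim z)
    then obtain c where c: "Z z = ennreal c" "c \<ge> 0" by (cases "Z z") auto
    have i: "integrable lborel (\<lambda>x. A x * B (z - x))"
      by (rule integrableI_bounded) (use elim in \<open>auto simp: Z_def norm_mult less_top\<close>)
    have "ennreal (norm (LINT x|lborel. A x * B (z - x))) \<le> (\<integral>\<^sup>+x. norm (A x * B (z - x)) \<partial>lborel)"
      by (rule integral_norm_bound_ennreal[OF i])
    also have "\<dots> = ennreal c" using c(1) by (simp add: Z_def norm_mult)
    finally have "norm (LINT x|lborel. A x * B (z - x)) \<le> c" using c by (simp add: ennreal_le_iff)
    then have le: "(norm (LINT x|lborel. A x * B (z - x)))\<^sup>2 \<le> c\<^sup>2" by (intro power_mono) auto
    obtain N0 :: nat where N0: "max c (norm z) \<le> real N0" using real_arch_simple by blast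
    have hc: "h N z = c" if "N \<ge> N0" for N
    proof -
      have "c \<le> real N" "norm z \<le> real N" using N0 that by auto
      then have "Z z \<le> of_nat N" unfolding c(1) ennreal_of_nat_eq_real_of_nat by (intro ennreal_leI)
      then show ?thesis using \<open>norm z \<le> real N\<close> c by (simp add: h_def)
    qed
    have "eventually (\<lambda>N. ennreal (c\<^sup>2) \<le> ennreal ((h N z)\<^sup>2)) sequentially"
      by (rule eventually_mono[OF eventually_ge_at_top[of N0]]) (simp add: hc)
    then have "ennreal (c\<^sup>2) \<le> liminf (\<lambda>N. ennreal ((h N z)\<^sup>2))" by (rule Liminf_bounded)
    then show ?case using ennreal_leI[OF le] by (rule order_trans[rotated])
  qed
  also have "\<dots> \<le> liminf (\<lambda>N. \<integral>\<^sup>+z. ennreal ((h N z)\<^sup>2) \<partial>lborel)" by (rule nn_integral_liminf) measurable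
  also have "\<dots> \<le> liminf (\<lambda>N. ennreal (P\<^sup>2))" by (intro Liminf_mono always_eventually allI hb)
  also have "\<dots> = ennreal (P\<^sup>2)" by (simp add: Liminf_const)
  finally show ?thesis .
qed

lemma fourier_product_L2_bound:
  fixes A B :: "real^'d::finite \<Rightarrow> complex"
  assumes A: "integrable lborel A" and B: "integrable lborel B" and P: "P \<ge> 0"
    and dual: "\<And>h. h \<in> borel_measurable borel \<Longrightarrow> (\<And>x. h x \<ge> 0) \<Longrightarrow> integrable lborel (\<lambda>x. (h x)\<^sup>2) \<Longrightarrow>
      (\<integral>\<^sup>+x. \<integral>\<^sup>+y. ennreal (norm (A x) * norm (B y) * h (x + y)) \<partial>lborel \<partial>lborel) \<le> ennreal (P * sqrt (LINT x|lborel. (h x)\<^sup>2))"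
  shows "(\<integral>\<^sup>+k. ennreal ((norm (fourier A k * fourier B k))\<^sup>2) \<partial>lborel) \<le> ennreal (((2 * pi) powr (- real CARD('d) / 2) * P)\<^sup>2)"
proof -
  define C where "C z = (LINT x|lborel. A x * B (z - x))" for z
  let ?c = "(2 * pi) powr (- real CARD('d) / 2)"
  have Ci: "integrable lborel C" unfolding C_def by (rule convolution_integrable_and_fourier(1)[OF A B])
  have Cb: "(\<integral>\<^sup>+z. ennreal ((norm (C z))\<^sup>2) \<partial>lborel) \<le> ennreal (P\<^sup>2)"
    unfolding C_def by (rule convolution_L2_bound[OF A B P dual])
  have Cm: "C \<in> borel_measurable borel" using Ci by auto
  note CL = L2_I_bound[OF Cm Cb P]
  note FC = fourier_L2[OF Ci CL(1)]
  have "fourier A k * fourier B k = complex_of_real ?c * fourier C k" for k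
  proof -
    have "complex_of_real ?c * complex_of_real ((2 * pi) powr (real CARD('d) / 2)) = 1"
      by (simp add: powr_minus_divide flip: of_real_mult)
    then show ?thesis
      unfolding C_def convolution_integrable_and_fourier(2)[OF A B] by (simp add: mult.assoc[symmetric])
  qed
  then have "(\<integral>\<^sup>+k. ennreal ((norm (fourier A k * fourier B k))\<^sup>2) \<partial>lborel) = (\<integral>\<^sup>+k. ennreal (?c\<^sup>2) * ennreal ((norm (fourier C k))\<^sup>2) \<partial>lborel)"
    by (simp add: norm_mult power_mult_distrib ennreal_mult)
  also have "\<dots> = ennreal (?c\<^sup>2) * ennreal ((L2_norm (fourier C))\<^sup>2)"
    unfolding nn_integral_L2[OF FC(1), symmetric] using L2_D(1)[OF FC(1)] by (intro nn_integral_cmult) simp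
  also have "\<dots> = ennreal ((?c * L2_norm (fourier C))\<^sup>2)" by (simp add: ennreal_mult power_mult_distrib)
  also have "\<dots> \<le> ennreal ((?c * P)\<^sup>2)"
    using FC(2) CL(2) by (intro ennreal_leI power_mono mult_left_mono) (auto simp: L2_norm_nonneg)
  finally show ?thesis .
qed

section \<open>Sobolev functions and their products\<close>

definition bessel_weight :: "real \<Rightarrow> real^'d::finite \<Rightarrow> real" where
  "bessel_weight l k = (1 + (norm k)\<^sup>2) powr (- (l / 2))"

lemma measurable_bessel_weight [measurable]: "bessel_weight l \<in> borel_measurable borel"
  unfolding bessel_weight_def by measurable

lemma bessel_weight_bounds: "bessel_weight l k > 0" "l \<ge> 0 \<Longrightarrow> bessel_weight l k \<le> 1" "bessel_weight l (- k) = bessel_weight l k"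
proof -
  have p: "1 + (norm k)\<^sup>2 \<ge> 1" by simp
  then show "bessel_weight l k > 0" unfolding bessel_weight_def by (intro powr_gt_zero[THEN iffD2]) linarith
  show "bessel_weight l k \<le> 1" if "l \<ge> 0"
    unfolding bessel_weight_def using powr_mono[of "- (l / 2)" 0 "1 + (norm k)\<^sup>2"] p that by simp
qed (simp add: bessel_weight_def)

text \<open>
  The function whose Fourier transform is the Sobolev function with datum \<open>u\<close>. The
  reflection replaces the inverse Fourier transform by the Fourier transform.
\<close>

definition reflected_weighted :: "real \<Rightarrow> (real^'d::finite \<Rightarrow> complex) \<Rightarrow> real^'d \<Rightarrow> complex" where
  "reflected_weighted l u x = u (- x) * complex_of_real (bessel_weight l x)"

lemma reflect_L2:
  assumes u: "u \<in> L2"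
  shows "(\<lambda>x. norm (u (- x))) \<in> borel_measurable borel" "integrable lborel (\<lambda>x. (norm (u (- x)))\<^sup>2)"
    "sqrt (LINT x|lborel. (norm (u (- x)))\<^sup>2) = L2_norm u"
proof -
  note [measurable] = L2_D(1)[OF u]
  have m: "(\<lambda>x. (norm (u x))\<^sup>2) \<in> borel_measurable borel" by measurable
  show "(\<lambda>x. norm (u (- x))) \<in> borel_measurable borel" by measurable
  show "integrable lborel (\<lambda>x. (norm (u (- x)))\<^sup>2)" using lborel_reflect(1)[OF m] L2_D(2)[OF u] by simp
  show "sqrt (LINT x|lborel. (norm (u (- x)))\<^sup>2) = L2_norm u"
    unfolding L2_norm_def using lborel_reflect(2)[OF m] by simp
qed

lemma norm_reflected_weighted: "norm (reflected_weighted l u x) = norm (u (- x)) * bessel_weight l x"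
  using bessel_weight_bounds(1)[of l x] by (simp add: reflected_weighted_def norm_mult)

lemma reflected_weighted_L2:
  assumes u: "u \<in> L2" and l: "l \<ge> 0"
  shows "reflected_weighted l u \<in> L2"
proof -
  note [measurable] = L2_D(1)[OF u]
  have m: "reflected_weighted l u \<in> borel_measurable borel" unfolding reflected_weighted_def by measurable
  have "norm (reflected_weighted l u x) \<le> norm (u (- x))" for x
    unfolding norm_reflected_weighted using bessel_weight_bounds[of l x] l by (intro mult_left_le) auto
  then have "(\<integral>\<^sup>+x. ennreal ((norm (reflected_weighted l u x))\<^sup>2) \<partial>lborel) \<le> (\<integral>\<^sup>+x. ennreal ((norm (u (- x)))\<^sup>2) \<partial>lborel)"
    by (intro nn_integral_mono ennreal_leI power_mono) auto
  also have "\<dots> = ennreal ((L2_norm u)\<^sup>2)"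
    unfolding reflect_L2(3)[OF u, symmetric] using nn_integral_eq_integral[OF reflect_L2(2)[OF u]] by simp
  finally show ?thesis by (rule L2_I_bound(1)[OF m _ L2_norm_nonneg])
qed

lemma is_function_D:
  assumes "is_function T f"
  shows "f \<in> borel_measurable borel" "\<phi> \<in> schwartz \<Longrightarrow> integrable lborel (\<lambda>x. f x * \<phi> x)" "\<phi> \<in> schwartz \<Longrightarrow> T \<phi> = (LINT x|lborel. f x * \<phi> x)"
  using assms by (auto simp: is_function_def)

text \<open>
  The test function \<open>(1 + |k|\<^sup>2) powr (- l / 2)\<close> times a modulated Gaussian cancels the Sobolev weight. Its
  image is then the transform of the modulated Gaussian, a heat kernel, on which the
  distribution acts through the function \<open>f\<close>.
\<close>

lemma sobolev_test_identity:
  fixes T :: "'d::finite distr"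
  assumes f: "is_function T f" and u: "is_function (sobolev_weighted_fourier l T) u" and a: "a > 0"
  shows "(LINT x|lborel. f x * complex_of_real (heat_kernel a y x)) = (LINT x|lborel. u x * (complex_of_real (bessel_weight l x) * gaussian_wave a y x))"
proof -
  define \<phi> where "\<phi> x = complex_of_real (bessel_weight l x) * gaussian_wave a y x" for x
  have \<phi>: "\<phi> \<in> schwartz"
    using weighted_gaussian_wave_schwartz[OF a, of "- (l / 2)" y] unfolding \<phi>_def bessel_weight_def by simp
  have "(\<lambda>x. complex_of_real ((1 + (norm x)\<^sup>2) powr (l / 2)) * \<phi> x) = gaussian_wave a y"
  proof (rule ext)
    fix x :: "real^'d"
    have "1 + (norm x)\<^sup>2 > 0" by (simp add: add_pos_nonneg)
    then have "(1 + (norm x)\<^sup>2) powr (l / 2) * bessel_weight l x = 1"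
      unfolding bessel_weight_def by (simp add: powr_add[symmetric])
    then show "complex_of_real ((1 + (norm x)\<^sup>2) powr (l / 2)) * \<phi> x = gaussian_wave a y x"
      unfolding \<phi>_def by (simp add: mult.assoc[symmetric] flip: of_real_mult)
  qed
  then have "sobolev_weighted_fourier l T \<phi> = T (\<lambda>k. complex_of_real (heat_kernel a y k))"
    unfolding sobolev_weighted_fourier_def distr_mult_def distr_fourier_def
    by (simp add: fourier_gaussian_wave[OF a, abs_def] fun_eq_iff)
  then show ?thesis
    using is_function_D(3)[OF u \<phi>] is_function_D(3)[OF f heat_kernel_schwartz[OF a, of y]] by (simp add: \<phi>_def)
qed

lemma is_function_gaussian_integrable:
  fixes T :: "'d::finite distr"
  assumes f: "is_function T f" and a: "a > 0"
  shows "integrable lborel (\<lambda>x. norm (f x) * exp (- (a * (norm x)\<^sup>2)))"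
proof -
  have "(\<lambda>x. complex_of_real (heat_kernel (1 / (2 * a)) 0 x)) \<in> schwartz" by (rule heat_kernel_schwartz) (use a in simp)
  from integrable_norm[OF is_function_D(2)[OF f this]]
  have i: "integrable lborel (\<lambda>x. norm (f x) * heat_kernel (1 / (2 * a)) 0 x)"
    using a by (simp add: norm_mult heat_kernel_nonneg)
  define c where "c = (1 / (2 * a)) powr (- real CARD('d) / 2)"
  have c: "c > 0" using a by (simp add: c_def)
  have "norm (f x) * exp (- (a * (norm x)\<^sup>2)) = (1 / c) * (norm (f x) * heat_kernel (1 / (2 * a)) 0 x)" for x
  proof -
    have "heat_kernel (1 / (2 * a)) 0 x = c * exp (- (a * (norm x)\<^sup>2))"
      unfolding heat_kernel_def c_def using a by (simp add: mult.commute)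
    then show ?thesis using c by simp
  qed
  then show ?thesis using i by simp
qed

text \<open>
  Both \<open>f\<close> and the square integrable transform of \<open>reflected_weighted l u\<close> have the same integrals against
  all heat kernels.
\<close>

lemma sobolev_function_as_fourier_limit:
  fixes T :: "'d::finite distr"
  assumes f: "is_function T f" and u: "is_function (sobolev_weighted_fourier l T) u" "u \<in> L2" and l: "l \<ge> 0"
  obtains r where "strict_mono r" "AE x in lborel. (\<lambda>n. fourier (gaussian_cutoff (reflected_weighted l u) (r n)) x) \<longlonglongrightarrow> f x"
proof -
  define U where "U = reflected_weighted l u"
  have U: "U \<in> L2" unfolding U_def by (rule reflected_weighted_L2[OF u(2) l])
  obtain W r where W: "W \<in> L2" and r: "strict_mono r"
    and lim: "AE x in lborel. (\<lambda>n. fourier (gaussian_cutoff U (r n)) x) \<longlonglongrightarrow> W x"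
    and pars: "\<And>\<phi>. integrable lborel \<phi> \<Longrightarrow> \<phi> \<in> L2 \<Longrightarrow> (LINT x|lborel. U x * fourier \<phi> x) = (LINT x|lborel. W x * \<phi> x)"
    by (rule L2_fourier_transform_exists[OF U]) blast
  note [measurable] = L2_D(1)[OF W] is_function_D(1)[OF f] L2_D(1)[OF u(2)]
  have "AE x in lborel. f x - W x = 0"
  proof (rule heat_kernel_uniqueness)
    fix a :: real assume a: "a > 0"
    have "integrable lborel (\<lambda>x. norm (W x * complex_of_real (exp (- (a * (norm x)\<^sup>2)))))"
      by (intro integrable_norm L2_mult(1)[OF W gaussian_L2[OF a]])
    then have "integrable lborel (\<lambda>x. norm (W x) * exp (- (a * (norm x)\<^sup>2)))" by (simp add: norm_mult)
    then have i: "integrable lborel (\<lambda>x. norm (f x) * exp (- (a * (norm x)\<^sup>2)) + norm (W x) * exp (- (a * (norm x)\<^sup>2)))"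
      by (intro Bochner_Integration.integrable_add is_function_gaussian_integrable[OF f a])
    show "integrable lborel (\<lambda>x. norm (f x - W x) * exp (- (a * (norm x)\<^sup>2)))"
    proof (rule Bochner_Integration.integrable_bound[OF i])
      show "AE x in lborel. norm (norm (f x - W x) * exp (- (a * (norm x)\<^sup>2))) \<le> norm (norm (f x) * exp (- (a * (norm x)\<^sup>2)) + norm (W x) * exp (- (a * (norm x)\<^sup>2)))"
      proof (rule AE_I2)
        fix x
        have "norm (f x - W x) * exp (- (a * (norm x)\<^sup>2)) \<le> (norm (f x) + norm (W x)) * exp (- (a * (norm x)\<^sup>2))"
          by (intro mult_right_mono norm_triangle_ineq4) simp
        then show "norm (norm (f x - W x) * exp (- (a * (norm x)\<^sup>2))) \<le> norm (norm (f x) * exp (- (a * (norm x)\<^sup>2)) + norm (W x) * exp (- (a * (norm x)\<^sup>2)))"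
          by (simp add: distrib_right)
      qed
    qed measurable
  next
    fix a :: real and y :: "real^'d" assume a: "0 < a" "a \<le> 1"
    let ?k = "\<lambda>x. complex_of_real (heat_kernel a y x)"
    have ks: "?k \<in> schwartz" by (rule heat_kernel_schwartz[OF a(1)])
    note k = schwartz_square_integrable(1,2)[OF ks]
    have "(LINT x|lborel. W x * ?k x) = (LINT x|lborel. U x * fourier ?k x)" by (rule pars[OF k, symmetric])
    also have "\<dots> = (LINT x|lborel. u (- x) * (complex_of_real (bessel_weight l (- x)) * gaussian_wave a y (- x)))"
      by (simp add: fourier_heat_kernel[OF a(1)] U_def reflected_weighted_def bessel_weight_bounds(3) mult.assoc)
    also have "\<dots> = (LINT x|lborel. u x * (complex_of_real (bessel_weight l x) * gaussian_wave a y x))"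
      by (rule lborel_reflect(2)) measurable
    also have "\<dots> = (LINT x|lborel. f x * ?k x)" by (rule sobolev_test_identity[OF f u(1) a(1), symmetric])
    finally have "(LINT x|lborel. f x * ?k x) - (LINT x|lborel. W x * ?k x) = 0" by simp
    then show "(LINT x|lborel. (f x - W x) * ?k x) = 0"
      using is_function_D(2)[OF f ks] L2_mult(1)[OF W k(2)] by (simp add: left_diff_distrib)
  qed measurable
  with lim have "AE x in lborel. (\<lambda>n. fourier (gaussian_cutoff U (r n)) x) \<longlonglongrightarrow> f x"
    by eventually_elim simp
  then show ?thesis using that r unfolding U_def by blast
qed

text \<open>
  For the cutoffs the product is the transform of a convolution and the trilinear bound applies,
  uniformly because cutting off decreases absolute values. The
  cutoffs of the two factors may run along different subsequences.
\<close>

lemma sobolev_product_L2: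
  fixes F G :: "'d::finite distr"
  assumes tb: "trilinear_bound (bessel_weight m) (bessel_weight n :: real^'d \<Rightarrow> real) B" and B: "B \<ge> 0"
    and mn: "m \<ge> 0" "n \<ge> 0"
    and f: "is_function F f" "is_function (sobolev_weighted_fourier m F) u" "u \<in> L2"
    and g: "is_function G g" "is_function (sobolev_weighted_fourier n G) v" "v \<in> L2"
  shows "(\<lambda>x. f x * g x) \<in> L2" "L2_norm (\<lambda>x. f x * g x) \<le> (2 * pi) powr (- real CARD('d) / 2) * B * L2_norm u * L2_norm v"
proof -
  define P where "P = B * L2_norm u * L2_norm v"
  have P: "P \<ge> 0" unfolding P_def by (intro mult_nonneg_nonneg B L2_norm_nonneg)
  let ?c = "(2 * pi) powr (- real CARD('d) / 2)"
  obtain r where r: "AE x in lborel. (\<lambda>k. fourier (gaussian_cutoff (reflected_weighted m u) (r k)) x) \<longlonglongrightarrow> f x"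
    by (rule sobolev_function_as_fourier_limit[OF f mn(1)]) blast
  obtain s where s: "AE x in lborel. (\<lambda>k. fourier (gaussian_cutoff (reflected_weighted n v) (s k)) x) \<longlonglongrightarrow> g x"
    by (rule sobolev_function_as_fourier_limit[OF g mn(2)]) blast
  define A where "A k = gaussian_cutoff (reflected_weighted m u) (r k)" for k
  define A' where "A' k = gaussian_cutoff (reflected_weighted n v) (s k)" for k
  note uL = reflected_weighted_L2[OF f(3) mn(1)] and vL = reflected_weighted_L2[OF g(3) mn(2)]
  have Ai: "integrable lborel (A k)" "integrable lborel (A' k)" for k
    unfolding A_def A'_def by (rule gaussian_cutoff_integrable uL vL)+
  have An: "norm (A k x) \<le> norm (u (- x)) * bessel_weight m x" "norm (A' k x) \<le> norm (v (- x)) * bessel_weight n x" for k x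
    unfolding A_def A'_def norm_reflected_weighted[symmetric] by (rule norm_gaussian_cutoff_le)+
  have bound: "(\<integral>\<^sup>+x. ennreal ((norm (fourier (A k) x * fourier (A' k) x))\<^sup>2) \<partial>lborel) \<le> ennreal ((?c * P)\<^sup>2)" for k
  proof (rule fourier_product_L2_bound[OF Ai P])
    fix h :: "real^'d \<Rightarrow> real" assume h: "h \<in> borel_measurable borel" "\<And>x. h x \<ge> 0" "integrable lborel (\<lambda>x. (h x)\<^sup>2)"
    have "(\<integral>\<^sup>+x. \<integral>\<^sup>+y. ennreal (norm (A k x) * norm (A' k y) * h (x + y)) \<partial>lborel \<partial>lborel)
      \<le> (\<integral>\<^sup>+x. \<integral>\<^sup>+y. ennreal ((norm (u (- x)) * bessel_weight m x) * (norm (v (- y)) * bessel_weight n y) * h (x + y)) \<partial>lborel \<partial>lborel)"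
      using bessel_weight_bounds(1)[THEN less_imp_le] by (intro nn_integral_mono ennreal_leI mult_mono An mult_right_mono) (auto intro!: h(2) mult_nonneg_nonneg)
    also have "\<dots> \<le> ennreal (B * sqrt (LINT x|lborel. (norm (u (- x)))\<^sup>2) * sqrt (LINT x|lborel. (norm (v (- x)))\<^sup>2) * sqrt (LINT x|lborel. (h x)\<^sup>2))"
      by (rule tb[unfolded trilinear_bound_def, rule_format]) (use h reflect_L2[OF f(3)] reflect_L2[OF g(3)] in auto)
    finally show "(\<integral>\<^sup>+x. \<integral>\<^sup>+y. ennreal (norm (A k x) * norm (A' k y) * h (x + y)) \<partial>lborel \<partial>lborel) \<le> ennreal (P * sqrt (LINT x|lborel. (h x)\<^sup>2))"
      unfolding reflect_L2(3)[OF f(3)] reflect_L2(3)[OF g(3)] P_def .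
  qed
  have [measurable]: "A k \<in> borel_measurable borel" "A' k \<in> borel_measurable borel" for k using Ai[of k] by auto
  note [measurable] = is_function_D(1)[OF f(1)] is_function_D(1)[OF g(1)]
  have "(\<integral>\<^sup>+x. ennreal ((norm (f x * g x))\<^sup>2) \<partial>lborel) = (\<integral>\<^sup>+x. liminf (\<lambda>k. ennreal ((norm (fourier (A k) x * fourier (A' k) x))\<^sup>2)) \<partial>lborel)"
  proof (rule nn_integral_cong_AE, use r s in eventually_elim)
    case (elim x)
    have "(\<lambda>k. (norm (fourier (A k) x * fourier (A' k) x))\<^sup>2) \<longlonglongrightarrow> (norm (f x * g x))\<^sup>2"
      unfolding A_def A'_def by (intro tendsto_power tendsto_norm tendsto_mult elim)
    from lim_imp_Liminf[OF trivial_limit_sequentially tendsto_ennrealI[OF this]] show ?case by (rule sym)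
  qed
  also have "\<dots> \<le> liminf (\<lambda>k. \<integral>\<^sup>+x. ennreal ((norm (fourier (A k) x * fourier (A' k) x))\<^sup>2) \<partial>lborel)"
    by (rule nn_integral_liminf) measurable
  also have "\<dots> \<le> liminf (\<lambda>k. ennreal ((?c * P)\<^sup>2))" by (intro Liminf_mono always_eventually allI bound)
  also have "\<dots> = ennreal ((?c * P)\<^sup>2)" by (simp add: Liminf_const)
  finally have n: "(\<integral>\<^sup>+x. ennreal ((norm (f x * g x))\<^sup>2) \<partial>lborel) \<le> ennreal ((?c * P)\<^sup>2)" .
  have m: "(\<lambda>x. f x * g x) \<in> borel_measurable borel" by measurable
  have cP: "?c * P \<ge> 0" using P by simp
  show "(\<lambda>x. f x * g x) \<in> L2" by (rule L2_I_bound(1)[OF m n cP])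
  show "L2_norm (\<lambda>x. f x * g x) \<le> ?c * B * L2_norm u * L2_norm v"
    using L2_I_bound(2)[OF m n cP] by (simp add: P_def mult.assoc)
qed

text \<open>
  Justifies the choice of a representative in the definition of \<open>sobolev_norm\<close>.
\<close>

lemma is_function_norm_unique:
  fixes u u' :: "real^'d::finite \<Rightarrow> complex"
  assumes u: "u \<in> L2" "u' \<in> L2"
    and eq: "\<And>a y. 0 < a \<Longrightarrow> (LINT x|lborel. u x * complex_of_real (heat_kernel a y x)) = (LINT x|lborel. u' x * complex_of_real (heat_kernel a y x))"
  shows "L2_norm u = L2_norm u'"
proof -
  define w where "w x = u x - u' x" for x
  have w: "w \<in> L2" unfolding w_def by (rule L2_diff(1)[OF u])
  note [measurable] = L2_D(1)[OF w] L2_D(1)[OF u(1)] L2_D(1)[OF u(2)]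
  have "AE x in lborel. w x = 0"
  proof (rule heat_kernel_uniqueness)
    fix a :: real assume a: "a > 0"
    have "integrable lborel (\<lambda>x. norm (w x * complex_of_real (exp (- (a * (norm x)\<^sup>2)))))"
      by (intro integrable_norm L2_mult(1)[OF w gaussian_L2[OF a]])
    then show "integrable lborel (\<lambda>x. norm (w x) * exp (- (a * (norm x)\<^sup>2)))" by (simp add: norm_mult)
  next
    fix a :: real and y :: "real^'d" assume a: "0 < a" "a \<le> 1"
    note k = schwartz_square_integrable(2)[OF heat_kernel_schwartz[OF a(1), of y]]
    show "(LINT x|lborel. w x * complex_of_real (heat_kernel a y x)) = 0"
      using eq[OF a(1), of y] L2_mult(1)[OF u(1) k] L2_mult(1)[OF u(2) k] by (simp add: w_def left_diff_distrib)
  qed measurable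
  then have "AE x in lborel. (norm (u x))\<^sup>2 = (norm (u' x))\<^sup>2" by eventually_elim (simp add: w_def)
  then have "(LINT x|lborel. (norm (u x))\<^sup>2) = (LINT x|lborel. (norm (u' x))\<^sup>2)" by (intro integral_cong_AE) measurable
  then show ?thesis by (simp add: L2_norm_def)
qed

lemma sobolev_norm_eq:
  fixes T :: "'d::finite distr"
  assumes u: "u \<in> L2" "is_function (sobolev_weighted_fourier l T) u"
  shows "sobolev_norm l T = L2_norm u"
proof -
  define u' where "u' = (SOME u. u \<in> L2 \<and> is_function (sobolev_weighted_fourier l T) u)"
  have u': "u' \<in> L2 \<and> is_function (sobolev_weighted_fourier l T) u'"
    unfolding u'_def by (rule someI[of _ u]) (use u in blast)
  have "L2_norm u' = L2_norm u"
  proof (rule is_function_norm_unique)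
    fix a :: real and y :: "real^'d" assume a: "a > 0"
    note k = heat_kernel_schwartz[OF a, of y]
    show "(LINT x|lborel. u' x * complex_of_real (heat_kernel a y x)) = (LINT x|lborel. u x * complex_of_real (heat_kernel a y x))"
      using is_function_D(3)[OF u(2) k] is_function_D(3)[OF conjunct2[OF u'] k] by simp
  qed (use u u' in auto)
  then show ?thesis by (simp add: sobolev_norm_def u'_def)
qed

lemma sobolev_weighted_fourier_0: "sobolev_weighted_fourier 0 T \<phi> = T (fourier \<phi>)" for T :: "'d::finite distr"
proof -
  have "1 + (norm x)\<^sup>2 \<noteq> 0" for x :: "real^'d" using zero_le_power2[of "norm x"] by linarith
  then show ?thesis by (simp add: sobolev_weighted_fourier_def distr_mult_def distr_fourier_def)
qed

text \<open>
  Two distributions given by the same function agree on Schwartz functions only. The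
  transforms of heat kernels are modulated Gaussians, hence Schwartz functions, so the Fourier
  transforms of the two distributions agree on heat kernels, and this determines them.
\<close>

lemma sobolev_norm_0_determined:
  fixes H H' :: "'d::finite distr"
  assumes H: "H \<in> sobolev 0" "is_function H h" and H': "H' \<in> sobolev 0" "is_function H' h"
  shows "sobolev_norm 0 H = sobolev_norm 0 H'"
proof -
  obtain u where u: "u \<in> L2" "is_function (sobolev_weighted_fourier 0 H) u" using H by (auto simp: sobolev_def)
  obtain u' where u': "u' \<in> L2" "is_function (sobolev_weighted_fourier 0 H') u'" using H' by (auto simp: sobolev_def)
  have "L2_norm u = L2_norm u'"
  proof (rule is_function_norm_unique[OF u(1) u'(1)])
    fix a :: real and y :: "real^'d" assume a: "a > 0"
    let ?k = "\<lambda>x. complex_of_real (heat_kernel a y x)"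
    note k = heat_kernel_schwartz[OF a, of y]
    \<comment> \<open>The test function has a Schwartz transform of the same kind, where both distributions are integration against \<open>h\<close>.\<close>
    have fk: "fourier ?k = gaussian_wave a (- y)"
      using fourier_heat_kernel[OF a, of y] by (simp add: fun_eq_iff gaussian_wave_def)
    have "(\<lambda>x. complex_of_real ((1 + (norm x)\<^sup>2) powr 0) * gaussian_wave a (- y) x) = gaussian_wave a (- y)"
    proof -
      have "1 + (norm x)\<^sup>2 \<noteq> 0" for x :: "real^'d" using zero_le_power2[of "norm x"] by linarith
      then show ?thesis by simp
    qed
    then have gw: "gaussian_wave a (- y) \<in> schwartz" using weighted_gaussian_wave_schwartz[OF a, of 0 "- y"] by simp
    have "(LINT x|lborel. u x * ?k x) = H (fourier ?k)" using is_function_D(3)[OF u(2) k] by (simp add: sobolev_weighted_fourier_0)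
    also have "\<dots> = H' (fourier ?k)" unfolding fk using is_function_D(3)[OF H(2) gw] is_function_D(3)[OF H'(2) gw] by simp
    also have "\<dots> = (LINT x|lborel. u' x * ?k x)" using is_function_D(3)[OF u'(2) k] by (simp add: sobolev_weighted_fourier_0)
    finally show "(LINT x|lborel. u x * ?k x) = (LINT x|lborel. u' x * ?k x)" .
  qed
  then show ?thesis by (simp add: sobolev_norm_eq[OF u] sobolev_norm_eq[OF u'])
qed

text \<open>
  The distribution is integration against \<open>h\<close>; its Fourier transform is the function provided by
  \<open>L2_fourier_transform_exists\<close>.
\<close>

lemma L2_function_in_sobolev_0:
  fixes h :: "real^'d::finite \<Rightarrow> complex"
  assumes h: "h \<in> L2"
  obtains H :: "'d distr" where "H \<in> sobolev 0" "is_function H h" "sobolev_norm 0 H \<le> L2_norm h"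
proof -
  define H where "H \<phi> = (LINT x|lborel. h x * \<phi> x)" for \<phi>
  have i: "integrable lborel (\<lambda>x. h x * \<phi> x)" if "\<phi> \<in> schwartz" for \<phi>
    by (rule L2_mult(1)[OF h schwartz_square_integrable(2)[OF that]])
  have isf: "is_function H h" using L2_D(1)[OF h] i by (simp add: is_function_def H_def)
  obtain W where W: "W \<in> L2" "L2_norm W \<le> L2_norm h"
    and pars: "\<And>\<phi>. integrable lborel \<phi> \<Longrightarrow> \<phi> \<in> L2 \<Longrightarrow> (LINT x|lborel. h x * fourier \<phi> x) = (LINT x|lborel. W x * \<phi> x)"
    by (rule L2_fourier_transform_exists[OF h]) blast
  have isW: "is_function (sobolev_weighted_fourier 0 H) W"
    unfolding is_function_def sobolev_weighted_fourier_0
    using L2_D(1)[OF W(1)] L2_mult(1)[OF W(1) schwartz_square_integrable(2)] pars[OF schwartz_square_integrable(1,2)] by (simp add: H_def)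
  define I where "I = (LINT k|(lborel :: (real^'d) measure). (1 + (norm k)\<^sup>2) powr (- real (Suc CARD('d))))"
  have "tempered H"
    unfolding tempered_def
  proof (intro conjI ballI allI)
    fix \<phi> \<psi> :: "real^'d \<Rightarrow> complex" and a b assume s: "\<phi> \<in> schwartz" "\<psi> \<in> schwartz"
    have "H (\<lambda>x. a * \<phi> x + b * \<psi> x) = (LINT x|lborel. a * (h x * \<phi> x) + b * (h x * \<psi> x))"
      unfolding H_def by (intro Bochner_Integration.integral_cong refl) (simp add: algebra_simps)
    also have "\<dots> = a * H \<phi> + b * H \<psi>" unfolding H_def using i[OF s(1)] i[OF s(2)] by simp
    finally show "H (\<lambda>x. a * \<phi> x + b * \<psi> x) = a * H \<phi> + b * H \<psi>" .
  next
    show "\<exists>C N. \<forall>\<phi>\<in>schwartz. norm (H \<phi>) \<le> C * schwartz_seminorm N \<phi>"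
    proof (intro exI ballI)
      fix \<phi> :: "real^'d \<Rightarrow> complex" assume s: "\<phi> \<in> schwartz"
      have "norm (H \<phi>) \<le> L2_norm h * L2_norm \<phi>"
        unfolding H_def by (rule L2_mult(3)[OF h schwartz_square_integrable(2)[OF s]])
      also have "\<dots> \<le> L2_norm h * (sqrt I * schwartz_seminorm (Suc CARD('d)) \<phi>)"
        unfolding I_def by (intro mult_left_mono schwartz_square_integrable(3)[OF s] L2_norm_nonneg)
      finally show "norm (H \<phi>) \<le> (L2_norm h * sqrt I) * schwartz_seminorm (Suc CARD('d)) \<phi>" by (simp only: mult.assoc)
    qed
  qed
  then have "H \<in> sobolev 0" using W(1) isW by (auto simp: sobolev_def)
  then show ?thesis using that isf sobolev_norm_eq[OF W(1) isW] W(2) by simp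
qed

lemma product_bound_of_trilinear_bound:
  assumes tb: "trilinear_bound (bessel_weight m) (bessel_weight n :: real^'d \<Rightarrow> real) B" and B: "B \<ge> 0" and mn: "m \<ge> 0" "n \<ge> 0"
  shows "product_bound TYPE('d::finite) m n ((2 * pi) powr (- real CARD('d) / 2) * B)"
  unfolding product_bound_def
proof (intro ballI allI impI)
  fix F G :: "'d distr" and f g
  assume F: "F \<in> sobolev m" and G: "G \<in> sobolev n" and fg: "is_function F f \<and> is_function G g"
  obtain u where u: "u \<in> L2" "is_function (sobolev_weighted_fourier m F) u" using F by (auto simp: sobolev_def)
  obtain v where v: "v \<in> L2" "is_function (sobolev_weighted_fourier n G) v" using G by (auto simp: sobolev_def)
  note p = sobolev_product_L2[OF tb B mn conjunct1[OF fg] u(2,1) conjunct2[OF fg] v(2,1)]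
  obtain H :: "'d distr" where H: "H \<in> sobolev 0" "is_function H (\<lambda>x. f x * g x)" "sobolev_norm 0 H \<le> L2_norm (\<lambda>x. f x * g x)"
    by (rule L2_function_in_sobolev_0[OF p(1)]) blast
  then show "\<exists>H\<in>sobolev 0. is_function H (\<lambda>x. f x * g x) \<and>
      sobolev_norm 0 H \<le> (2 * pi) powr (- real CARD('d) / 2) * B * sobolev_norm m F * sobolev_norm n G"
    using p(2) by (intro bexI[of _ H]) (auto simp: sobolev_norm_eq[OF u] sobolev_norm_eq[OF v])
qed

text \<open>
  The witness \<open>H\<close> in \<open>product_bound\<close> may depend on the constant, but its norm does not. The norm is
  therefore bounded by \<open>K\<close> times the product of the norms for all admissible \<open>K\<close> at once, hence also
  for their infimum, which is then the least admissible constant.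
\<close>

lemma K0_le:
  assumes C: "product_bound TYPE('d::finite) m n C" "C \<ge> 0"
  shows "K0 TYPE('d) m n \<le> C"
proof -
  define S where "S = {K. 0 \<le> K \<and> product_bound TYPE('d) m n K}"
  have S: "C \<in> S" "bdd_below S" using C by (auto simp: S_def)
  define I where "I = Inf S"
  have I0: "I \<ge> 0" unfolding I_def using S(1) by (intro cInf_greatest) (auto simp: S_def)
  have lower: "I \<le> K" if "K \<in> S" for K unfolding I_def by (rule cInf_lower[OF that S(2)])
  have "product_bound TYPE('d) m n I"
    unfolding product_bound_def
  proof (intro ballI allI impI)
    fix F G :: "'d distr" and f g
    assume F: "F \<in> sobolev m" and G: "G \<in> sobolev n" and fg: "is_function F f \<and> is_function G g"
    define t where "t = sobolev_norm m F * sobolev_norm n G"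
    have t: "t \<ge> 0" unfolding t_def sobolev_norm_def by (intro mult_nonneg_nonneg L2_norm_nonneg)
    have ex: "\<exists>H\<in>sobolev 0. is_function H (\<lambda>x. f x * g x) \<and> sobolev_norm 0 H \<le> K * t" if "K \<in> S" for K
      using that F G fg unfolding S_def product_bound_def t_def by (auto simp: mult.assoc)
    obtain H where H: "H \<in> sobolev 0" "is_function H (\<lambda>x. f x * g x)" using ex[OF S(1)] by blast
    have le: "sobolev_norm 0 H \<le> K * t" if K: "K \<in> S" for K
      using ex[OF K] sobolev_norm_0_determined[OF H] by auto
    have "sobolev_norm 0 H \<le> I * t"
    proof (cases "t = 0")
      case True
      then show ?thesis using le[OF S(1)] by simp
    next
      case False
      then have tp: "t > 0" using t by simp
      have "sobolev_norm 0 H / t \<le> I"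
        unfolding I_def by (rule cInf_greatest) (use S(1) le tp in \<open>auto simp: pos_divide_le_eq\<close>)
      then show ?thesis using tp by (simp add: pos_divide_le_eq)
    qed
    then show "\<exists>H\<in>sobolev 0. is_function H (\<lambda>x. f x * g x) \<and> sobolev_norm 0 H \<le> I * sobolev_norm m F * sobolev_norm n G"
      using H by (auto simp: t_def mult.assoc)
  qed
  then have "K0 TYPE('d) m n = I"
    unfolding K0_def using I0 lower by (intro Least_equality) (auto simp: S_def)
  then show ?thesis using lower[OF S(1)] by simp
qed

section \<open>Exponents and constants\<close>

lemma dual_exponent_cases:
  assumes "p \<ge> 2"
  obtains (two) "p = 2" "dual_exponent p = \<infinity>"
    | (infinity) "p = \<infinity>" "dual_exponent p = 2"
    | (real) r s where "p = ereal r" "dual_exponent p = ereal s" "r > 2" "s > 2" "1 / r + 1 / s = 1 / 2"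
proof -
  have inv: "1 / ereal x = ereal (1 / x)" if "x > 0" for x
    using that by (simp add: one_ereal_def)
  have half: "(1::ereal) / 2 = ereal (1 / 2)"
    using inv[of 2] by (simp only: numeral_eq_ereal zero_less_numeral simp_thms)
  have uniq: "dual_exponent p = q" if "q \<in> {2..\<infinity>}" "1 / p + 1 / q = 1 / 2" "\<And>q'. q' \<ge> 2 \<Longrightarrow> 1 / p + 1 / q' = 1 / 2 \<Longrightarrow> q' = q" for q
    unfolding dual_exponent_def
    by (rule the_equality) (rule conjI[OF that(1,2)], elim conjE, rule that(3), simp)
  consider "p = \<infinity>" | r where "p = ereal r" "r = 2" | r where "p = ereal r" "r > 2"
    using assms by (cases p) (auto simp: le_less)
  then show ?thesis
  proof cases
    case 1
    have "dual_exponent p = 2"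
    proof (rule uniq)
      fix q' :: ereal assume q: "q' \<ge> 2" "1 / p + 1 / q' = 1 / 2"
      show "q' = 2"
      proof (cases q')
        case (real x)
        with q(1) have "x \<ge> 2" by simp
        then have "1 / x = 1 / 2" using q(2) real 1 inv[of x] half by simp
        then show ?thesis using \<open>x \<ge> 2\<close> real by (simp add: field_simps)
      qed (use q 1 half in auto)
    qed (use 1 in auto)
    then show ?thesis using infinity 1 by blast
  next
    case 2
    have "dual_exponent p = \<infinity>"
    proof (rule uniq)
      fix q' :: ereal assume q: "q' \<ge> 2" "1 / p + 1 / q' = 1 / 2"
      show "q' = \<infinity>"
      proof (cases q')
        case (real x)
        with q(1) have "x \<ge> 2" by simp
        then have "1 / 2 + 1 / x = 1 / 2" using q(2) real 2 inv[of x] inv[of 2] half by simp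
        then show ?thesis using \<open>x \<ge> 2\<close> by simp
      qed (use q in auto)
    qed (use 2 in auto)
    then show ?thesis using two 2 that(1) by simp
  next
    case (3 r)
    define s where "s = 2 * r / (r - 2)"
    have s: "s > 2" using 3 by (simp add: s_def pos_less_divide_eq)
    have rs: "1 / r + 1 / s = 1 / 2" using 3 by (simp add: s_def field_simps)
    have "dual_exponent p = ereal s"
    proof (rule uniq)
      show "ereal s \<in> {2..\<infinity>}" using s by simp
      show "1 / p + 1 / ereal s = 1 / 2" using 3 s rs inv[of r] inv[of s] half by simp
      fix q' :: ereal assume q: "q' \<ge> 2" "1 / p + 1 / q' = 1 / 2"
      show "q' = ereal s"
      proof (cases q')
        case (real x)
        with q(1) have x: "x \<ge> 2" by simp
        then have "1 / r + 1 / x = 1 / 2" using q(2) real 3 inv[of x] inv[of r] half by simp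
        then have "1 / x = 1 / s" using rs by linarith
        then show ?thesis using real x s by simp
      next
        case PInf
        then have "1 / r = 1 / 2" using q(2) 3 inv[of r] half by simp
        then show ?thesis using 3 by simp
      qed (use q in auto)
    qed
    then show ?thesis using that(3)[of r s] 3 s rs by blast
  qed
qed

lemma R_set_ge_2: "p \<in> R_set t d \<Longrightarrow> p \<ge> 2"
  by (auto simp: R_set_def split: if_splits)

text \<open>
  The integrals of the weights converge for the exponents at which the constants are defined.
\<close>

lemma S_defined_real:
  assumes S: "S_defined (ereal r) t d" and r: "r > 2" and d: "d > 0"
  shows "t / (1 - 2 / r) > real d / 2"
proof -
  have c: "0 < 1 - 2 / r" "1 - 2 / r < 1" using r by auto
  consider "0 \<le> t" "t < real d / 2" "r < real d / (real d / 2 - t)" | "t \<ge> real d / 2"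
    using S r unfolding S_defined_def by auto
  then show ?thesis
  proof cases
    case 1
    have "r * (real d / 2 - t) < real d" using 1 by (simp add: pos_less_divide_eq)
    then have "real d / 2 * (1 - 2 / r) < t" using r by (simp add: field_simps)
    then show ?thesis using c by (simp add: pos_less_divide_eq)
  next
    case 2
    then have "real d / 2 * (1 - 2 / r) < t * 1" using c d by (intro mult_le_less_imp_less) auto
    then show ?thesis using c by (simp add: pos_less_divide_eq)
  qed
qed

lemma S_defined_infinity: "S_defined \<infinity> t d \<Longrightarrow> t > real d / 2"
  unfolding S_defined_def by (elim conjE disjE) simp_all

lemma bessel_weight_powr: "bessel_weight l k powr c = (1 + (norm k)\<^sup>2) powr (- (l / 2 * c))"
  by (simp only: bessel_weight_def powr_powr mult_minus_left)

lemma two_pi_normalization: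
  assumes "d \<ge> (0::real)"
  shows "(2 * pi) powr (- d / 2) * (pi powr (d / 2)) powr (1 / 2) = 1 / (4 * pi) powr (d / 4)"
proof -
  have "(2 * pi) powr (- d / 2) = (4 * pi) powr (- d / 4) * pi powr (- d / 4)"
  proof -
    have "(2 * pi) powr (- d / 2) = ((2 * pi) powr 2) powr (- d / 4)"
    proof -
      have "2 * (- d / 4) = - d / 2" by simp
      then show ?thesis by (simp only: powr_powr)
    qed
    also have "(2 * pi) powr 2 = (4 * pi) * pi" by (simp add: power2_eq_square)
    finally show ?thesis by (simp only: powr_mult)
  qed
  moreover have "(pi powr (d / 2)) powr (1 / 2) = pi powr (d / 4)" by (simp only: powr_powr) simp
  moreover have "pi powr (- d / 4) * pi powr (d / 4) = 1" by (simp add: powr_add[symmetric])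
  ultimately have "(2 * pi) powr (- d / 2) * (pi powr (d / 2)) powr (1 / 2) = (4 * pi) powr (- d / 4) * 1"
    by (simp only: mult.assoc)
  then show ?thesis by (simp add: powr_minus_divide)
qed

lemma bessel_weight_square_integrable:
  assumes "t > real CARD('d::finite) / 2"
  shows "integrable lborel (\<lambda>k::real^'d. (bessel_weight t k)\<^sup>2)"
    "(2 * pi) powr (- real CARD('d) / 2) * sqrt (LINT k|(lborel :: (real^'d) measure). (bessel_weight t k)\<^sup>2) = S_const \<infinity> t CARD('d)"
proof -
  have sq: "(bessel_weight t k)\<^sup>2 = (1 + (norm k)\<^sup>2) powr (- t)" for k :: "real^'d"
    using bessel_weight_powr[of t k 2] bessel_weight_bounds(1)[of t k] by simp
  have t: "real DIM(real^'d) / 2 < t" using assms by simp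
  note b = integrable_bessel_weight[OF t]
  show "integrable lborel (\<lambda>k::real^'d. (bessel_weight t k)\<^sup>2)" unfolding sq by (rule b(1))
  define X where "X = Gamma (t - real CARD('d) / 2) / Gamma t"
  have X: "X \<ge> 0"
  proof -
    have "0 \<le> real CARD('d) / 2" by simp
    then have "t > 0" "t - real CARD('d) / 2 > 0" using assms by linarith+
    then show ?thesis unfolding X_def by (simp add: Gamma_real_pos less_imp_le)
  qed
  have I: "(LINT k|(lborel :: (real^'d) measure). (bessel_weight t k)\<^sup>2) = pi powr (real CARD('d) / 2) * X"
    unfolding sq b(2) by (simp add: X_def)
  have "(2 * pi) powr (- real CARD('d) / 2) * sqrt (LINT k|(lborel :: (real^'d) measure). (bessel_weight t k)\<^sup>2)
      = (2 * pi) powr (- real CARD('d) / 2) * (pi powr (real CARD('d) / 2)) powr (1 / 2) * sqrt X"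
    unfolding I real_sqrt_mult by (simp add: powr_half_sqrt)
  also have "\<dots> = 1 / (4 * pi) powr (real CARD('d) / 4) * sqrt X" by (subst two_pi_normalization) auto
  finally show "(2 * pi) powr (- real CARD('d) / 2) * sqrt (LINT k|(lborel :: (real^'d) measure). (bessel_weight t k)\<^sup>2) = S_const \<infinity> t CARD('d)"
    by (simp add: S_const_def X_def)
qed

lemma young_const_power:
  assumes "0 < l" "l < 1"
  shows "young_const l ^ d = (E_fun l / E_fun (1 - l)) powr (real d / 2)"
proof -
  have p: "l powr l / (1 - l) powr (1 - l) > 0" using assms by simp
  have "young_const l ^ d = young_const l powr real d"
    using young_const_pos[OF assms] by (simp add: powr_realpow)
  also have "\<dots> = ((l powr l / (1 - l) powr (1 - l)) powr (1 / 2)) powr real d"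
    using p by (simp add: young_const_def powr_half_sqrt)
  also have "\<dots> = (E_fun l / E_fun (1 - l)) powr (real d / 2)"
    using assms by (simp add: powr_powr E_fun_def)
  finally show ?thesis .
qed

lemma weight_integral:
  assumes t: "t / (1 - 2 / r) > real CARD('d::finite) / 2" and r: "r > 2"
  shows "integrable lborel (\<lambda>k::real^'d. bessel_weight t k powr (2 / (1 - 2 * (1 / r))))"
    "(LINT k|(lborel :: (real^'d) measure). bessel_weight t k powr (2 / (1 - 2 * (1 / r))))
       = pi powr (real CARD('d) / 2) * (Gamma (t / (1 - 2 / r) - real CARD('d) / 2) / Gamma (t / (1 - 2 / r)))"
proof -
  have e: "bessel_weight t k powr (2 / (1 - 2 * (1 / r))) = (1 + (norm k)\<^sup>2) powr (- (t / (1 - 2 / r)))" for k :: "real^'d"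
    unfolding bessel_weight_powr by simp
  have t': "real DIM(real^'d) / 2 < t / (1 - 2 / r)" using t by simp
  show "integrable lborel (\<lambda>k::real^'d. bessel_weight t k powr (2 / (1 - 2 * (1 / r))))"
    unfolding e by (rule integrable_bessel_weight(1)[OF t'])
  show "(LINT k|(lborel :: (real^'d) measure). bessel_weight t k powr (2 / (1 - 2 * (1 / r))))
       = pi powr (real CARD('d) / 2) * (Gamma (t / (1 - 2 / r) - real CARD('d) / 2) / Gamma (t / (1 - 2 / r)))"
    unfolding e integrable_bessel_weight(2)[OF t'] by simp
qed

text \<open>
  The endpoints use the Cauchy-Schwarz bound. In between, \<open>1/p + 1/q = 1/2\<close> turns the
  normalization of the Fourier transform and the powers of \<open>pi\<close> from the weights into the powers
  of \<open>4 pi\<close> of the two constants.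
\<close>

lemma K0_le_S_const:
  assumes mn: "0 \<le> m" "0 \<le> n" and p: "p \<in> R_pair_defined m n CARD('d::finite)"
  shows "K0 TYPE('d) m n \<le> S_const p m CARD('d) * S_const (dual_exponent p) n CARD('d)"
proof -
  let ?d = "CARD('d)"
  let ?c = "(2 * pi) powr (- real CARD('d) / 2)"
  let ?wm = "bessel_weight m :: real^'d \<Rightarrow> real"
  let ?wn = "bessel_weight n :: real^'d \<Rightarrow> real"
  have S: "S_defined p m ?d" "S_defined (dual_exponent p) n ?d" and R: "p \<in> R_set m ?d"
    using p by (auto simp: R_pair_defined_def R_pair_def)
  note w0 = bessel_weight_bounds(1)[THEN less_imp_le]
  have close: "K0 TYPE('d) m n \<le> ?c * B" if "trilinear_bound ?wm ?wn B" "B \<ge> 0" for B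
    using that by (intro K0_le product_bound_of_trilinear_bound mn) auto
  from R_set_ge_2[OF R] show ?thesis
  proof (cases rule: dual_exponent_cases)
    case two
    then have n: "n > real ?d / 2" using S(2) S_defined_infinity by simp
    have "trilinear_bound ?wn ?wm (sqrt (LINT x|lborel. (?wn x)\<^sup>2))"
      by (rule trilinear_bound_square_integrable_left)
        (use bessel_weight_square_integrable(1)[OF n] w0 bessel_weight_bounds(2)[OF mn(1)] in auto)
    then have "trilinear_bound ?wm ?wn (sqrt (LINT x|lborel. (?wn x)\<^sup>2))"
      by (rule trilinear_bound_commute[rotated 2]) measurable
    then have "K0 TYPE('d) m n \<le> ?c * sqrt (LINT x|lborel. (?wn x)\<^sup>2)" by (rule close) simp
    moreover have "S_const p m ?d = 1" using two(1) by (simp add: S_const_def)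
    ultimately show ?thesis unfolding bessel_weight_square_integrable(2)[OF n] two(2) by simp
  next
    case infinity
    then have m: "m > real ?d / 2" using S(1) S_defined_infinity by simp
    have "trilinear_bound ?wm ?wn (sqrt (LINT x|lborel. (?wm x)\<^sup>2))"
      by (rule trilinear_bound_square_integrable_left)
        (use bessel_weight_square_integrable(1)[OF m] w0 bessel_weight_bounds(2)[OF mn(2)] in auto)
    then have "K0 TYPE('d) m n \<le> ?c * sqrt (LINT x|lborel. (?wm x)\<^sup>2)" by (rule close) simp
    moreover have "S_const (dual_exponent p) n ?d = 1" using infinity(2) by (simp add: S_const_def)
    ultimately show ?thesis unfolding bessel_weight_square_integrable(2)[OF m] using infinity(1) by simp
  next
    case (real r s)
    have tm: "m / (1 - 2 / r) > real ?d / 2" using S(1) real by (intro S_defined_real) auto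
    have tn: "n / (1 - 2 / s) > real ?d / 2" using S(2) real by (intro S_defined_real) auto
    define X where "X = Gamma (m / (1 - 2 / r) - real ?d / 2) / Gamma (m / (1 - 2 / r))"
    define Y where "Y = Gamma (n / (1 - 2 / s) - real ?d / 2) / Gamma (n / (1 - 2 / s))"
    define P where "P = pi powr (real ?d / 2)"
    define E1 where "E1 = (E_fun (1 / r) / E_fun (1 - 1 / r)) powr (real ?d / 2)"
    define E2 where "E2 = (E_fun (1 / s) / E_fun (1 - 1 / s)) powr (real ?d / 2)"
    have lr: "0 < 1 / r" "1 / r < 1" "0 < 1 / s" "1 / s < 1" using real by auto
    have E: "young_const (1 / r) ^ ?d = E1" "young_const (1 / s) ^ ?d = E2"
      unfolding E1_def E2_def by (rule young_const_power lr)+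
    note I1 = weight_integral[OF tm \<open>r > 2\<close>, folded X_def P_def] and I2 = weight_integral[OF tn \<open>s > 2\<close>, folded Y_def P_def]
    have "trilinear_bound ?wm ?wn ((young_const (1 / r) * young_const (1 / s)) ^ DIM(real^'d) *
        ((LINT k|lborel. ?wm k powr (2 / (1 - 2 * (1 / r)))) powr (1/2 - 1 / r) * (LINT k|lborel. ?wn k powr (2 / (1 - 2 * (1 / s)))) powr (1/2 - 1 / s)))"
      by (rule trilinear_bound_sharp_young) (use real lr I1(1) I2(1) w0 in auto)
    then have tb: "trilinear_bound ?wm ?wn (E1 * E2 * ((P * X) powr (1/2 - 1 / r) * (P * Y) powr (1/2 - 1 / s)))"
      unfolding I1(2) I2(2) by (simp add: power_mult_distrib E)
    have "K0 TYPE('d) m n \<le> ?c * (E1 * E2 * ((P * X) powr (1/2 - 1 / r) * (P * Y) powr (1/2 - 1 / s)))"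
      by (rule close[OF tb]) (simp add: E1_def E2_def)
    also have "\<dots> = (?c * (P powr (1/2 - 1 / r) * P powr (1/2 - 1 / s))) * (X powr (1/2 - 1 / r) * E1) * (Y powr (1/2 - 1 / s) * E2)"
      by (simp only: powr_mult mult_ac)
    also have "P powr (1/2 - 1 / r) * P powr (1/2 - 1 / s) = P powr (1 / 2)"
    proof -
      have "(1/2 - 1 / r) + (1/2 - 1 / s) = 1 / 2" using real(5) by linarith
      then show ?thesis by (simp only: powr_add[symmetric])
    qed
    also have "?c * P powr (1 / 2) = 1 / (4 * pi) powr (real ?d / 4)"
      unfolding P_def by (rule two_pi_normalization) simp
    also have "(4 * pi) powr (real ?d / 4) = (4 * pi) powr (real ?d / 4 - real ?d / (2 * r)) * (4 * pi) powr (real ?d / 4 - real ?d / (2 * s))"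
    proof -
      have "real ?d / (2 * r) + real ?d / (2 * s) = real ?d / 2 * (1 / r + 1 / s)" by (simp add: distrib_left)
      also have "\<dots> = real ?d / 4" unfolding real(5) by simp
      finally have "(real ?d / 4 - real ?d / (2 * r)) + (real ?d / 4 - real ?d / (2 * s)) = real ?d / 4" by linarith
      then show ?thesis by (simp only: powr_add[symmetric])
    qed
    finally have "K0 TYPE('d) m n \<le> (1 / (4 * pi) powr (real ?d / 4 - real ?d / (2 * r)) * X powr (1/2 - 1 / r) * E1)
       * (1 / (4 * pi) powr (real ?d / 4 - real ?d / (2 * s)) * Y powr (1/2 - 1 / s) * E2)"
      by (simp add: mult_ac)
    moreover have "S_const p m ?d = 1 / (4 * pi) powr (real ?d / 4 - real ?d / (2 * r)) * X powr (1/2 - 1 / r) * E1"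
      unfolding real(1) using \<open>r > 2\<close> by (simp add: S_const_def Let_def X_def E1_def)
    moreover have "S_const (dual_exponent p) n ?d = 1 / (4 * pi) powr (real ?d / 4 - real ?d / (2 * s)) * Y powr (1/2 - 1 / s) * E2"
      unfolding real(2) using \<open>s > 2\<close> by (simp add: S_const_def Let_def Y_def E2_def)
    ultimately show ?thesis by simp
  qed
qed

text \<open>
  In terms of the inverse exponent \<open>y = 1/r\<close> the condition on \<open>r\<close> is \<open>1/2 - t/d < y < 1/2\<close>.
\<close>

lemma exponent_admissible:
  assumes t: "0 \<le> t" "t \<le> real d / 2" and d: "d > 0" and y: "0 < y" "y < 1 / 2" "1 / 2 - t / real d < y"
  shows "ereal (1 / y) \<in> R_set t d" "S_defined (ereal (1 / y)) t d"
proof -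
  have g: "1 / y > 2" using y by (simp add: pos_less_divide_eq)
  have "1 / y < real d / (real d / 2 - t)" if "t < real d / 2"
  proof -
    have "(real d / 2 - t) < y * real d" using y(3) d by (simp add: field_simps)
    then show ?thesis using that y by (simp add: field_simps)
  qed
  then show "ereal (1 / y) \<in> R_set t d" "S_defined (ereal (1 / y)) t d"
    using g t by (auto simp: R_set_def S_defined_def)
qed

text \<open>
  If \<open>n > d/2\<close>, then \<open>p = 2\<close> is admissible. Otherwise \<open>x = 1/p\<close> has to satisfy
  \<open>1/2 - m/d < x\<close> and, for the dual exponent, \<open>1/2 - n/d < 1/2 - x\<close>, as well as \<open>0 < x < 1/2\<close>; these
  intervals overlap.
\<close>

lemma R_pair_defined_nonempty:
  fixes d :: nat
  assumes mn: "0 \<le> m" "m \<le> n" "m + n > real d / 2" and d: "d > 0"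
  shows "R_pair_defined m n d \<noteq> {}"
proof (cases "n > real d / 2")
  case True
  have D: "dual_exponent 2 = \<infinity>"
    by (cases "2::ereal" rule: dual_exponent_cases) auto
  then have D': "dual_exponent (ereal 2) = \<infinity>" by simp
  have "2 \<in> R_set m d"
  proof -
    have "2 \<le> real d / (real d / 2 - m)" if "m < real d / 2"
      using that mn(1) by (simp add: pos_le_divide_eq)
    then show ?thesis by (auto simp: R_set_def)
  qed
  then have "2 \<in> R_pair_defined m n d"
    using True mn by (auto simp: R_pair_defined_def R_pair_def D D' R_set_def S_defined_def)
  then show ?thesis by blast
next
  case False
  then have n: "n \<le> real d / 2" "m \<le> real d / 2" and m: "m > 0" using mn by auto
  have "max 0 (1 / 2 - m / real d) < min (1 / 2) (n / real d)"
  proof -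
    have "1 / 2 < (m + n) / real d" using mn(3) d by (simp add: pos_less_divide_eq)
    then have "1 / 2 - m / real d < n / real d" unfolding add_divide_distrib by linarith
    moreover have "0 < n / real d" "0 < m / real d" using m mn d by auto
    ultimately show ?thesis
      unfolding min_less_iff_conj max_less_iff_conj by (intro conjI; linarith)
  qed
  then obtain x where "max 0 (1 / 2 - m / real d) < x" "x < min (1 / 2) (n / real d)" using dense by blast
  then have x: "0 < x" "x < 1 / 2" "1 / 2 - m / real d < x" "1 / 2 - n / real d < 1 / 2 - x" by auto
  have D: "dual_exponent (ereal (1 / x)) = ereal (1 / (1 / 2 - x))"
  proof -
    have "1 / x > 2" using x by (simp add: pos_less_divide_eq)
    then have "ereal (1 / x) \<ge> 2" by simp
    then show ?thesis
    proof (cases rule: dual_exponent_cases)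
      case (real r s)
      have "1 / r = x" using real(1) by auto
      then have "1 / 2 - x = 1 / s" using real(5) by linarith
      then have "1 / (1 / 2 - x) = s" by simp
      then show ?thesis using real by simp
    qed (use \<open>1 / x > 2\<close> in auto)
  qed
  have "ereal (1 / x) \<in> R_pair_defined m n d"
    unfolding R_pair_defined_def R_pair_def mem_Collect_eq D
    by (intro conjI exponent_admissible) (use x n m mn d in auto)
  then show ?thesis by blast
qed

theorem proposition2p4:
  fixes m n :: real
  assumes "0 \<le> m" and "m \<le> n" and "m + n > real CARD('d::finite) / 2"
  shows "R_pair m n CARD('d) \<noteq> {} \<and>
    (\<forall>p \<in> R_pair_defined m n CARD('d).
       K0 TYPE('d) m n \<le> S_const p m CARD('d) * S_const (dual_exponent p) n CARD('d)) \<and>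
    K0 TYPE('d) m n \<le>
      (INF p \<in> R_pair_defined m n CARD('d). S_const p m CARD('d) * S_const (dual_exponent p) n CARD('d))"
proof -
  have ne: "R_pair_defined m n CARD('d) \<noteq> {}"
    by (rule R_pair_defined_nonempty) (use assms in auto)
  have bound: "K0 TYPE('d) m n \<le> S_const p m CARD('d) * S_const (dual_exponent p) n CARD('d)"
    if "p \<in> R_pair_defined m n CARD('d)" for p
    using that assms by (intro K0_le_S_const) auto
  have "R_pair m n CARD('d) \<noteq> {}" using ne by (auto simp: R_pair_defined_def)
  then show ?thesis by (intro conjI ballI bound cINF_greatest[OF ne bound])
qed

end
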